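(* Let $U'=S'e_2'$ be the free $S'$-module of rank one with $\varphi$-semilinear endomorphism $\varphi_{U'}(e_2')=\varepsilon\frac{F}{\varphi(F)}e_2'$, $\varepsilon=(-1)^{(p-1)/2}$. For $l\in\Gamma'=\mathbb{Z}_p^\times$ let $l$ act $\sigma_l$-semilinearly on $U'$ by $e_2'\mapsto\frac{F}{\sigma_l(F)}e_2'$, and for $m\in\mathbb{Z}_p$ let $\gamma^m\in\widehat\Gamma$ act $\widehat\rho(\gamma^m)$-semilinearly on $U'$ by $e_2'\mapsto\frac{F}{\widehat\rho(\gamma^m)(F)}e_2'$. These define a semilinear action $(\rho'*\widehat\rho)_{U'}$ of $\Gamma'\ltimes\widehat\Gamma$ on $U'$ (semilinear with respect to the action $\rho'*\widehat\rho$ of $\Gamma'\ltimes\widehat\Gamma$ on $S'$), and the triple $(U',\varphi_{U'},(\rho'*\widehat\rho)_{U'})$ is an object of $\mathrm{MF}^{[p]_q,q-1}_{[0,0]}(S',\varphi,\Gamma'\ltimes\widehat\Gamma)$ whose reduction modulo $q-1$ is $(U_{B'},\varphi_{U_{B'}})$.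
   Context: $p$ is an odd prime, $R=\mathbb{Z}_p[[q-1]]$; for $a\in\mathbb{Q}\cap\mathbb{Z}_p$, $[a]_q=\frac{q^a-1}{q-1}\in R$ with $q^a=\sum_{i\ge0}\binom ai(q-1)^i$. $h(\lambda)=\sum_{i=0}^{(p-1)/2}\binom{(p-1)/2}{i}^2\lambda^i$; $S'=R\langle\lambda,\frac1{h(\lambda)}\rangle$ is the $(p,q-1)$-adic completion of $R[\lambda,\frac1{h(\lambda)}]$, regarded as a subring of $R[[\lambda]]$; $B'=S'/(q-1)=\mathbb{Z}_p\langle\lambda,\frac1{h(\lambda)}\rangle\subset\mathbb{Z}_p[[\lambda]]$. $\varphi$ is the continuous ring endomorphism of $S'$ and of $R[[\lambda]]$ with $\varphi|_{\mathbb{Z}_p}=\mathrm{id}$, $\varphi(q)=q^p$, $\varphi(\lambda)=\lambda^p$. $\Gamma\cong\mathbb{Z}$ with generator $\gamma$; $\widehat\Gamma=\varprojlim_n\Gamma/\Gamma^{p^n}\cong\mathbb{Z}_p$ acts continuously on $S'$ and on $R[[\lambda]]$ by $R$-algebra automorphisms $\widehat\rho(\gamma^m)$, $\widehat\rho(\gamma^m)(\lambda)=q^m\lambda$ ($m\in\mathbb{Z}_p$). $\Gamma'=\mathbb{Z}_p^\times$ acts (action $\rho'$) by the continuous ring automorphisms $\sigma_l$ with $\sigma_l|_{\mathbb{Z}_p}=\mathrm{id}$, $\sigma_l(q)=q^l$, $\sigma_l(\lambda)=\lambda$. Since $\sigma_l\widehat\rho(\gamma^m)\sigma_l^{-1}=\widehat\rho(\gamma^{ml})$,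 these combine into an action $\rho'*\widehat\rho$ of the semi-direct product $\Gamma'\ltimes\widehat\Gamma$ (formed with the canonical action of $\mathbb{Z}_p^\times$ on $\widehat\Gamma\cong\mathbb{Z}_p$) on $S'$. $F=\sum_{n\ge0}a_n\lambda^n\in R[[\lambda]]$ with $a_n=\prod_{i=0}^{n-1}\Big(\frac{[i+\frac12]_q}{[i+1]_q}\Big)^2$, and $f=F|_{q=1}\in\mathbb{Z}_p[[\lambda]]$. One has $\frac F{\varphi(F)},\frac F{\sigma_l(F)},\frac{F}{\widehat\rho(\gamma^m)(F)}\in S'^\times$. $U'$ is a $q$-deformation of the unit root part $U_{B'}$ of the log de Rham cohomology of the Legendre family $y^2=x(x-1)(x-\lambda)$: the free $B'$-module of rank one $U_{B'}=B'\overline e_2'$, $\overline e_2'=\lambda(1-\lambda)\big(\frac1f\frac{df}{d\lambda}\omega-D(\omega)\big)$ (with $\omega=dx/y$ and $D$ the Gauss–Manin derivative along $\frac{d}{d\lambda}$), with $\varphi$-semilinear Frobenius $\varphi_{U_{B'}}(\overline e_2')=\varepsilon\frac f{\varphi(f)}\overline e_2'$; $e_2'$ reduces to $\overline e_2'$. For $G=\Gamma'\ltimes\widehat\Gamma$, an object of $\mathrm{MF}^{[p]_q,q-1}_{[0,0]}(S',\varphi,G)$ is a free $S'$-module $M$ of finite type with a $\varphi$-semilinear endomorphism $\varphi_M$ satisfying $S'\cdot\varphi_M(M)=M$ and a continuous semilinear action of $G$ on $M$ commuting with $\varphi_M$ and with $(g-1)(M)\subset(q-1)M$ for all $g\in G$.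 *)

theory Defs
  imports
    "HOL-Algebra.Module"
    "HOL-Analysis.Product_Topology"
    "HOL-Computational_Algebra.Polynomial_FPS"
    "Berlekamp_Zassenhaus.Finite_Field"
begin

section \<open>The ring of p-adic integers\<close>

text \<open>The prime is \<^term>\<open>CARD('p)\<close> for a type \<^typ>\<open>'p\<close> of class \<^class>\<open>prime_card\<close>, and
  the p-adic integers are the inverse limit of the rings of integers modulo \<^term>\<open>CARD('p) ^ n\<close>,
  residue classes being represented by their least non-negative elements.\<close>

typedef 'p padic_int =
  "{x :: nat \<Rightarrow> int. \<forall>n. 0 \<le> x n \<and> x n < int CARD('p::prime_card) ^ n \<and>
      x (Suc n) mod int CARD('p) ^ n = x n}"
proof -
  have "0 < int CARD('p)" using prime_card_int[where 'a='p] prime_gt_0_int by blast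
  then show ?thesis by (intro exI[of _ "\<lambda>_. 0"]) simp
qed

setup_lifting type_definition_padic_int

lemma prime_card_pow_pos: "0 < int CARD('p::prime_card) ^ n"
  using prime_card_int[where 'a='p] prime_gt_0_int by simp

lemma padic_closed:
  fixes f :: "nat \<Rightarrow> int"
  assumes "\<And>n. f (Suc n) mod int CARD('p::prime_card) ^ n = f n mod int CARD('p) ^ n"
  shows "0 \<le> f n mod int CARD('p) ^ n \<and> f n mod int CARD('p) ^ n < int CARD('p) ^ n \<and>
    (f (Suc n) mod int CARD('p) ^ Suc n) mod int CARD('p) ^ n = f n mod int CARD('p) ^ n"
proof -
  have "(f (Suc n) mod int CARD('p) ^ Suc n) mod int CARD('p) ^ n = f (Suc n) mod int CARD('p) ^ n"
    by (rule mod_mod_cancel) (rule le_imp_power_dvd, simp)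
  then show "0 \<le> f n mod int CARD('p) ^ n \<and> f n mod int CARD('p) ^ n < int CARD('p) ^ n \<and>
    (f (Suc n) mod int CARD('p) ^ Suc n) mod int CARD('p) ^ n = f n mod int CARD('p) ^ n"
    using assms[of n] pos_mod_sign[OF prime_card_pow_pos[where 'p='p]]
      pos_mod_bound[OF prime_card_pow_pos[where 'p='p]] by metis
qed

instantiation padic_int :: (prime_card) comm_ring_1
begin

lift_definition zero_padic_int :: "'a padic_int" is "\<lambda>_. 0"
  using prime_card_pow_pos[where 'p='a] by simp

lift_definition one_padic_int :: "'a padic_int" is "\<lambda>n. 1 mod int CARD('a) ^ n"
  by (rule padic_closed[of "\<lambda>_. 1"]) (rule refl)

lift_definition plus_padic_int :: "'a padic_int \<Rightarrow> 'a padic_int \<Rightarrow> 'a padic_int"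
  is "\<lambda>x y n. (x n + y n) mod int CARD('a) ^ n"
  by (rule padic_closed[of "\<lambda>n. fun1 n + fun2 n" for fun1 fun2]) (metis mod_add_eq)

lift_definition times_padic_int :: "'a padic_int \<Rightarrow> 'a padic_int \<Rightarrow> 'a padic_int"
  is "\<lambda>x y n. (x n * y n) mod int CARD('a) ^ n"
  by (rule padic_closed[of "\<lambda>n. fun1 n * fun2 n" for fun1 fun2]) (metis mod_mult_eq)

lift_definition uminus_padic_int :: "'a padic_int \<Rightarrow> 'a padic_int"
  is "\<lambda>x n. (- x n) mod int CARD('a) ^ n"
  by (rule padic_closed[of "\<lambda>n. - fun1 n" for fun1]) (metis mod_minus_eq)

lift_definition minus_padic_int :: "'a padic_int \<Rightarrow> 'a padic_int \<Rightarrow> 'a padic_int"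
  is "\<lambda>x y n. (x n - y n) mod int CARD('a) ^ n"
  by (rule padic_closed[of "\<lambda>n. fun1 n - fun2 n" for fun1 fun2]) (metis mod_diff_eq)

instance
proof
  fix a b c :: "'a padic_int"
  show "a * b * c = a * (b * c)"
    by transfer (simp add: mod_mult_left_eq mod_mult_right_eq mult.assoc)
  show "a * b = b * a" by transfer (simp add: mult.commute)
  show "1 * a = a" by transfer (auto simp: fun_eq_iff mod_mult_left_eq)
  show "a + b + c = a + (b + c)"
    by transfer (simp add: mod_add_left_eq mod_add_right_eq add.assoc)
  show "a + b = b + a" by transfer (simp add: add.commute)
  show "0 + a = a" by transfer (auto simp: fun_eq_iff)
  show "- a + a = 0" by transfer (simp add: mod_add_left_eq)
  show "a - b = a + - b" by transfer (simp add: mod_add_right_eq)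
  show "(a + b) * c = a * c + b * c"
    by transfer (simp add: mod_mult_left_eq mod_add_eq distrib_right)
  show "(0::'a padic_int) \<noteq> 1"
  proof (transfer, rule notI)
    assume "(\<lambda>_::nat. 0::int) = (\<lambda>n. 1 mod int CARD('a) ^ n)"
    then have "(0::int) = 1 mod int CARD('a) ^ 1" by meson
    moreover have "1 < int CARD('a)"
      using prime_card_int[where 'a='a] prime_gt_1_int by blast
    ultimately show False by simp
  qed
qed

end

lemma prime_power_dvd_mult_cases:
  fixes p a b :: int
  assumes "prime p" "p ^ (m + n) dvd a * b"
  shows "p ^ m dvd a \<or> p ^ n dvd b"
proof (cases "a = 0 \<or> b = 0")
  case False
  with assms have "m + n \<le> multiplicity p (a * b)"
    by (intro multiplicity_geI) auto
  also have "\<dots> = multiplicity p a + multiplicity p b"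
    using assms False by (intro prime_elem_multiplicity_mult_distrib) auto
  finally have "m \<le> multiplicity p a \<or> n \<le> multiplicity p b" by linarith
  with assms False show ?thesis by (auto intro: multiplicity_dvd')
qed auto

lemma padic_coherent:
  assumes "\<forall>n. 0 \<le> x n \<and> x n < int CARD('p::prime_card) ^ n \<and> x (Suc n) mod int CARD('p) ^ n = x n"
  shows "x (n + k) mod int CARD('p) ^ n = x n"
proof (induction k)
  case (Suc k)
  have "x (n + Suc k) mod int CARD('p) ^ n
      = (x (Suc (n + k)) mod int CARD('p) ^ (n + k)) mod int CARD('p) ^ n"
    by (simp add: mod_mod_cancel le_imp_power_dvd)
  also have "\<dots> = x (n + k) mod int CARD('p) ^ n" using assms by simp
  finally show ?case using Suc by simp
qed (use assms in simp)

instance padic_int :: (prime_card) idom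
proof
  fix a b :: "'a padic_int"
  show "a \<noteq> 0 \<Longrightarrow> b \<noteq> 0 \<Longrightarrow> a * b \<noteq> 0"
  proof (transfer, rule notI)
    fix x y :: "nat \<Rightarrow> int"
    let ?p = "int CARD('a)"
    assume x: "\<forall>n. 0 \<le> x n \<and> x n < ?p ^ n \<and> x (Suc n) mod ?p ^ n = x n"
      and y: "\<forall>n. 0 \<le> y n \<and> y n < ?p ^ n \<and> y (Suc n) mod ?p ^ n = y n"
      and "x \<noteq> (\<lambda>_. 0)" "y \<noteq> (\<lambda>_. 0)"
      and xy: "(\<lambda>n. (x n * y n) mod ?p ^ n) = (\<lambda>_. 0)"
    then obtain m n where m: "x m \<noteq> 0" and n: "y n \<noteq> 0" by (meson ext)
    have "?p ^ (m + n) dvd x (m + n) * y (m + n)" using xy by (metis mod_0_imp_dvd)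
    then consider "?p ^ m dvd x (m + n)" | "?p ^ n dvd y (n + m)"
      using prime_power_dvd_mult_cases[OF prime_card_int[where 'a='a]] by (auto simp: add.commute)
    then show False
      by cases (use padic_coherent[OF x, of m n] padic_coherent[OF y, of n m] m n in auto)
  qed
qed


section \<open>Quotients, power series and subrings\<close>

text \<open>The quotient \<^term>\<open>a / b\<close> in an integral domain, for \<^term>\<open>b \<noteq> 0\<close> dividing \<^term>\<open>a\<close>.\<close>

definition quot :: "'a::comm_ring_1 \<Rightarrow> 'a \<Rightarrow> 'a" where
  "quot a b = (THE c. c * b = a)"

lemma quot_eqI: "c * b = a \<Longrightarrow> b \<noteq> 0 \<Longrightarrow> quot a b = c" for a b c :: "'a::idom"
  unfolding quot_def by (rule the_equality) auto

definition coeff_map :: "('a \<Rightarrow> 'b) \<Rightarrow> 'a fps \<Rightarrow> 'b fps" where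
  "coeff_map g F = Abs_fps (\<lambda>n. g (fps_nth F n))"

text \<open>A subring \<^term>\<open>A\<close> of a ring type as a ring, and as a module over itself.\<close>

definition ring_on :: "'a::comm_ring_1 set \<Rightarrow> 'a ring" where
  "ring_on A = \<lparr>carrier = A, mult = (*), one = 1, zero = 0, add = (+)\<rparr>"

definition module_on :: "'a::comm_ring_1 set \<Rightarrow> ('a, 'a) module" where
  "module_on A = \<lparr>carrier = A, mult = (*), one = 1, zero = 0, add = (+), smult = (*)\<rparr>"


section \<open>Modules and adic topologies\<close>

definition module_span :: "('a, 'm) ring_scheme \<Rightarrow> ('a, 'b, 'n) module_scheme \<Rightarrow> 'b set \<Rightarrow> 'b set" where
  "module_span S M X = \<Inter>{N. submodule N S M \<and> X \<subseteq> N}"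

definition free_of_finite_type :: "('a, 'm) ring_scheme \<Rightarrow> ('a, 'b, 'n) module_scheme \<Rightarrow> bool" where
  "free_of_finite_type S M \<longleftrightarrow> (\<exists>E. finite E \<and> E \<subseteq> carrier M \<and>
     (\<forall>x\<in>carrier M. \<exists>!c. c \<in> E \<rightarrow>\<^sub>E carrier S \<and> x = (\<Oplus>\<^bsub>M\<^esub>e\<in>E. c e \<odot>\<^bsub>M\<^esub> e)))"

text \<open>The submodule \<open>J\<^sup>n M\<close>, where the ideal \<open>J\<close> is given by a set of generators.\<close>

primrec adic_power ::
  "('a, 'm) ring_scheme \<Rightarrow> ('a, 'b, 'n) module_scheme \<Rightarrow> 'a set \<Rightarrow> nat \<Rightarrow> 'b set" where
  "adic_power S M J 0 = carrier M"
| "adic_power S M J (Suc n) =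
     module_span S M {a \<odot>\<^bsub>M\<^esub> x | a x. a \<in> J \<and> x \<in> adic_power S M J n}"

definition adic_topology ::
  "('a, 'm) ring_scheme \<Rightarrow> ('a, 'b, 'n) module_scheme \<Rightarrow> 'a set \<Rightarrow> 'b topology" where
  "adic_topology S M J = topology (\<lambda>U. U \<subseteq> carrier M \<and>
     (\<forall>x\<in>U. \<exists>n. \<forall>y\<in>adic_power S M J n. x \<oplus>\<^bsub>M\<^esub> y \<in> U))"

text \<open>For a subring \<open>A\<close> of a \<open>J\<close>-adically complete and separated ring type, with \<open>J \<subseteq> A\<close>: the image
  in that ring of the \<open>J\<close>-adic completion of \<open>A\<close>. An element of the completion is represented by
  a sequence in \<open>A\<close> which is Cauchy for the \<open>J\<close>-adic topology of \<open>A\<close> itself.\<close>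

definition completion_in :: "'a::comm_ring_1 set \<Rightarrow> 'a set \<Rightarrow> 'a set" where
  "completion_in A J = {x. \<exists>y. \<forall>n. y n \<in> A
     \<and> y (Suc n) - y n \<in> adic_power (ring_on A) (module_on A) J n
     \<and> x - y n \<in> adic_power (ring_on UNIV) (module_on UNIV) J n}"


section \<open>Semilinear actions and the category MF\<close>

definition semilinear_map ::
  "('a, 'm) ring_scheme \<Rightarrow> ('a \<Rightarrow> 'c) \<Rightarrow> ('a, 'b, 'n) module_scheme \<Rightarrow>
   ('c, 'd, 'k) module_scheme \<Rightarrow> ('b \<Rightarrow> 'd) \<Rightarrow> bool" where
  "semilinear_map S s M N f \<longleftrightarrow>
     (\<forall>x\<in>carrier M. f x \<in> carrier N) \<and>
     (\<forall>x\<in>carrier M. \<forall>y\<in>carrier M. f (x \<oplus>\<^bsub>M\<^esub> y) = f x \<oplus>\<^bsub>N\<^esub> f y) \<and>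
     (\<forall>a\<in>carrier S. \<forall>x\<in>carrier M. f (a \<odot>\<^bsub>M\<^esub> x) = s a \<odot>\<^bsub>N\<^esub> f x)"

definition acts_on :: "('g, 'm) monoid_scheme \<Rightarrow> 'b set \<Rightarrow> ('g \<Rightarrow> 'b \<Rightarrow> 'b) \<Rightarrow> bool" where
  "acts_on G X act \<longleftrightarrow>
     (\<forall>g\<in>carrier G. \<forall>x\<in>X. act g x \<in> X) \<and>
     (\<forall>x\<in>X. act \<one>\<^bsub>G\<^esub> x = x) \<and>
     (\<forall>g\<in>carrier G. \<forall>h\<in>carrier G. \<forall>x\<in>X. act (g \<otimes>\<^bsub>G\<^esub> h) x = act g (act h x))"

definition acts_by_ring_automorphisms ::
  "('a, 'm) ring_scheme \<Rightarrow> ('g, 'k) monoid_scheme \<Rightarrow> ('g \<Rightarrow> 'a \<Rightarrow> 'a) \<Rightarrow> bool" where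
  "acts_by_ring_automorphisms S G act \<longleftrightarrow>
     acts_on G (carrier S) act \<and> (\<forall>g\<in>carrier G. act g \<in> Ring.ring_hom S S)"

text \<open>\<open>act\<close> is the action on the ring, \<open>actM\<close> the action on the module.\<close>

definition semilinear_action ::
  "('a, 'm) ring_scheme \<Rightarrow> ('g, 'k) monoid_scheme \<Rightarrow> ('g \<Rightarrow> 'a \<Rightarrow> 'a) \<Rightarrow>
   ('a, 'b, 'n) module_scheme \<Rightarrow> ('g \<Rightarrow> 'b \<Rightarrow> 'b) \<Rightarrow> bool" where
  "semilinear_action S G act M actM \<longleftrightarrow>
     group G \<and> acts_by_ring_automorphisms S G act \<and> acts_on G (carrier M) actM \<and>
     (\<forall>g\<in>carrier G. semilinear_map S (act g) M M (actM g))"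

text \<open>Objects of \<open>MF\<^bsub>[0,0]\<^esub>\<close> over \<open>(S, \<phi>, G)\<close>, where \<open>p\<close> and \<open>t = q - 1\<close> are elements of \<open>S\<close>,
  \<open>S\<close>-modules carry the \<open>(p, t)\<close>-adic topology, and \<open>T\<close> is the topology of \<open>G\<close>. In the range
  \<open>[0,0]\<close> the element \<open>[p]\<^sub>q\<close> does not enter the conditions.\<close>

definition MF00_object ::
  "('a, 'm) ring_scheme \<Rightarrow> 'a \<Rightarrow> 'a \<Rightarrow> ('a \<Rightarrow> 'a) \<Rightarrow>
   ('g, 'k) monoid_scheme \<Rightarrow> 'g topology \<Rightarrow> ('g \<Rightarrow> 'a \<Rightarrow> 'a) \<Rightarrow>
   ('a, 'b, 'n) module_scheme \<Rightarrow> ('b \<Rightarrow> 'b) \<Rightarrow> ('g \<Rightarrow> 'b \<Rightarrow> 'b) \<Rightarrow> bool" where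
  "MF00_object S p t \<phi> G T act M \<phi>M actM \<longleftrightarrow>
     module S M \<and> free_of_finite_type S M \<and>
     \<phi> \<in> Ring.ring_hom S S \<and> semilinear_map S \<phi> M M \<phi>M \<and>
     module_span S M (\<phi>M ` carrier M) = carrier M \<and>
     semilinear_action S G act M actM \<and>
     continuous_map (prod_topology T (adic_topology S M {p, t})) (adic_topology S M {p, t})
       (\<lambda>(g, x). actM g x) \<and>
     (\<forall>g\<in>carrier G. \<forall>x\<in>carrier M. actM g (\<phi>M x) = \<phi>M (actM g x)) \<and>
     (\<forall>g\<in>carrier G. \<forall>x\<in>carrier M. \<exists>y\<in>carrier M. actM g x \<ominus>\<^bsub>M\<^esub> x = t \<odot>\<^bsub>M\<^esub> y)"

text \<open>\<open>(N, \<phi>N)\<close> over \<open>B\<close> is the reduction of \<open>(M, \<phi>M)\<close> modulo \<open>t \<in> S\<close>: the map \<open>r\<close> identifies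
  \<open>S / tS\<close> with \<open>B\<close>, and the map \<open>\<pi>\<close> identifies \<open>M / tM\<close> with \<open>N\<close>, compatibly with \<open>\<phi>M\<close> and \<open>\<phi>N\<close>.\<close>

definition is_reduction ::
  "('a, 'm) ring_scheme \<Rightarrow> 'a \<Rightarrow> ('a, 'b, 'n) module_scheme \<Rightarrow> ('b \<Rightarrow> 'b) \<Rightarrow>
   ('c, 'k) ring_scheme \<Rightarrow> ('a \<Rightarrow> 'c) \<Rightarrow> ('c, 'd, 'l) module_scheme \<Rightarrow> ('d \<Rightarrow> 'd) \<Rightarrow>
   ('b \<Rightarrow> 'd) \<Rightarrow> bool" where
  "is_reduction S t M \<phi>M B r N \<phi>N \<pi> \<longleftrightarrow>
     r \<in> Ring.ring_hom S B \<and> r ` carrier S = carrier B \<and>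
     {a \<in> carrier S. r a = \<zero>\<^bsub>B\<^esub>} = {t \<otimes>\<^bsub>S\<^esub> a | a. a \<in> carrier S} \<and>
     module S M \<and> module B N \<and>
     semilinear_map S r M N \<pi> \<and> \<pi> ` carrier M = carrier N \<and>
     {x \<in> carrier M. \<pi> x = \<zero>\<^bsub>N\<^esub>} = {t \<odot>\<^bsub>M\<^esub> x | x. x \<in> carrier M} \<and>
     (\<forall>x\<in>carrier M. \<pi> (\<phi>M x) = \<phi>N (\<pi> x))"


section \<open>The ring R and its q-analogues\<close>

text \<open>\<open>R = \<int>\<^sub>p[[q - 1]]\<close> is \<^typ>\<open>'p padic_int fps\<close>, with \<^term>\<open>fps_X\<close> in the role of \<open>q - 1\<close>.
  Then \<open>R[[\<lambda>]]\<close> is \<^typ>\<open>'p padic_int fps fps\<close>, where \<open>\<lambda>\<close> is the outer \<^term>\<open>fps_X\<close>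
  and \<open>q - 1\<close> is \<^term>\<open>fps_const fps_X\<close>.\<close>

definition padic_binom :: "'p::prime_card padic_int \<Rightarrow> nat \<Rightarrow> 'p padic_int" where
  "padic_binom a i = quot (\<Prod>j<i. a - of_nat j) (of_nat (fact i))"

definition q_power :: "'p::prime_card padic_int \<Rightarrow> 'p padic_int fps" where
  "q_power a = Abs_fps (padic_binom a)"

definition q_number :: "'p::prime_card padic_int \<Rightarrow> 'p padic_int fps" where
  "q_number a = quot (q_power a - 1) fps_X"

text \<open>The endomorphisms of \<open>R[[\<lambda>]]\<close>. On \<open>R\<close>, \<open>q \<mapsto> q\<^sup>p\<close> and \<open>q \<mapsto> q\<^sup>l\<close> are given by
  substituting \<open>q\<^sup>p - 1\<close> and \<open>q\<^sup>l - 1\<close> for \<open>q - 1\<close>.\<close>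

definition frob :: "'p::prime_card padic_int fps fps \<Rightarrow> 'p padic_int fps fps" where
  "frob F = fps_compose (coeff_map (\<lambda>c. fps_compose c ((1 + fps_X) ^ CARD('p) - 1)) F)
              (fps_X ^ CARD('p))"

definition sigma ::
  "'p::prime_card padic_int \<Rightarrow> 'p padic_int fps fps \<Rightarrow> 'p padic_int fps fps" where
  "sigma l F = coeff_map (\<lambda>c. fps_compose c (q_power l - 1)) F"

definition rho ::
  "'p::prime_card padic_int \<Rightarrow> 'p padic_int fps fps \<Rightarrow> 'p padic_int fps fps" where
  "rho m F = fps_compose F (fps_const (q_power m) * fps_X)"

text \<open>The Frobenius of \<open>\<int>\<^sub>p[[\<lambda>]]\<close> and the map \<open>R[[\<lambda>]] \<rightarrow> \<int>\<^sub>p[[\<lambda>]]\<close>, \<open>q \<mapsto> 1\<close>.\<close>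

definition frob1 :: "'p::prime_card padic_int fps \<Rightarrow> 'p padic_int fps" where
  "frob1 f = fps_compose f (fps_X ^ CARD('p))"

definition at_q1 :: "'p::prime_card padic_int fps fps \<Rightarrow> 'p padic_int fps" where
  "at_q1 F = coeff_map (\<lambda>c. fps_nth c 0) F"

definition h_poly :: "nat \<Rightarrow> 'a::comm_ring_1 poly" where
  "h_poly p = (\<Sum>i\<le>(p - 1) div 2. Polynomial.monom (of_nat ((((p - 1) div 2) choose i)\<^sup>2)) i)"

text \<open>\<open>A[\<lambda>, 1/h]\<close> as a subring of \<open>A[[\<lambda>]]\<close>; this makes sense because \<open>h\<close> has constant term 1.\<close>

definition poly_localization :: "'a::comm_ring_1 poly \<Rightarrow> 'a fps set" where
  "poly_localization h = {quot (fps_of_poly P) (fps_of_poly h ^ k) | P k. True}"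

definition S' :: "'p::prime_card padic_int fps fps set" where
  "S' = completion_in (poly_localization (h_poly CARD('p))) {of_nat CARD('p), fps_const fps_X}"

definition B' :: "'p::prime_card padic_int fps set" where
  "B' = completion_in (poly_localization (h_poly CARD('p))) {of_nat CARD('p)}"


section \<open>The group\<close>

definition padic_units :: "'p::prime_card padic_int set" where
  "padic_units = {l. l dvd 1}"

text \<open>The pair \<open>(l, m)\<close> stands for \<open>\<gamma>\<^sup>m \<cdot> l\<close>; since \<open>l \<gamma>\<^sup>m l\<^sup>-\<^sup>1 = \<gamma>\<^bsup>lm\<^esup>\<close>, one has
  \<open>(\<gamma>\<^sup>m \<cdot> l)(\<gamma>\<^bsup>m'\<^esup> \<cdot> l') = \<gamma>\<^bsup>m + l m'\<^esup> \<cdot> l l'\<close>. The profinite completion of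
  \<open>\<Gamma>\<close> is identified with the additive group of p-adic integers through \<open>m \<mapsto> \<gamma>\<^sup>m\<close>.\<close>

definition Gamma_semidirect ::
  "('p::prime_card padic_int \<times> 'p padic_int) monoid" where
  "Gamma_semidirect = \<lparr>carrier = padic_units \<times> UNIV,
     mult = (\<lambda>(l, m) (l', m'). (l * l', m + l * m')), one = (1, 0)\<rparr>"

definition padic_topology :: "'p::prime_card padic_int topology" where
  "padic_topology = adic_topology (ring_on UNIV) (module_on UNIV) {of_nat CARD('p)}"

definition Gamma_topology :: "('p::prime_card padic_int \<times> 'p padic_int) topology" where
  "Gamma_topology = prod_topology (subtopology padic_topology padic_units) padic_topology"

definition Gamma_act ::
  "'p::prime_card padic_int \<times> 'p padic_int \<Rightarrow> 'p padic_int fps fps \<Rightarrow> 'p padic_int fps fps" where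
  "Gamma_act = (\<lambda>(l, m). rho m \<circ> sigma l)"


section \<open>The hypergeometric series and the module U'\<close>

definition a_coeff :: "nat \<Rightarrow> 'p::prime_card padic_int fps" where
  "a_coeff n = quot (\<Prod>i<n. (q_number (of_nat i + quot 1 2))\<^sup>2) (\<Prod>i<n. (q_number (of_nat (i + 1)))\<^sup>2)"

definition F_series :: "'p::prime_card padic_int fps fps" where
  "F_series = Abs_fps a_coeff"

definition f_series :: "'p::prime_card padic_int fps" where
  "f_series = at_q1 F_series"

text \<open>The free module \<open>U' = S' e\<^sub>2'\<close> is \<open>S'\<close> as a module over itself, with \<open>e\<^sub>2' = 1\<close>: the
  element \<open>x\<close> stands for \<open>x e\<^sub>2'\<close>.\<close>

definition U' :: "('p::prime_card padic_int fps fps, 'p padic_int fps fps) module" where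
  "U' = module_on S'"

definition e2' :: "'p::prime_card padic_int fps fps" where
  "e2' = 1"

definition U'_frob :: "'p::prime_card padic_int fps fps \<Rightarrow> 'p padic_int fps fps" where
  "U'_frob x = frob x * ((-1) ^ ((CARD('p) - 1) div 2) * quot F_series (frob F_series)) * e2'"

definition U'_sigma ::
  "'p::prime_card padic_int \<Rightarrow> 'p padic_int fps fps \<Rightarrow> 'p padic_int fps fps" where
  "U'_sigma l x = sigma l x * quot F_series (sigma l F_series) * e2'"

definition U'_rho ::
  "'p::prime_card padic_int \<Rightarrow> 'p padic_int fps fps \<Rightarrow> 'p padic_int fps fps" where
  "U'_rho m x = rho m x * quot F_series (rho m F_series) * e2'"

definition U'_act ::
  "'p::prime_card padic_int \<times> 'p padic_int \<Rightarrow> 'p padic_int fps fps \<Rightarrow> 'p padic_int fps fps" where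
  "U'_act = (\<lambda>(l, m). U'_rho m \<circ> U'_sigma l)"


section \<open>The unit root part\<close>

text \<open>The relative de Rham cohomology of \<open>y\<^sup>2 = x(x-1)(x-\<lambda>)\<close> is not constructed. It enters as an
  arbitrary \<open>\<int>\<^sub>p[[\<lambda>]]\<close>-module \<open>H\<close> with a connection \<open>D\<close> along \<open>d/d\<lambda>\<close> and an element \<open>\<omega> = dx/y\<close>, such
  that \<open>\<omega>\<close> and \<open>D \<omega>\<close> are linearly independent and satisfy the Picard-Fuchs equation
  \<open>4\<lambda>(1-\<lambda>) D\<^sup>2\<omega> + 4(1-2\<lambda>) D\<omega> = \<omega>\<close>. The logarithmic cohomology over \<open>B'\<close> is contained in such a
  module, obtained from it by extending scalars to \<open>\<int>\<^sub>p[[\<lambda>]]\<close> and inverting \<open>\<lambda>\<close>.\<close>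

definition legendre_de_rham ::
  "('p::prime_card padic_int fps, 'h) module \<Rightarrow> ('h \<Rightarrow> 'h) \<Rightarrow> 'h \<Rightarrow> bool" where
  "legendre_de_rham H D \<omega> \<longleftrightarrow>
     module (ring_on UNIV) H \<and> \<omega> \<in> carrier H \<and>
     (\<forall>x\<in>carrier H. D x \<in> carrier H) \<and>
     (\<forall>x\<in>carrier H. \<forall>y\<in>carrier H. D (x \<oplus>\<^bsub>H\<^esub> y) = D x \<oplus>\<^bsub>H\<^esub> D y) \<and>
     (\<forall>a. \<forall>x\<in>carrier H. D (a \<odot>\<^bsub>H\<^esub> x) = (fps_deriv a \<odot>\<^bsub>H\<^esub> x) \<oplus>\<^bsub>H\<^esub> (a \<odot>\<^bsub>H\<^esub> D x)) \<and>
     (\<forall>a b. (a \<odot>\<^bsub>H\<^esub> \<omega>) \<oplus>\<^bsub>H\<^esub> (b \<odot>\<^bsub>H\<^esub> D \<omega>) = \<zero>\<^bsub>H\<^esub> \<longrightarrow> a = 0 \<and> b = 0) \<and>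
     ((4 * fps_X * (1 - fps_X)) \<odot>\<^bsub>H\<^esub> D (D \<omega>)) \<oplus>\<^bsub>H\<^esub> ((4 * (1 - 2 * fps_X)) \<odot>\<^bsub>H\<^esub> D \<omega>) = \<omega>"

definition e2_bar :: "('p::prime_card padic_int fps, 'h) module \<Rightarrow> ('h \<Rightarrow> 'h) \<Rightarrow> 'h \<Rightarrow> 'h" where
  "e2_bar H D \<omega> = (fps_X * (1 - fps_X)) \<odot>\<^bsub>H\<^esub>
     ((quot (fps_deriv f_series) f_series \<odot>\<^bsub>H\<^esub> \<omega>) \<ominus>\<^bsub>H\<^esub> D \<omega>)"

definition U_B' ::
  "('p::prime_card padic_int fps, 'h) module \<Rightarrow> ('h \<Rightarrow> 'h) \<Rightarrow> 'h \<Rightarrow> ('p padic_int fps, 'h) module" where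
  "U_B' H D \<omega> = H\<lparr>carrier := {b \<odot>\<^bsub>H\<^esub> e2_bar H D \<omega> | b. b \<in> B'}\<rparr>"

definition U_B'_frob ::
  "('p::prime_card padic_int fps, 'h) module \<Rightarrow> ('h \<Rightarrow> 'h) \<Rightarrow> 'h \<Rightarrow> 'h \<Rightarrow> 'h" where
  "U_B'_frob H D \<omega> x = (let b = (THE b. b \<in> B' \<and> x = b \<odot>\<^bsub>H\<^esub> e2_bar H D \<omega>) in
     (frob1 b * ((-1) ^ ((CARD('p) - 1) div 2) * quot f_series (frob1 f_series)))
       \<odot>\<^bsub>H\<^esub> e2_bar H D \<omega>)"

end

theory Submission
  imports Defs
begin

text \<open>Let \<open>\<phi>\<close> be the Frobenius and \<open>J = (p, q - 1)\<close>. Everything reduces to \<open>F / \<phi>(F) \<in> S'\<^sup>\<times>\<close>: if \<open>g\<close> is an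
  element of the group, then \<open>v = F / g(F)\<close> and \<open>u = F / \<phi>(F)\<close> satisfy \<open>v = (u / g(u)) \<phi>(v)\<close>, and since
  \<open>v\<close> is congruent to 1 modulo \<open>q - 1\<close> and \<open>\<phi>\<^sup>N(q - 1) \<in> J\<^bsup>N + 1\<^esup>\<close>, it is the limit of the products
  \<open>\<Prod> \<phi>\<^sup>n(u / g(u))\<close>. For \<open>u\<close> itself, let \<open>F\<^sub>s\<close> be the truncation of \<open>F\<close> below degree \<open>p\<^sup>s\<close>. The
  coefficients satisfy \<open>a\<^bsub>b + pi\<^esub> = \<phi>(a\<^sub>i) g\<^sub>b(i)\<close>, where \<open>g\<^sub>b(i)\<close> modulo \<open>J\<^bsup>r + 1\<^esup>\<close> depends only on \<open>i\<close>
  modulo \<open>p\<^sup>r\<close>, because q-numbers do and the q-numbers of units are units. This gives the Dwork congruence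
  \<open>F \<phi>(F\<^sub>s) \<equiv> F\<^bsub>s + 1\<^esub> \<phi>(F)\<close> modulo \<open>J\<^bsup>s + 1\<^esup>\<close>. As \<open>F\<^bsub>s + 1\<^esub> \<equiv> h \<phi>(F\<^sub>s)\<close> modulo \<open>J\<close>, all \<open>F\<^sub>s\<close>
  are units of \<open>S'\<close>, hence \<open>u\<close> is the limit of the \<open>F\<^bsub>s + 1\<^esub> / \<phi>(F\<^sub>s)\<close> and is a unit.\<close>

text \<open>S' is defined as a completion for its own adic topology, whereas all estimates are made
  in \<open>R[[\<lambda>]]\<close> with the coefficientwise filtration \<open>fil\<close>. The two
  agree because \<open>x = emb (at_q1 x) + tt * tshift x\<close> does not leave the subring, and
  neither does division by p at q = 1. So S' is the closure of \<open>A2\<close> in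
  \<open>R[[\<lambda>]]\<close>, and membership is shown by approximation. The Dwork congruence
  rests on antisymmetry. In each degree the difference is a sum over j of products of coefficients
  at j and N - j, weighted by an antisymmetric kernel E(j, N - j). The complete sum would vanish;
  the difficulty is that j is cut off at \<open>p^s\<close>. Splitting off the last base-p digits of
  j and N - j gives a sum of the same kind with a new antisymmetric kernel, better by one power of
  J, and with s lowered by one. Since \<phi> moves R, each digit also twists the coefficients by
  \<phi>, so the induction treats a whole family of twisted sequences. The ratio v needs an argument
  of its own because \<phi> preserves the powers of J without improving them: the gain comes only
  from \<open>\<phi>^N(q - 1) = (q - 1) [p^N]_q\<close>, so the error must be carried as an exact
  multiple of this element.\<close>

unbundle fps_syntax

section \<open>Divisibility by p in the p-adic integers\<close>

abbreviation pp :: "'p::prime_card padic_int" where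
  "pp \<equiv> of_nat CARD('p)"

lemma padic_rep:
  fixes x :: "'p::prime_card padic_int"
  shows "0 \<le> Rep_padic_int x n" "Rep_padic_int x n < int CARD('p) ^ n"
    "Rep_padic_int x (n + k) mod int CARD('p) ^ n = Rep_padic_int x n"
  using Rep_padic_int[of x] padic_coherent[of "Rep_padic_int x" n k] by auto

lemma padic_rep_of_nat:
  "Rep_padic_int (of_nat m :: 'p::prime_card padic_int) n = int m mod int CARD('p) ^ n"
proof (induction m)
  case (Suc m)
  then show ?case
    by (simp add: plus_padic_int.rep_eq one_padic_int.rep_eq mod_add_eq)
qed (simp add: zero_padic_int.rep_eq)

lemma padic_rep_diff:
  fixes x y :: "'p::prime_card padic_int"
  shows "Rep_padic_int (x - y) n = 0 \<longleftrightarrow> Rep_padic_int x n = Rep_padic_int y n"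
proof -
  have "Rep_padic_int (x - y) n = 0 \<longleftrightarrow>
      Rep_padic_int x n mod int CARD('p) ^ n = Rep_padic_int y n mod int CARD('p) ^ n"
    by (simp add: minus_padic_int.rep_eq mod_eq_dvd_iff dvd_eq_mod_eq_0)
  then show ?thesis by (simp add: padic_rep)
qed

lemma padic_pow_dvd_iff:
  fixes x :: "'p::prime_card padic_int"
  shows "pp ^ n dvd x \<longleftrightarrow> Rep_padic_int x n = 0"
proof
  assume "pp ^ n dvd x"
  then obtain y where "x = of_nat (CARD('p) ^ n) * y" by (auto simp: dvd_def)
  then show "Rep_padic_int x n = 0"
    by (simp only: times_padic_int.rep_eq padic_rep_of_nat) simp
next
  let ?p = "int CARD('p)"
  assume 0: "Rep_padic_int x n = 0"
  \<comment> \<open>The residue of \<open>x / p^n\<close> modulo \<open>p^k\<close> is read off from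
    x modulo \<open>p^(n + k)\<close>; the index shift pays for the division.\<close>
  define y where "y k = Rep_padic_int x (n + k) div ?p ^ n" for k
  have mult: "?p ^ n * y k = Rep_padic_int x (n + k)" for k
    using padic_rep(3)[of x n k] 0 unfolding y_def by auto
  have pos: "0 < ?p ^ k" for k by (rule prime_card_pow_pos)
  have y: "0 \<le> y k \<and> y k < ?p ^ k \<and> y (Suc k) mod ?p ^ k = y k" for k
  proof (intro conjI)
    show "0 \<le> y k" unfolding y_def using padic_rep(1) pos pos_imp_zdiv_nonneg_iff by blast
    have "?p ^ n * y k < ?p ^ n * ?p ^ k"
      using mult padic_rep(2)[of x "n + k"] by (simp add: power_add)
    then show "y k < ?p ^ k" using pos by simp
    have "?p ^ n * (y (Suc k) mod ?p ^ k) = (?p ^ n * y (Suc k)) mod (?p ^ n * ?p ^ k)"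
      by (rule mult_mod_right)
    also have "\<dots> = Rep_padic_int x ((n + k) + 1) mod ?p ^ (n + k)"
      using mult by (simp add: power_add)
    also have "\<dots> = ?p ^ n * y k" using padic_rep(3)[of x "n + k" 1] mult by simp
    finally show "y (Suc k) mod ?p ^ k = y k" using pos[of n] by simp
  qed
  define z :: "'p padic_int" where "z = Abs_padic_int y"
  have z: "Rep_padic_int z = y" unfolding z_def using y by (intro Abs_padic_int_inverse) auto
  have "Rep_padic_int (of_nat (CARD('p) ^ n) * z) k = Rep_padic_int x k" for k
  proof -
    have "Rep_padic_int (of_nat (CARD('p) ^ n) * z) k = (?p ^ n * y k) mod ?p ^ k"
      unfolding times_padic_int.rep_eq padic_rep_of_nat z by (simp add: mod_mult_left_eq)
    also have "\<dots> = Rep_padic_int x (k + n) mod ?p ^ k" using mult by (simp add: add.commute)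
    finally show ?thesis by (simp only: padic_rep(3))
  qed
  then have "x = of_nat (CARD('p) ^ n) * z" by (metis Rep_padic_int_inject ext)
  then show "pp ^ n dvd x" by simp
qed

lemma padic_approx:
  fixes x :: "'p::prime_card padic_int"
  obtains m where "pp ^ n dvd x - of_nat m"
proof
  show "pp ^ n dvd x - of_nat (nat (Rep_padic_int x n))"
    unfolding padic_pow_dvd_iff padic_rep_diff padic_rep_of_nat
    using padic_rep[of x n] by simp
qed

lemma padic_pow_dvd_of_nat_iff:
  "(pp ^ n :: 'p::prime_card padic_int) dvd of_nat m \<longleftrightarrow> CARD('p) ^ n dvd m"
  unfolding padic_pow_dvd_iff padic_rep_of_nat
  by (metis dvd_eq_mod_eq_0 of_nat_dvd_iff of_nat_power)

lemma padic_dvd_of_nat_iff: "(pp :: 'p::prime_card padic_int) dvd of_nat m \<longleftrightarrow> CARD('p) dvd m"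
  using padic_pow_dvd_of_nat_iff[where 'p='p and n=1] by simp

instance padic_int :: (prime_card) ring_char_0
proof
  have "m = n" if le: "m \<le> n" and eq: "(of_nat m :: 'a padic_int) = of_nat n" for m n
  proof -
    have "(of_nat (n - m) :: 'a padic_int) = 0" using le eq by (simp add: of_nat_diff)
    \<comment> \<open>The exponent is the difference itself: as \<open>N < p^N\<close>, only N = 0
      can be divisible by \<open>p^N\<close>.\<close>
    then have "(pp ^ (n - m) :: 'a padic_int) dvd of_nat (n - m)" by simp
    then have "CARD('a) ^ (n - m) dvd n - m" using padic_pow_dvd_of_nat_iff by blast
    moreover have "n - m < CARD('a) ^ (n - m)"
      using prime_gt_1_nat[OF prime_card[where 'a='a]] by (intro power_gt_expt) simp
    ultimately have "n - m = 0" by (meson dvd_imp_le leD not_gr_zero)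
    then show ?thesis using le by simp
  qed
  then show "inj (of_nat :: nat \<Rightarrow> 'a padic_int)" by (metis injI nat_le_linear)
qed

text \<open>An inverse modulo \<open>p^n\<close> is unique once normalised to lie between 0 and
  \<open>p^n\<close>, so the inverses chosen level by level are automatically coherent.\<close>

lemma padic_unit_iff:
  fixes x :: "'p::prime_card padic_int"
  shows "x dvd 1 \<longleftrightarrow> \<not> pp dvd x"
proof
  assume "x dvd 1"
  then show "\<not> pp dvd x"
    using padic_dvd_of_nat_iff[where 'p='p and m=1] prime_card[where 'a='p]
    by (metis dvd_trans not_prime_unit of_nat_1 nat_dvd_1_iff_1 One_nat_def not_prime_1)
next
  let ?p = "int CARD('p)" and ?x = "Rep_padic_int x"
  assume "\<not> pp dvd x"
  then have "?x 1 \<noteq> 0" using padic_pow_dvd_iff[of 1 x] by simp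
  have cop: "coprime (?x n) (?p ^ n)" for n
  proof (cases n)
    case (Suc m)
    have "\<not> ?p dvd ?x n"
      using padic_rep(3)[of x 1 m] \<open>?x 1 \<noteq> 0\<close> Suc by (auto simp: dvd_eq_mod_eq_0)
    then show ?thesis
      using prime_card_int[where 'a='p]
      by (intro coprime_power_right_iff[THEN iffD2]) (metis coprime_commute prime_imp_coprime)
  qed simp
  have "\<exists>y. 0 \<le> y \<and> y < ?p ^ n \<and> (?x n * y) mod ?p ^ n = 1 mod ?p ^ n" for n
  proof -
    obtain y where "[?x n * y = 1] (mod ?p ^ n)" using cop[of n] cong_solve_coprime_int by blast
    then show ?thesis
      using prime_card_pow_pos[where 'p='p, of n]
      by (intro exI[of _ "y mod ?p ^ n"]) (simp add: cong_def mod_mult_right_eq)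
  qed
  then obtain y where y: "\<And>n. 0 \<le> y n \<and> y n < ?p ^ n \<and> (?x n * y n) mod ?p ^ n = 1 mod ?p ^ n"
    by metis
  have coh: "y (Suc n) mod ?p ^ n = y n" for n
  proof -
    have "[?x n * y (Suc n) = ?x (n + 1) * y (Suc n)] (mod ?p ^ n)"
      using padic_rep(3)[of x n 1] by (metis cong_def mod_mult_left_eq)
    also have "[?x (n + 1) * y (Suc n) = 1] (mod ?p ^ n)"
      using y[of "Suc n"] by (metis Suc_eq_plus1 cong_def cong_dvd_modulus le_add1 le_imp_power_dvd)
    also have "[1 = ?x n * y n] (mod ?p ^ n)" using y[of n] by (simp add: cong_def)
    finally have "[y (Suc n) = y n] (mod ?p ^ n)" using cop cong_mult_lcancel by blast
    then show ?thesis using y[of n] by (simp add: cong_def)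
  qed
  define z :: "'p padic_int" where "z = Abs_padic_int y"
  have "Rep_padic_int z = y" unfolding z_def using y coh by (intro Abs_padic_int_inverse) auto
  then have "Rep_padic_int (x * z) = Rep_padic_int (1 :: 'p padic_int)"
    using y by (auto simp: times_padic_int.rep_eq one_padic_int.rep_eq)
  then show "x dvd 1" by (metis Rep_padic_int_inject dvdI)
qed

lemma padic_of_nat_unit: "\<not> CARD('p) dvd n \<Longrightarrow> (of_nat n :: 'p::prime_card padic_int) dvd 1"
  by (simp add: padic_unit_iff padic_dvd_of_nat_iff)

text \<open>Makes divisibility by an integer such as \<open>fact i\<close> a condition modulo a
  power of p, so that it can be tested on natural approximations.\<close>

lemma padic_of_nat_dvd_pow:
  assumes "n > 0"
  obtains k where "(of_nat n :: 'p::prime_card padic_int) dvd pp ^ k"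
proof -
  obtain m where m: "n = CARD('p) ^ multiplicity CARD('p) n * m" "\<not> CARD('p) dvd m"
    using multiplicity_decompose'[of n "CARD('p)"] assms prime_card[where 'a='p]
    by (metis not_prime_unit not_gr_zero)
  have "(of_nat m :: 'p padic_int) dvd 1" using padic_of_nat_unit m(2) .
  then have "(of_nat n :: 'p padic_int) dvd pp ^ multiplicity CARD('p) n * 1"
    by (subst m(1)) (simp only: of_nat_mult of_nat_power mult_dvd_mono dvd_refl)
  then show ?thesis using that by simp
qed

section \<open>Binomial coefficients and the powers of q\<close>

lemma prod_diff_of_nat:
  "(\<Prod>j<i. of_nat N - of_nat j :: 'a::comm_ring_1) = of_nat (fact i * (N choose i))"
proof (induction i)
  case (Suc i)
  have "(N choose i) * (N - i) = Suc i * (N choose Suc i)"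
    using binomial_absorb_comp[of N i] binomial_absorption[of i "N"]
    by (metis binomial_absorption mult.commute)
  then have "fact i * (N choose i) * (N - i) = fact (Suc i) * (N choose Suc i)"
    by (simp add: algebra_simps)
  moreover have "of_nat (fact i * (N choose i)) * (of_nat N - of_nat i :: 'a)
      = of_nat (fact i * (N choose i) * (N - i))"
    by (cases "i \<le> N") (simp_all add: of_nat_diff binomial_eq_0)
  ultimately show ?case using Suc by simp
qed simp

lemma dvd_prod_diff:
  fixes a b :: "nat \<Rightarrow> 'a::comm_ring_1"
  assumes "\<And>j. j < i \<Longrightarrow> d dvd a j - b j"
  shows "d dvd (\<Prod>j<i. a j) - (\<Prod>j<i. b j)"
  using assms
proof (induction i)
  case (Suc i)
  have "(\<Prod>j<Suc i. a j) - (\<Prod>j<Suc i. b j)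
      = ((\<Prod>j<i. a j) - (\<Prod>j<i. b j)) * a i + (\<Prod>j<i. b j) * (a i - b i)"
    by (simp add: algebra_simps)
  then show ?case using Suc by (simp add: dvd_add)
qed simp

text \<open>By density of the natural numbers: for N the quotient is a binomial coefficient, and N
  is taken so close to a that both products agree modulo \<open>fact i\<close>.\<close>

lemma fact_dvd_prod_padic:
  "of_nat (fact i) dvd (\<Prod>j<i. a - of_nat j :: 'p::prime_card padic_int)"
proof -
  obtain k where k: "(of_nat (fact i) :: 'p padic_int) dvd pp ^ k"
    by (rule padic_of_nat_dvd_pow[OF fact_gt_zero])
  obtain N where "pp ^ k dvd a - of_nat N" using padic_approx .
  then have "pp ^ k dvd (\<Prod>j<i. a - of_nat j) - (\<Prod>j<i. of_nat N - of_nat j)"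
    by (intro dvd_prod_diff) simp
  then have "of_nat (fact i) dvd (\<Prod>j<i. a - of_nat j) - of_nat (fact i * (N choose i))"
    using k dvd_trans by (auto simp: prod_diff_of_nat)
  then have "of_nat (fact i) dvd ((\<Prod>j<i. a - of_nat j) - of_nat (fact i * (N choose i)))
      + of_nat (fact i * (N choose i))"
    by (rule dvd_add) simp
  then show ?thesis by simp
qed

lemma quot_mult: "b dvd a \<Longrightarrow> b \<noteq> 0 \<Longrightarrow> quot a b * b = a" for a b :: "'a::idom"
  by (metis dvd_div_mult_self dvdE mult.commute quot_eqI)

lemma padic_binom_fact: "padic_binom a i * of_nat (fact i) = (\<Prod>j<i. a - of_nat j)"
  unfolding padic_binom_def by (rule quot_mult[OF fact_dvd_prod_padic]) simp

lemma padic_binom_0 [simp]: "padic_binom a 0 = 1"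
  using padic_binom_fact[of a 0] by simp

lemma padic_binom_Suc: "of_nat (Suc n) * padic_binom a (Suc n) = (a - of_nat n) * padic_binom a n"
proof -
  have "(of_nat (Suc n) * padic_binom a (Suc n)) * of_nat (fact n)
      = padic_binom a (Suc n) * of_nat (fact (Suc n))"
    by (simp only: fact_Suc of_nat_mult of_nat_id mult_ac)
  also have "\<dots> = (padic_binom a n * of_nat (fact n)) * (a - of_nat n)"
    by (simp only: padic_binom_fact prod.lessThan_Suc)
  also have "\<dots> = ((a - of_nat n) * padic_binom a n) * of_nat (fact n)"
    by (simp only: mult_ac)
  finally show ?thesis by (simp del: of_nat_Suc)
qed

lemma q_power_ODE: "(1 + fps_X) * fps_deriv (q_power a) = fps_const a * q_power a"
proof (rule fps_ext)
  fix n
  show "((1 + fps_X) * fps_deriv (q_power a)) $ n = (fps_const a * q_power a) $ n"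
    using padic_binom_Suc[of n a]
    by (cases n) (simp_all add: q_power_def distrib_right algebra_simps)
qed

lemma q_power_0th [simp]: "q_power a $ 0 = 1"
  by (simp add: q_power_def)

text \<open>In characteristic zero the differential equation of \<open>(1 + X)^a\<close> determines
  all coefficients from the constant one. The exponent laws follow from this uniqueness, without
  binomial convolution identities.\<close>

lemma q_power_unique:
  fixes F :: "'p::prime_card padic_int fps"
  assumes 0: "F $ 0 = 1" and ode: "(1 + fps_X) * fps_deriv F = fps_const a * F"
  shows "F = q_power a"
proof -
  have rec: "of_nat (Suc n) * F $ Suc n = (a - of_nat n) * F $ n" for n
    using arg_cong[OF ode, of "\<lambda>G. G $ n"]
    by (cases n) (simp_all add: distrib_right algebra_simps)
  have "F $ n = padic_binom a n" for n
  proof (induction n)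
    case (Suc n)
    then have "of_nat (Suc n) * F $ Suc n = of_nat (Suc n) * padic_binom a (Suc n)"
      by (simp only: rec padic_binom_Suc)
    then show ?case by (metis mult_left_cancel of_nat_0_eq_iff nat.distinct(1))
  qed (simp add: 0)
  then show ?thesis by (simp add: fps_eq_iff q_power_def)
qed

lemma q_power_add: "q_power (a + b) = q_power a * q_power b"
proof (rule q_power_unique[symmetric])
  have "(1 + fps_X) * fps_deriv (q_power a * q_power b)
      = q_power b * ((1 + fps_X) * fps_deriv (q_power a))
        + q_power a * ((1 + fps_X) * fps_deriv (q_power b))"
    by (simp add: algebra_simps)
  also have "\<dots> = fps_const (a + b) * (q_power a * q_power b)"
    unfolding q_power_ODE by (simp add: algebra_simps flip: fps_const_add)
  finally show "(1 + fps_X) * fps_deriv (q_power a * q_power b)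
      = fps_const (a + b) * (q_power a * q_power b)" .
qed simp

lemma q_power_zero [simp]: "q_power 0 = 1"
  by (rule q_power_unique[symmetric]) simp_all

lemma q_power_one [simp]: "q_power 1 = 1 + fps_X"
  by (rule q_power_unique[symmetric]) simp_all

lemma q_power_of_nat_mult: "q_power (of_nat n * a) = q_power a ^ n"
  by (induction n) (simp_all add: q_power_add distrib_right)

lemma q_power_compose: "fps_compose (q_power a) (q_power l - 1) = q_power (l * a)"
proof (rule q_power_unique)
  let ?w = "q_power l - 1"
  have "(1 + fps_X) * fps_deriv (fps_compose (q_power a) ?w)
      = fps_compose (fps_deriv (q_power a)) ?w * ((1 + fps_X) * fps_deriv (q_power l))"
    by (simp add: fps_compose_deriv algebra_simps)
  \<comment> \<open>Reading \<open>q_power l\<close> as \<open>1 + fps_X\<close> evaluated at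
    \<open>?w\<close> allows the equation of \<open>q_power a\<close> to be applied under the
    substitution.\<close>
  also have "\<dots> = fps_compose (fps_deriv (q_power a)) ?w * (fps_const l * fps_compose (1 + fps_X) ?w)"
    by (simp add: q_power_ODE fps_compose_add_distrib)
  also have "\<dots> = fps_const l * fps_compose ((1 + fps_X) * fps_deriv (q_power a)) ?w"
    by (simp add: fps_compose_mult_distrib)
  also have "\<dots> = fps_const (l * a) * fps_compose (q_power a) ?w"
    by (simp add: q_power_ODE fps_compose_mult_distrib mult.assoc flip: fps_const_mult)
  finally show "(1 + fps_X) * fps_deriv (fps_compose (q_power a) ?w)
      = fps_const (l * a) * fps_compose (q_power a) ?w" .
qed simp

lemma q_power_card: "(1 + fps_X) ^ CARD('p) - 1 = (q_power pp - 1 :: 'p::prime_card padic_int fps)"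
  using q_power_of_nat_mult[of "CARD('p)" "1 :: 'p padic_int"] by simp

section \<open>q-numbers\<close>

lemma q_number_mult: "q_number a * fps_X = q_power a - 1"
  unfolding q_number_def
proof (rule quot_mult)
  have "q_power a - 1 = fps_X * fps_shift 1 (q_power a - 1)"
    by (intro fps_ext) simp
  then show "fps_X dvd q_power a - 1" by (rule dvdI)
qed simp

lemma q_number_eqI: "c * fps_X = q_power a - 1 \<Longrightarrow> q_number a = c"
  unfolding q_number_def by (rule quot_eqI) simp_all

lemma q_number_0th [simp]: "q_number a $ 0 = a"
proof -
  have "(q_number a * fps_X) $ 1 = padic_binom a (Suc 0)"
    unfolding q_number_mult by (simp add: q_power_def)
  also have "\<dots> = a" using padic_binom_Suc[of 0 a] by simp
  finally show ?thesis by simp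
qed

lemma q_number_add: "q_number (a + b) = q_number a + q_power a * q_number b"
proof (rule q_number_eqI)
  have "(q_number a + q_power a * q_number b) * fps_X
      = q_number a * fps_X + q_power a * (q_number b * fps_X)" by (simp add: algebra_simps)
  also have "\<dots> = q_power (a + b) - 1"
    unfolding q_number_mult q_power_add by (simp add: algebra_simps)
  finally show "(q_number a + q_power a * q_number b) * fps_X = q_power (a + b) - 1" .
qed

text \<open>From \<open>(q^l)^a - 1 = [a]_{q^l} (q^l - 1)\<close>, divided by q - 1. For l = p this
  is the source of the Frobenius twist in the recursions for the coefficients of F.\<close>

lemma q_number_mult_compose:
  "q_number (l * a) = fps_compose (q_number a) (q_power l - 1) * q_number l"
proof (rule q_number_eqI)
  have "fps_compose (q_number a) (q_power l - 1) * q_number l * fps_X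
      = fps_compose (q_number a) (q_power l - 1) * fps_compose fps_X (q_power l - 1)"
    by (simp add: mult.assoc q_number_mult)
  also have "\<dots> = fps_compose (q_power a - 1) (q_power l - 1)"
    unfolding q_number_mult[of a, symmetric] by (rule fps_compose_mult_distrib[symmetric]) simp
  also have "\<dots> = q_power (l * a) - 1" by (simp add: fps_compose_sub_distrib q_power_compose)
  finally show "fps_compose (q_number a) (q_power l - 1) * q_number l * fps_X = q_power (l * a) - 1" .
qed

lemma q_number_neq_0: "a \<noteq> 0 \<Longrightarrow> q_number a \<noteq> 0"
  by (metis q_number_0th fps_zero_nth)

lemma q_number_of_nat_Suc_neq_0: "q_number (of_nat (Suc n)) \<noteq> 0"
  by (rule q_number_neq_0) (simp del: of_nat_Suc)

lemma fps_dvd_one_iff: "c dvd 1 \<longleftrightarrow> c $ 0 dvd 1" for c :: "'a::comm_ring_1 fps"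
proof
  assume "c dvd 1"
  then obtain d where "c * d = 1" by (metis dvdE)
  then have "c $ 0 * d $ 0 = 1" by (metis fps_mult_nth_0 fps_one_nth)
  then show "c $ 0 dvd 1" by (metis dvdI)
next
  assume "c $ 0 dvd 1"
  then obtain d where "d * c $ 0 = 1" by (metis dvdE mult.commute)
  then have "fps_left_inverse c d * c = 1" by (rule fps_left_inverse)
  then show "c dvd 1" by (metis dvd_triv_right)
qed

section \<open>The (p, q - 1)-adic filtration of R\<close>

text \<open>The ideal \<open>(p, q - 1)^n\<close> of R in terms of coefficients; truncated
  subtraction leaves the coefficients from index n on unrestricted.\<close>

definition fil_R :: "nat \<Rightarrow> 'p::prime_card padic_int fps \<Rightarrow> bool" where
  "fil_R n c \<longleftrightarrow> (\<forall>k. pp ^ (n - k) dvd c $ k)"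

lemma fil_R_0 [simp]: "fil_R 0 c"
  by (simp add: fil_R_def)

lemma fil_R_zero [simp]: "fil_R n 0"
  by (simp add: fil_R_def)

lemma fil_R_add: "fil_R n c \<Longrightarrow> fil_R n d \<Longrightarrow> fil_R n (c + d)"
  by (simp add: fil_R_def dvd_add)

lemma fil_R_diff: "fil_R n c \<Longrightarrow> fil_R n d \<Longrightarrow> fil_R n (c - d)"
  by (simp add: fil_R_def dvd_diff)

lemma fil_R_minus_iff [simp]: "fil_R n (- c) \<longleftrightarrow> fil_R n c"
  by (simp add: fil_R_def)

lemma fil_R_sum: "(\<And>i. i \<in> A \<Longrightarrow> fil_R n (f i)) \<Longrightarrow> fil_R n (sum f A)"
  by (induction A rule: infinite_finite_induct) (simp_all add: fil_R_add)

lemma fil_R_mono: "fil_R n c \<Longrightarrow> m \<le> n \<Longrightarrow> fil_R m c"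
  unfolding fil_R_def by (meson diff_le_mono dvd_trans le_imp_power_dvd)

lemma fil_R_mult: assumes "fil_R m c" "fil_R n d" shows "fil_R (m + n) (c * d)"
  unfolding fil_R_def fps_mult_nth
proof (intro allI dvd_sum)
  fix k i :: nat assume "i \<in> {0..k}"
  then have "m + n - k \<le> (m - i) + (n - (k - i))" by auto
  then have "pp ^ (m + n - k) dvd (pp ^ (m - i) * pp ^ (n - (k - i)) :: 'a padic_int)"
    unfolding power_add[symmetric] by (rule le_imp_power_dvd)
  also have "\<dots> dvd c $ i * d $ (k - i)" using assms by (auto simp: fil_R_def intro: mult_dvd_mono)
  finally show "pp ^ (m + n - k) dvd c $ i * d $ (k - i)" .
qed

lemma fil_R_mult_left: "fil_R n d \<Longrightarrow> fil_R n (c * d)"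
  using fil_R_mult[of 0 c n d] by simp

lemma fil_R_mult_right: "fil_R n c \<Longrightarrow> fil_R n (c * d)"
  using fil_R_mult[of n c 0 d] by simp

lemma fil_R_cong_mult:
  assumes "fil_R n (a - a')" "fil_R n (b - b')"
  shows "fil_R n (a * b - a' * b')"
proof -
  have "a * b - a' * b' = (a - a') * b + a' * (b - b')" by (simp add: algebra_simps)
  then show ?thesis using assms by (simp add: fil_R_add fil_R_mult_left fil_R_mult_right)
qed

lemma fil_R_cong_trans: "fil_R n (a - b) \<Longrightarrow> fil_R n (b - c) \<Longrightarrow> fil_R n (a - c)"
  using fil_R_add[of n "a - b" "b - c"] by simp

lemma fil_R_cong_sym: "fil_R n (a - b) \<Longrightarrow> fil_R n (b - a)"
  using fil_R_minus_iff[of n "a - b"] by simp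

lemma fil_R_cong_power: "fil_R n (a - b) \<Longrightarrow> fil_R n (a ^ k - b ^ k)"
  by (induction k) (simp_all add: fil_R_cong_mult)

lemma fil_R_cong_prod:
  "(\<And>i. i \<in> A \<Longrightarrow> fil_R n (f i - g i)) \<Longrightarrow> fil_R n (prod f A - prod g A)"
  by (induction A rule: infinite_finite_induct) (simp_all add: fil_R_cong_mult)

lemma fil_R_cancel_unit:
  assumes "fil_R n (a * u - b * u)" "u dvd 1" shows "fil_R n (a - b)"
proof -
  obtain v where "u * v = 1" using assms(2) by (metis dvdE)
  then have "(a * u - b * u) * v = a - b"
    by (simp add: left_diff_distrib mult.assoc)
  then show ?thesis using fil_R_mult_right[OF assms(1), of v] by simp
qed

lemma fil_R_1_iff: "fil_R (Suc 0) c \<longleftrightarrow> pp dvd c $ 0"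
proof
  assume "fil_R (Suc 0) c"
  then show "pp dvd c $ 0" unfolding fil_R_def by (elim allE[of _ 0]) simp
next
  assume 0: "pp dvd c $ 0"
  have "pp ^ (Suc 0 - k) dvd c $ k" for k using 0 by (cases k) simp_all
  then show "fil_R (Suc 0) c" by (simp add: fil_R_def)
qed

lemma fil_R_fps_X: "fil_R (Suc 0) fps_X"
  by (simp add: fil_R_1_iff)

lemma fil_R_pp_pow: "fil_R n (fps_const (pp ^ n))"
  unfolding fil_R_def by (auto simp: le_imp_power_dvd)

section \<open>Substitution of powers of q\<close>

definition subst_q :: "'p::prime_card padic_int \<Rightarrow> 'p padic_int fps \<Rightarrow> 'p padic_int fps" where
  "subst_q l c = fps_compose c (q_power l - 1)"

lemma subst_q_mult: "subst_q l (c * d) = subst_q l c * subst_q l d"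
  by (simp add: subst_q_def fps_compose_mult_distrib)

lemma subst_q_add: "subst_q l (c + d) = subst_q l c + subst_q l d"
  by (simp add: subst_q_def fps_compose_add_distrib)

lemma subst_q_diff: "subst_q l (c - d) = subst_q l c - subst_q l d"
  by (simp add: subst_q_def fps_compose_sub_distrib)

lemma subst_q_0 [simp]: "subst_q l 0 = 0" and subst_q_1 [simp]: "subst_q l 1 = 1"
  by (simp_all add: subst_q_def)

lemma subst_q_const [simp]: "subst_q l (fps_const c) = fps_const c"
  by (simp add: subst_q_def)

lemma subst_q_power: "subst_q l (c ^ n) = subst_q l c ^ n"
  by (induction n) (simp_all add: subst_q_mult)

lemma subst_q_sum: "subst_q l (sum f A) = (\<Sum>i\<in>A. subst_q l (f i))"
  by (simp add: subst_q_def fps_compose_sum_distrib)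

lemma subst_q_0th [simp]: "subst_q l c $ 0 = c $ 0"
  by (simp add: subst_q_def)

lemma subst_q_X: "subst_q l fps_X = q_number l * fps_X"
  by (simp add: subst_q_def q_number_mult)

lemma subst_q_q_power: "subst_q l (q_power a) = q_power (l * a)"
  by (simp add: subst_q_def q_power_compose)

lemma subst_q_subst_q: "subst_q l (subst_q k c) = subst_q (l * k) c"
proof -
  have "fps_compose (q_power k - 1) (q_power l - 1) = q_power (l * k) - 1"
    by (simp add: fps_compose_sub_distrib q_power_compose)
  then show ?thesis by (simp add: subst_q_def flip: fps_compose_assoc)
qed

lemma subst_q_one_id [simp]: "subst_q 1 c = c"
  by (simp add: subst_q_def)

lemma q_number_mult_subst: "q_number (l * a) = subst_q l (q_number a) * q_number l"
  unfolding subst_q_def by (rule q_number_mult_compose)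

text \<open>As \<open>q^l - 1\<close> has no constant term, coefficient k of the result involves
  only the coefficients of c up to k, whose divisibility is at least as strong.\<close>

lemma fil_R_subst_q:
  assumes "fil_R n c" shows "fil_R n (subst_q l c)"
  unfolding fil_R_def subst_q_def fps_compose_nth
proof (intro allI dvd_sum)
  fix k i :: nat assume "i \<in> {0..k}"
  then have "pp ^ (n - k) dvd (pp ^ (n - i) :: 'a padic_int)" by (intro le_imp_power_dvd) auto
  also have "\<dots> dvd c $ i * ((q_power l - 1) ^ i) $ k" using assms by (simp add: fil_R_def)
  finally show "pp ^ (n - k) dvd c $ i * ((q_power l - 1) ^ i) $ k" .
qed

text \<open>Since \<open>[p^(n+1)]_q\<close> is \<open>\<phi>([p^n]_q) [p]_q\<close>, every step
  adds the factor \<open>[p]_q\<close>, which lies in J because its constant term is p.\<close>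

lemma fil_R_q_number_pow: "fil_R n (q_number (pp ^ n :: 'p::prime_card padic_int))"
proof (induction n)
  case (Suc n)
  have "fil_R (n + Suc 0) (subst_q pp (q_number (pp ^ n)) * q_number (pp :: 'p padic_int))"
    by (rule fil_R_mult[OF fil_R_subst_q[OF Suc]]) (simp add: fil_R_1_iff)
  then show ?case by (simp flip: q_number_mult_subst)
qed simp

lemma fil_R_q_number_cong: "fil_R n (q_number (x + pp ^ n * y) - q_number x)"
  by (simp add: q_number_add q_number_mult_subst fil_R_mult_left fil_R_q_number_pow)

lemma fil_R_q_power_cong: "fil_R (Suc n) (q_power (x + pp ^ n * y) - q_power x)"
proof -
  have "q_power (x + pp ^ n * y) - q_power x = q_power x * (q_number (pp ^ n * y) * fps_X)"
    unfolding q_number_mult q_power_add by (simp add: algebra_simps)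
  moreover have "fil_R (n + Suc 0) (q_number (pp ^ n * y) * fps_X)"
    using fil_R_q_number_cong[of n 0 y] by (intro fil_R_mult fil_R_fps_X)
      (simp add: q_number_mult_subst fil_R_mult_left fil_R_q_number_pow)
  ultimately show ?thesis by (simp add: fil_R_mult_left)
qed

lemma fil_R_subst_q_cong:
  assumes "fil_R n (q_power l - q_power l')"
  shows "fil_R n (subst_q l c - subst_q l' c)"
proof -
  have pow: "fil_R n ((q_power l - 1) ^ i - (q_power l' - 1) ^ i)" for i
    using assms by (intro fil_R_cong_power) simp
  show ?thesis
    unfolding fil_R_def subst_q_def fps_compose_nth fps_sub_nth sum_subtractf[symmetric]
  proof (intro allI dvd_sum)
    fix k i
    have "pp ^ (n - k) dvd ((q_power l - 1) ^ i - (q_power l' - 1) ^ i) $ k"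
      using pow[of i] unfolding fil_R_def by blast
    then show "pp ^ (n - k) dvd
        c $ i * ((q_power l - 1) ^ i) $ k - c $ i * ((q_power l' - 1) ^ i) $ k"
      by (simp flip: right_diff_distrib)
  qed
qed

section \<open>The coefficients of F\<close>

abbreviation half :: "'p::prime_card padic_int" where
  "half \<equiv> quot 1 2"

lemma odd_half_eq: "odd n \<Longrightarrow> n = 2 * ((n - 1) div 2) + 1" for n :: nat
  by presburger

lemma two_half: assumes "odd CARD('p::prime_card)" shows "2 * half = (1 :: 'p padic_int)"
proof -
  have "\<not> CARD('p) dvd 2"
    using assms prime_card[where 'a='p] by (metis dvd_refl primes_dvd_imp_eq two_is_prime_nat)
  then have "(of_nat 2 :: 'p padic_int) dvd 1" by (rule padic_of_nat_unit)
  then show ?thesis using quot_mult[of 2 "1 :: 'p padic_int"] by (simp add: mult.commute)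
qed

text \<open>As in Morita's p-adic Gamma function, the non-units are replaced by 1: all values are
  units, and the dependence on x modulo powers of p is kept. The products \<open>window\<close> are
  thus, up to sign, q-analogues of quotients of Gamma values.\<close>

definition q_number_unit :: "'p::prime_card padic_int \<Rightarrow> 'p padic_int fps" where
  "q_number_unit x = (if pp dvd x then 1 else q_number x)"

lemma q_number_unit_dvd_one: "q_number_unit x dvd 1"
  by (simp add: q_number_unit_def fps_dvd_one_iff padic_unit_iff)

lemma fil_R_q_number_unit_cong:
  assumes "s > 0" shows "fil_R s (q_number_unit (x + pp ^ s * y) - q_number_unit x)"
proof -
  have "pp dvd pp ^ s * y" using assms by (simp add: dvd_power)
  then have "pp dvd x + pp ^ s * y \<longleftrightarrow> pp dvd x" by (simp add: dvd_add_left_iff)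
  then show ?thesis by (simp add: q_number_unit_def fil_R_q_number_cong)
qed

definition window :: "nat \<Rightarrow> 'p::prime_card padic_int \<Rightarrow> 'p padic_int fps" where
  "window n x = (\<Prod>j<n. q_number_unit (x + of_nat j))"

lemma window_dvd_one: "window n x dvd 1"
proof -
  have "window n x dvd (\<Prod>j<n. 1)"
    unfolding window_def by (rule prod_dvd_prod) (rule q_number_unit_dvd_one)
  then show ?thesis by simp
qed

lemma window_add: "window (m + n) x = window m x * window n (x + of_nat m)"
  by (induction n) (simp_all add: window_def add_ac)

lemma window_Suc_left: "window (Suc n) x = q_number_unit x * window n (x + 1)"
  using window_add[of 1 n x] by (simp add: window_def)

lemma window_Suc: "window (Suc n) x = window n x * q_number_unit (x + of_nat n)"
  by (simp add: window_def)

text \<open>A window whose length is a multiple of \<open>p ^ s\<close> meets all residue classes equally often.\<close>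

lemma fil_R_window_shift:
  assumes "s > 0"
  shows "fil_R s (window (CARD('p) ^ s * k) x
      - window (CARD('p) ^ s * k) (y :: 'p::prime_card padic_int))"
proof -
  define n where "n = CARD('p) ^ s * k"
  \<comment> \<open>A shift by one exchanges the factor at z for the factor at \<open>z + n\<close>,
    and n is a multiple of \<open>p^s\<close>.\<close>
  have step: "fil_R s (window n (z + 1) - window n z)" for z :: "'p padic_int"
  proof (rule fil_R_cancel_unit)
    have "window n (z + 1) * q_number_unit z - window n z * q_number_unit z
        = window n z * (q_number_unit (z + pp ^ s * of_nat k) - q_number_unit z)"
      using window_Suc_left[of n z] window_Suc[of n z] by (simp add: n_def algebra_simps)
    then show "fil_R s (window n (z + 1) * q_number_unit z - window n z * q_number_unit z)"
      using assms by (simp add: fil_R_mult_left fil_R_q_number_unit_cong)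
  qed (rule q_number_unit_dvd_one)
  have steps: "fil_R s (window n (of_nat N) - window n (0 :: 'p padic_int))" for N
  proof (induction N)
    case (Suc N)
    then show ?case using step[of "of_nat N"] by (auto intro: fil_R_cong_trans simp: add.commute)
  qed simp
  have "fil_R s (window n z - window n 0)" for z :: "'p padic_int"
  proof -
    obtain N where "pp ^ s dvd z - of_nat N" using padic_approx .
    then obtain w where "z = of_nat N + pp ^ s * w" by (metis dvdE diff_eq_eq add.commute)
    have "fil_R s (window n z - window n (of_nat N))"
      unfolding window_def
    proof (intro fil_R_cong_prod)
      fix i
      show "fil_R s (q_number_unit (z + of_nat i) - q_number_unit (of_nat N + of_nat i))"
        using fil_R_q_number_unit_cong[OF assms, of "of_nat N + of_nat i" w]
        by (simp add: \<open>z = _\<close> add_ac)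
    qed
    from this steps show ?thesis by (rule fil_R_cong_trans)
  qed
  then show ?thesis unfolding n_def[symmetric] by (metis fil_R_cong_sym fil_R_cong_trans)
qed

section \<open>Separating the multiples of p in the numerators and denominators of the
  coefficients\<close>

definition num_prod :: "nat \<Rightarrow> 'p::prime_card padic_int fps" where
  "num_prod n = (\<Prod>j<n. q_number (half + of_nat j))"

definition den_prod :: "nat \<Rightarrow> 'p::prime_card padic_int fps" where
  "den_prod n = (\<Prod>j<n. q_number (of_nat (Suc j)))"

lemma den_prod_neq_0: "den_prod n \<noteq> 0"
  by (simp add: den_prod_def q_number_of_nat_Suc_neq_0 del: of_nat_Suc)

text \<open>The multiples of p up to n are the \<open>p j\<close> with j up to
  \<open>n div p\<close>, and \<open>[p j]_q = \<phi>([j]_q) [p]_q\<close>; the other factors form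
  the window.\<close>

lemma den_prod_factor:
  "(den_prod n :: 'p::prime_card padic_int fps)
    = q_number pp ^ (n div CARD('p)) * subst_q pp (den_prod (n div CARD('p))) * window n 1"
proof (induction n)
  case 0
  then show ?case by (simp add: den_prod_def window_def)
next
  case (Suc n)
  let ?k = "n div CARD('p)"
  have dvd_iff: "pp dvd (1 + of_nat n :: 'p padic_int) \<longleftrightarrow> CARD('p) dvd Suc n"
    using padic_dvd_of_nat_iff[where 'p='p, of "Suc n"] by simp
  have Suc_n: "(den_prod (Suc n) :: 'p padic_int fps) = den_prod n * q_number (of_nat (Suc n))"
    by (simp add: den_prod_def)
  show ?case
  proof (cases "CARD('p) dvd Suc n")
    case True
    then have k: "Suc n div CARD('p) = Suc ?k" by (simp add: div_Suc dvd_eq_mod_eq_0)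
    have "Suc n = CARD('p) * Suc ?k" using True k by (metis dvd_mult_div_cancel)
    then have "of_nat (Suc n) = (pp * of_nat (Suc ?k) :: 'p padic_int)" by (metis of_nat_mult)
    then have "(den_prod (Suc n) :: 'p padic_int fps)
        = den_prod n * (subst_q pp (q_number (of_nat (Suc ?k))) * q_number pp)"
      unfolding Suc_n by (simp only: q_number_mult_subst)
    then show ?thesis
      using True dvd_iff unfolding k window_Suc Suc
      by (simp add: q_number_unit_def den_prod_def subst_q_mult del: of_nat_Suc)
  next
    case False
    then have k: "Suc n div CARD('p) = ?k" by (simp add: div_Suc dvd_eq_mod_eq_0)
    show ?thesis
      using False dvd_iff Suc unfolding k window_Suc Suc_n
      by (simp add: q_number_unit_def)
  qed
qed

text \<open>For odd p, the number of j < n such that p divides \<open>1/2 + j\<close>, that is, of j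
  congruent to (p - 1)/2 modulo p.\<close>

definition num_count :: "nat \<Rightarrow> nat \<Rightarrow> nat" where
  "num_count p n = (n + (p - 1) div 2) div p"

context
  assumes odd_card: "odd CARD('p::prime_card)"
begin

text \<open>Dwork's prime operation fixes 1/2: for \<open>j = (p - 1)/2 + p k\<close> one has
  \<open>1/2 + j = p (1/2 + k)\<close>. So the multiples of p in the numerator reproduce the same
  kind of product.\<close>

lemma num_prod_factor:
  "(num_prod n :: 'p padic_int fps) = q_number pp ^ num_count CARD('p) n
    * subst_q pp (num_prod (num_count CARD('p) n)) * window n half"
proof (induction n)
  case 0
  have "(CARD('p) - 1) div 2 < CARD('p)"
    using prime_gt_0_nat[OF prime_card[where 'a='p]] by linarith
  then have "num_count CARD('p) 0 = 0" by (simp add: num_count_def)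
  then show ?case by (simp add: num_prod_def window_def)
next
  case (Suc n)
  let ?k = "num_count CARD('p) n"
  define m where "m = (CARD('p) - 1) div 2"
  have nc: "num_count CARD('p) n = (n + m) div CARD('p)" for n by (simp add: num_count_def m_def)
  have p: "CARD('p) = 2 * m + 1" unfolding m_def using odd_card by (rule odd_half_eq)
  have pm: "(pp :: 'p padic_int) = 2 * of_nat m + 1" using arg_cong[OF p, of "of_nat :: nat \<Rightarrow> 'p padic_int"] by simp
  have half: "2 * half = (1 :: 'p padic_int)" by (rule two_half[OF odd_card])
  \<comment> \<open>This form reduces divisibility of \<open>1/2 + n\<close> by p to divisibility of
    a natural number.\<close>
  have eq: "half + of_nat n = of_nat (Suc n + m) - pp * (half :: 'p padic_int)"
  proof -
    have "pp * half = of_nat m * (2 * half) + (half :: 'p padic_int)"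
      unfolding pm by (simp add: algebra_simps)
    moreover have "(half :: 'p padic_int) + half = 1" using half by simp
    ultimately show ?thesis unfolding half by (simp add: algebra_simps)
  qed
  have dvd_iff: "pp dvd (half + of_nat n :: 'p padic_int) \<longleftrightarrow> CARD('p) dvd Suc n + m"
    unfolding eq padic_dvd_of_nat_iff[where 'p='p, of "Suc n + m", symmetric]
    by (metis diff_add_cancel dvd_add_left_iff dvd_triv_left)
  have Suc_n: "(num_prod (Suc n) :: 'p padic_int fps) = num_prod n * q_number (half + of_nat n)"
    by (simp add: num_prod_def)
  show ?case
  proof (cases "CARD('p) dvd Suc n + m")
    case True
    then have k: "num_count CARD('p) (Suc n) = Suc ?k"
      by (simp add: nc div_Suc dvd_eq_mod_eq_0)
    have "Suc n + m = CARD('p) * Suc ?k"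
      using True k unfolding nc by (metis dvd_mult_div_cancel)
    then have "of_nat (Suc n + m) = (pp * of_nat (Suc ?k) :: 'p padic_int)" by (metis of_nat_mult)
    moreover have "(1 :: 'p padic_int) - half = half" using half by (simp add: algebra_simps)
    ultimately have "half + of_nat n = (pp * (half + of_nat ?k) :: 'p padic_int)"
      unfolding eq by (simp add: algebra_simps)
    then have "(num_prod (Suc n) :: 'p padic_int fps)
        = num_prod n * (subst_q pp (q_number (half + of_nat ?k)) * q_number pp)"
      unfolding Suc_n by (simp only: q_number_mult_subst)
    then show ?thesis
      using True dvd_iff unfolding k window_Suc Suc
      by (simp add: q_number_unit_def num_prod_def subst_q_mult)
  next
    case False
    then have k: "num_count CARD('p) (Suc n) = ?k"
      by (simp add: nc div_Suc dvd_eq_mod_eq_0)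
    show ?thesis
      using False dvd_iff Suc unfolding k window_Suc Suc_n
      by (simp add: q_number_unit_def)
  qed
qed

text \<open>A digit b above (p - 1)/2 means that the numerator has met one more multiple of p than
  the denominator, namely \<open>p (1/2 + i)\<close>. The remaining ratio consists of units.\<close>

definition root_quotient :: "nat \<Rightarrow> nat \<Rightarrow> 'p padic_int fps" where
  "root_quotient b i = (if b > (CARD('p) - 1) div 2 then q_number (pp * (half + of_nat i)) else 1)
     * quot (window (b + CARD('p) * i) half) (window (b + CARD('p) * i) 1)"

definition root_coeff :: "nat \<Rightarrow> 'p padic_int fps" where
  "root_coeff n = quot (num_prod n) (den_prod n)"

lemma quot_window: "quot (window n half) (window n 1) * window n 1 = (window n half :: 'p padic_int fps)"
  using window_dvd_one[of n "1 :: 'p padic_int"]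
  by (intro quot_mult) (auto intro: dvd_trans)

lemma num_count_add:
  assumes "b < CARD('p)"
  shows "num_count CARD('p) (b + CARD('p) * i)
    = (if b > (CARD('p) - 1) div 2 then Suc i else i)"
proof -
  define m where "m = (CARD('p) - 1) div 2"
  have p: "CARD('p) = 2 * m + 1" unfolding m_def using odd_card by (rule odd_half_eq)
  have "(b + CARD('p) * i + m) div CARD('p) = (b + m + i * CARD('p)) div CARD('p)"
    by (simp only: mult_ac add_ac)
  also have "\<dots> = i + (b + m) div CARD('p)" by (rule div_mult_self1) simp
  also have "(b + m) div CARD('p) = (if b > m then 1 else 0)"
    using p assms by (auto intro!: div_nat_eqI)
  finally show ?thesis unfolding num_count_def m_def[symmetric] by simp
qed

text \<open>The quotient at i enters as a hypothesis c, so that the same identity serves first to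
  prove divisibility by induction and then to compute \<open>root_coeff\<close>.\<close>

lemma num_prod_step:
  assumes "b < CARD('p)" and "num_prod i = c * (den_prod i :: 'p padic_int fps)"
  shows "num_prod (b + CARD('p) * i)
    = subst_q pp c * root_quotient b i * (den_prod (b + CARD('p) * i) :: 'p padic_int fps)"
proof -
  let ?n = "b + CARD('p) * i"
  let ?d = "(if b > (CARD('p) - 1) div 2 then q_number (pp * (half + of_nat i)) else 1) :: 'p padic_int fps"
  have "?n div CARD('p) = i" using assms(1) by simp
  then have den: "(den_prod ?n :: 'p padic_int fps)
      = q_number pp ^ i * subst_q pp (den_prod i) * window ?n 1"
    using den_prod_factor[of ?n, where 'p='p] by simp
  have "num_prod ?n = q_number pp ^ i * subst_q pp (num_prod i) * ?d * window ?n half"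
    unfolding num_prod_factor[of ?n] num_count_add[OF assms(1)] q_number_mult_subst
    by (simp add: num_prod_def subst_q_mult)
  also have "\<dots> = q_number pp ^ i * subst_q pp (c * den_prod i) * ?d
      * (quot (window ?n half) (window ?n 1) * window ?n 1)"
    by (simp only: assms(2) quot_window)
  also have "\<dots> = subst_q pp c * root_quotient b i * den_prod ?n"
    unfolding den root_quotient_def subst_q_mult by (simp only: mult_ac)
  finally show ?thesis .
qed

text \<open>Induction along the base-p expansion of n: removing the last digit costs a factor
  \<open>root_quotient\<close>, which already lies in R.\<close>

lemma den_dvd_num: "den_prod n dvd (num_prod n :: 'p padic_int fps)"
proof (induction n rule: less_induct)
  case (less n)
  show ?case
  proof (cases "n = 0")
    case True
    then show ?thesis by (simp add: den_prod_def)
  next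
    case False
    let ?i = "n div CARD('p)"
    have p: "CARD('p) > 1" using prime_card[where 'a='p] by (rule prime_gt_1_nat)
    then have "?i < n" using False by simp
    then obtain c where "num_prod ?i = c * (den_prod ?i :: 'p padic_int fps)"
      using less by (metis dvdE mult.commute)
    then have "num_prod (n mod CARD('p) + CARD('p) * ?i) = subst_q pp c
        * root_quotient (n mod CARD('p)) ?i * (den_prod (n mod CARD('p) + CARD('p) * ?i) :: 'p padic_int fps)"
      using p by (intro num_prod_step) simp_all
    then show ?thesis by simp
  qed
qed

lemma root_coeff_den: "root_coeff n * den_prod n = (num_prod n :: 'p padic_int fps)"
  unfolding root_coeff_def by (rule quot_mult[OF den_dvd_num den_prod_neq_0])

lemma root_coeff_step:
  assumes "b < CARD('p)"
  shows "root_coeff (b + CARD('p) * i) = subst_q pp (root_coeff i) * root_quotient b i"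
  unfolding root_coeff_def[of "b + CARD('p) * i"]
  by (rule quot_eqI[OF _ den_prod_neq_0])
    (rule num_prod_step[OF assms root_coeff_den[symmetric], symmetric])

lemma a_coeff_eq: "a_coeff n = root_coeff n ^ 2"
  unfolding a_coeff_def
proof (rule quot_eqI)
  have "(root_coeff n)\<^sup>2 * (den_prod n)\<^sup>2 = (num_prod n :: 'p padic_int fps)\<^sup>2"
    by (simp add: root_coeff_den flip: power_mult_distrib)
  then show "(root_coeff n)\<^sup>2 * (\<Prod>i<n. (q_number (of_nat (i + 1)))\<^sup>2)
      = (\<Prod>i<n. (q_number (of_nat i + half :: 'p padic_int))\<^sup>2)"
    by (simp add: num_prod_def den_prod_def prod_power_distrib add.commute)
  show "(\<Prod>i<n. (q_number (of_nat (i + 1) :: 'p padic_int))\<^sup>2) \<noteq> 0"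
    by (simp add: q_number_of_nat_Suc_neq_0 del: of_nat_Suc)
qed

text \<open>The windows have length \<open>b + p i\<close>, so moving i by a multiple of
  \<open>p^r\<close> appends a stretch whose length is a multiple of \<open>p^(r+1)\<close>; this is
  where one power is gained. The stretches appended in numerator and denominator start at different
  points but are congruent by \<open>fil_R_window_shift\<close>.\<close>

lemma fil_R_root_quotient:
  "fil_R (Suc r) (root_quotient b (i + CARD('p) ^ r * k) - root_quotient b i)"
proof -
  define n where "n = b + CARD('p) * i"
  let ?m = "CARD('p) ^ Suc r * k"
  let ?Q = "\<lambda>n. quot (window n half) (window n 1) :: 'p padic_int fps"
  have n': "b + CARD('p) * (i + CARD('p) ^ r * k) = n + ?m"
    by (simp add: n_def algebra_simps)
  have Q: "fil_R (Suc r) (?Q (n + ?m) - ?Q n)"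
  proof (rule fil_R_cancel_unit)
    let ?w = "\<lambda>x. window ?m (x + of_nat n) :: 'p padic_int fps"
    have "?Q (n + ?m) * window (n + ?m) 1 = window n half * ?w half"
      by (simp only: quot_window) (rule window_add)
    moreover have "?Q n * window (n + ?m) 1 = window n half * ?w 1"
      by (simp only: quot_window window_add mult.assoc[symmetric])
    moreover have "fil_R (Suc r) (?w half - ?w 1)" by (rule fil_R_window_shift) simp
    ultimately show "fil_R (Suc r) (?Q (n + ?m) * window (n + ?m) 1 - ?Q n * window (n + ?m) 1)"
      by (simp only: fil_R_mult_left flip: right_diff_distrib)
  qed (rule window_dvd_one)
  have "pp * (half + of_nat (i + CARD('p) ^ r * k))
      = pp * (half + of_nat i) + pp ^ Suc r * (of_nat k :: 'p padic_int)"
    by (simp add: algebra_simps)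
  then have "fil_R (Suc r) (q_number (pp * (half + of_nat (i + CARD('p) ^ r * k)))
      - q_number (pp * (half + of_nat i) :: 'p padic_int))"
    by (simp only: fil_R_q_number_cong)
  then show ?thesis
    unfolding root_quotient_def n' n_def[symmetric] using Q by (intro fil_R_cong_mult) simp_all
qed

definition step_quotient :: "nat \<Rightarrow> nat \<Rightarrow> 'p padic_int fps" where
  "step_quotient b i = root_quotient b i ^ 2"

lemma a_coeff_step:
  "b < CARD('p) \<Longrightarrow> a_coeff (b + CARD('p) * i) = subst_q pp (a_coeff i) * step_quotient b i"
  by (simp add: a_coeff_eq step_quotient_def root_coeff_step subst_q_power power_mult_distrib)

lemma fil_R_step_quotient:
  "fil_R (Suc r) (step_quotient b (i + CARD('p) ^ r * k) - step_quotient b i)"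
  unfolding step_quotient_def by (intro fil_R_cong_power fil_R_root_quotient)

lemma a_coeff_0 [simp]: "a_coeff 0 = (1 :: 'p padic_int fps)"
  unfolding a_coeff_def by (rule quot_eqI) simp_all

text \<open>With m = (p - 1)/2, modulo p one has 1/2 = -m, so the product of the
  \<open>1/2 + j\<close> for j < b, divided by \<open>fact b\<close>, becomes \<open>(-1)^b\<close>
  times a binomial coefficient. The sign disappears on squaring, and b < p makes
  \<open>fact b\<close> invertible.\<close>

lemma fil_R_a_coeff_binomial:
  assumes "b < CARD('p)"
  shows "fil_R (Suc 0) (a_coeff b - (of_nat ((((CARD('p) - 1) div 2) choose b)\<^sup>2) :: 'p padic_int fps))"
proof -
  let ?c = "root_coeff b $ 0 :: 'p padic_int"
  define m where "m = (CARD('p) - 1) div 2"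
  let ?B = "of_nat (m choose b) :: 'p padic_int"
  have p: "CARD('p) = 2 * m + 1" unfolding m_def using odd_card by (rule odd_half_eq)
  have pm: "(pp :: 'p padic_int) = 2 * of_nat m + 1" using arg_cong[OF p, of "of_nat :: nat \<Rightarrow> 'p padic_int"] by simp
  have half: "2 * half = (1 :: 'p padic_int)" by (rule two_half[OF odd_card])
  have "pp * half = of_nat m * (2 * half) + (half :: 'p padic_int)"
    unfolding pm by (simp add: algebra_simps)
  then have h: "half + of_nat m = pp * (half :: 'p padic_int)" unfolding half by simp
  have prod0: "(\<Prod>j<n. f j) $ 0 = (\<Prod>j<n. f j $ 0)" for f :: "nat \<Rightarrow> 'p padic_int fps" and n
    by (induction n) simp_all
  have fact: "(den_prod b :: 'p padic_int fps) $ 0 = of_nat (fact b)"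
    unfolding den_prod_def prod0 by (induction b) (simp_all add: algebra_simps)
  have "?c * of_nat (fact b) = (\<Prod>j<b. half + of_nat j)"
    using arg_cong[OF root_coeff_den[of b], of "\<lambda>c. c $ 0"]
    by (simp add: fact num_prod_def prod0)
  moreover have "(\<Prod>j<b. of_nat j - of_nat m) = (-1) ^ b * (\<Prod>j<b. of_nat m - of_nat j :: 'p padic_int)"
    by (induction b) (simp_all add: algebra_simps)
  moreover have "pp dvd (\<Prod>j<b. half + of_nat j) - (\<Prod>j<b. of_nat j - of_nat m :: 'p padic_int)"
    by (rule dvd_prod_diff) (simp add: h)
  ultimately have "pp dvd ?c * of_nat (fact b) - (-1) ^ b * of_nat (fact b * (m choose b))"
    by (simp only: prod_diff_of_nat)
  then have dvd: "pp dvd of_nat (fact b) * (?c - (-1) ^ b * ?B)"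
    by (simp add: algebra_simps)
  have "(of_nat (fact b) :: 'p padic_int) dvd 1"
    using assms prime_card[where 'a='p] by (intro padic_of_nat_unit) (simp add: prime_dvd_fact_iff)
  then obtain v where v: "(1 :: 'p padic_int) = of_nat (fact b) * v" by (rule dvdE)
  have "pp dvd v * (of_nat (fact b) * (?c - (-1) ^ b * ?B))" using dvd by (rule dvd_mult)
  also have "\<dots> = (of_nat (fact b) * v) * (?c - (-1) ^ b * ?B)" by (simp only: mult_ac)
  finally have "pp dvd (?c - (-1) ^ b * ?B)" unfolding v[symmetric] by simp
  then have "pp dvd (?c + (-1) ^ b * ?B) * (?c - (-1) ^ b * ?B)" by (rule dvd_mult)
  also have "(?c + (-1) ^ b * ?B) * (?c - (-1) ^ b * ?B) = ?c\<^sup>2 - ?B\<^sup>2"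
    by (simp add: power2_eq_square algebra_simps flip: power_mult_distrib)
  finally show ?thesis
    unfolding m_def[symmetric] fil_R_1_iff a_coeff_eq fps_of_nat[symmetric]
    by (simp add: fps_power_zeroth)
qed

end

section \<open>Dwork congruences\<close>

lemma digit_le_iff:
  fixes p :: nat
  assumes "b < p" "e < p"
  shows "b + p * i \<le> e + p * M \<longleftrightarrow> b \<le> e \<and> i \<le> M \<or> e < b \<and> i < M"
proof (cases i M rule: linorder_cases)
  case less
  then have "p * Suc i \<le> p * M" by (intro mult_le_mono2) simp
  then show ?thesis using less assms by auto
next
  case greater
  then have "p * Suc M \<le> p * i" by (intro mult_le_mono2) simp
  then show ?thesis using greater assms by auto
qed auto

lemma digit_less_iff: "b < p \<Longrightarrow> b + p * i < p * M \<longleftrightarrow> i < M" for p :: nat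
  using digit_le_iff[of 0 p b M i] by (auto simp: not_less)

text \<open>The two ranges distinguish whether the subtraction \<open>e + p M - j\<close> needs a
  borrow in the last digit: none for b up to e, and one for larger b, which lowers the range of
  i.\<close>

lemma sum_digits:
  fixes f :: "nat \<Rightarrow> 'a::comm_monoid_add"
  assumes "e < p"
  shows "(\<Sum>j | j < p * K \<and> j \<le> e + p * M. f j)
    = (\<Sum>i | i < K \<and> i \<le> M. \<Sum>b\<le>e. f (b + p * i))
      + (\<Sum>i | i < K \<and> i < M. \<Sum>b\<in>{e<..<p}. f (b + p * i))"
proof -
  let ?A = "{..e} \<times> {i. i < K \<and> i \<le> M}" and ?B = "{e<..<p} \<times> {i. i < K \<and> i < M}"
  have "(\<Sum>j | j < p * K \<and> j \<le> e + p * M. f j) = (\<Sum>(b, i)\<in>?A \<union> ?B. f (b + p * i))"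
  proof (rule sum.reindex_bij_witness[where i = "\<lambda>(b, i). b + p * i" and j = "\<lambda>j. (j mod p, j div p)"])
    fix j assume j: "j \<in> {j. j < p * K \<and> j \<le> e + p * M}"
    have "j mod p < p" using assms by simp
    moreover have "j mod p + p * (j div p) = j" by simp
    ultimately show "(j mod p, j div p) \<in> ?A \<union> ?B"
      using j digit_le_iff[of "j mod p" p e "j div p" M] digit_less_iff[of "j mod p" p "j div p" K] assms
      by auto
    show "(case (j mod p, j div p) of (b, i) \<Rightarrow> b + p * i) = j" by simp
    show "(case (j mod p, j div p) of (b, i) \<Rightarrow> f (b + p * i)) = f j" by simp
  next
    fix x assume "x \<in> ?A \<union> ?B"
    then show "(case x of (b, i) \<Rightarrow> b + p * i) \<in> {j. j < p * K \<and> j \<le> e + p * M}"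
      using assms digit_le_iff[of "fst x" p e "snd x" M] digit_less_iff[of "fst x" p "snd x" K]
      by auto
    show "((case x of (b, i) \<Rightarrow> b + p * i) mod p, (case x of (b, i) \<Rightarrow> b + p * i) div p) = x"
      using \<open>x \<in> ?A \<union> ?B\<close> assms by auto
  qed
  also have "\<dots> = (\<Sum>(b, i)\<in>?A. f (b + p * i)) + (\<Sum>(b, i)\<in>?B. f (b + p * i))"
    by (rule sum.union_disjoint) auto
  also have "(\<Sum>(b, i)\<in>?A. f (b + p * i)) = (\<Sum>i | i < K \<and> i \<le> M. \<Sum>b\<le>e. f (b + p * i))"
    by (subst sum.swap) (simp add: sum.cartesian_product)
  also have "(\<Sum>(b, i)\<in>?B. f (b + p * i)) = (\<Sum>i | i < K \<and> i < M. \<Sum>b\<in>{e<..<p}. f (b + p * i))"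
    by (subst sum.swap) (simp add: sum.cartesian_product)
  finally show ?thesis .
qed

text \<open>Antisymmetry forces E 0 0 = 0, R having no 2-torsion. With r = 0 the second hypothesis
  then allows either argument to be moved from 0 to an arbitrary value.\<close>

lemma fil_R_antisym:
  fixes E :: "nat \<Rightarrow> nat \<Rightarrow> 'p::prime_card padic_int fps"
  assumes anti: "\<And>x y. E x y = - E y x"
    and lip: "\<And>r x j y. fil_R (r + c) (E (x + CARD('p) ^ r * j) y - E x y)"
  shows "fil_R c (E x y)"
proof -
  have "E 0 0 + E 0 0 = 0" by (subst (2) anti) (rule right_minus)
  then have "E 0 0 $ n + E 0 0 $ n = 0" for n by (metis fps_add_nth fps_zero_nth)
  then have "E 0 0 = 0" by (simp add: fps_eq_iff)
  then have "fil_R c (E x 0)" for x using lip[of 0 0 x 0] by simp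
  then have "fil_R c (E 0 y)" for y using anti[of 0 y] by simp
  then show ?thesis using lip[of 0 0 x y] fil_R_add[of c "E x y - E 0 y" "E 0 y"] by simp
qed

text \<open>Splitting off the last digits \<open>b\<close> and \<open>t - b\<close> of \<open>j\<close> and \<open>N - j\<close> turns an antisymmetric kernel
  into an antisymmetric kernel of better regularity; \<open>b \<mapsto> t - b\<close> permutes the possible digits.\<close>

lemma dwork_kernel:
  fixes E :: "nat \<Rightarrow> nat \<Rightarrow> 'p::prime_card padic_int fps" and g :: "nat \<Rightarrow> nat \<Rightarrow> 'p padic_int fps"
  assumes g: "\<And>b r i j. fil_R (Suc r) (g b (i + CARD('p) ^ r * j) - g b i)"
    and anti: "\<And>x y. E x y = - E y x"
    and lip: "\<And>r x j y. fil_R (r + c) (E (x + CARD('p) ^ r * j) y - E x y)"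
    and B: "\<And>b. b \<in> B \<Longrightarrow> b \<le> t \<and> t - b \<in> B"
  defines "G \<equiv> \<lambda>x y. \<Sum>b\<in>B. g b x * g (t - b) y * E (b + CARD('p) * x) (t - b + CARD('p) * y)"
  shows "G x y = - G y x" and "fil_R (r + Suc c) (G (x + CARD('p) ^ r * j) y - G x y)"
proof -
  have "G x y = (\<Sum>b\<in>B. g (t - b) x * g b y * E (t - b + CARD('p) * x) (b + CARD('p) * y))"
    unfolding G_def
    by (rule sum.reindex_bij_witness[where i = "\<lambda>b. t - b" and j = "\<lambda>b. t - b"])
      (simp_all add: B[THEN conjunct1] B[THEN conjunct2])
  also have "\<dots> = - G y x"
    unfolding G_def sum_negf[symmetric]
  proof (rule sum.cong[OF refl])
    fix b
    show "g (t - b) x * g b y * E (t - b + CARD('p) * x) (b + CARD('p) * y)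
        = - (g b y * g (t - b) x * E (b + CARD('p) * y) (t - b + CARD('p) * x))"
      by (subst anti) (simp add: mult.commute)
  qed
  finally show "G x y = - G y x" .
  show "fil_R (r + Suc c) (G (x + CARD('p) ^ r * j) y - G x y)"
    unfolding G_def sum_subtractf[symmetric]
  proof (rule fil_R_sum)
    fix b
    let ?x' = "x + CARD('p) ^ r * j"
    let ?E = "\<lambda>x. E (b + CARD('p) * x) (t - b + CARD('p) * y)"
    \<comment> \<open>Each summand gains one power of J: the first from the change of g, the second
      because the argument of E moves by \<open>p^(r+1) j\<close>.\<close>
    have "g b ?x' * g (t - b) y * ?E ?x' - g b x * g (t - b) y * ?E x
        = g (t - b) y * ((g b ?x' - g b x) * ?E ?x') + g b x * g (t - b) y * (?E ?x' - ?E x)"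
      by (simp add: algebra_simps)
    moreover have "fil_R (Suc r + c) ((g b ?x' - g b x) * ?E ?x')"
      by (intro fil_R_mult g fil_R_antisym[OF anti lip])
    moreover have "fil_R (Suc r + c) (?E ?x' - ?E x)"
      using lip[of "Suc r" "b + CARD('p) * x" j] by (simp add: algebra_simps)
    ultimately show "fil_R (r + Suc c) (g b ?x' * g (t - b) y * ?E ?x' - g b x * g (t - b) y * ?E x)"
      by (simp add: fil_R_add fil_R_mult_left)
  qed
qed

text \<open>Each digit of the truncation is traded for one unit of c, so \<open>s + c\<close> is
  preserved. Removing a digit replaces E by the kernel of \<open>dwork_kernel\<close> and a k by a
  (Suc k), whence the generalisation over E, c, N and k. For s = 0 only j = 0 remains.\<close>

lemma dwork_sum:
  fixes E :: "nat \<Rightarrow> nat \<Rightarrow> 'p::prime_card padic_int fps"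
    and a :: "nat \<Rightarrow> nat \<Rightarrow> 'p padic_int fps" and g :: "nat \<Rightarrow> nat \<Rightarrow> nat \<Rightarrow> 'p padic_int fps"
  assumes step: "\<And>k b i. b < CARD('p) \<Longrightarrow> a k (b + CARD('p) * i) = a (Suc k) i * g k b i"
    and g: "\<And>k b r i j. fil_R (Suc r) (g k b (i + CARD('p) ^ r * j) - g k b i)"
    and anti: "\<And>x y. E x y = - E y x"
    and lip: "\<And>r x j y. fil_R (r + c) (E (x + CARD('p) ^ r * j) y - E x y)"
  shows "fil_R (s + c) (\<Sum>j | j < CARD('p) ^ s \<and> j \<le> N. a k j * a k (N - j) * E j (N - j))"
  using anti lip
proof (induction s arbitrary: E c N k)
  case 0
  have "{j. j < CARD('p) ^ 0 \<and> j \<le> N} = {0}" by auto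
  then show ?case using fil_R_antisym[of E, OF 0] by (simp add: fil_R_mult_left)
next
  case (Suc s)
  let ?p = "CARD('p)"
  define e M where "e = N mod ?p" and "M = N div ?p"
  have e: "e < ?p" unfolding e_def by simp
  have N: "N = e + ?p * M" unfolding e_def M_def by simp
  define f where "f j = a k j * a k (N - j) * E j (N - j)" for j
  define G where "G t B x y = (\<Sum>b\<in>B. g k b x * g k (t - b) y * E (b + ?p * x) (t - b + ?p * y))"
    for t B x y
  have term_eq: "(\<Sum>b\<in>B. f (b + ?p * i)) = a (Suc k) i * a (Suc k) (L - i) * G t B i (L - i)"
    if B: "\<And>b. b \<in> B \<Longrightarrow> b < ?p \<and> b \<le> t \<and> t - b < ?p" and "i \<le> L" and tL: "t + ?p * L = N"
    for B t L i
    unfolding G_def sum_distrib_left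
  proof (rule sum.cong[OF refl])
    fix b assume "b \<in> B"
    have "?p * i \<le> ?p * L" using \<open>i \<le> L\<close> by simp
    then have diff: "N - (b + ?p * i) = t - b + ?p * (L - i)"
      unfolding tL[symmetric] using B[OF \<open>b \<in> B\<close>] by (simp add: diff_mult_distrib2)
    show "f (b + ?p * i) = a (Suc k) i * a (Suc k) (L - i)
        * (g k b i * g k (t - b) (L - i) * E (b + ?p * i) (t - b + ?p * (L - i)))"
      unfolding f_def diff using B[OF \<open>b \<in> B\<close>] by (simp only: step) (simp only: mult_ac)
  qed
  have part: "fil_R (Suc s + c) (\<Sum>i | i < ?p ^ s \<and> i \<le> L. \<Sum>b\<in>B. f (b + ?p * i))"
    if B: "\<And>b. b \<in> B \<Longrightarrow> b < ?p \<and> b \<le> t \<and> t - b \<in> B" and tL: "t + ?p * L = N" for B t L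
  proof -
    have B': "\<And>b. b \<in> B \<Longrightarrow> b < ?p \<and> b \<le> t \<and> t - b < ?p" using B by blast
    have "(\<Sum>i | i < ?p ^ s \<and> i \<le> L. \<Sum>b\<in>B. f (b + ?p * i))
        = (\<Sum>i | i < ?p ^ s \<and> i \<le> L. a (Suc k) i * a (Suc k) (L - i) * G t B i (L - i))"
      by (intro sum.cong refl term_eq[OF B' _ tL]) auto
    moreover have "fil_R (s + Suc c)
        (\<Sum>i | i < ?p ^ s \<and> i \<le> L. a (Suc k) i * a (Suc k) (L - i) * G t B i (L - i))"
    proof (rule Suc.IH)
      show "G t B x y = - G t B y x" for x y
        unfolding G_def by (rule dwork_kernel(1)[OF g Suc.prems]) (use B in blast)+
      show "fil_R (r + Suc c) (G t B (x + ?p ^ r * j) y - G t B x y)" for r x j y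
        unfolding G_def by (rule dwork_kernel(2)[OF g Suc.prems]) (use B in blast)+
    qed
    ultimately show ?thesis by simp
  qed
  have low: "fil_R (Suc s + c) (\<Sum>i | i < ?p ^ s \<and> i \<le> M. \<Sum>b\<le>e. f (b + ?p * i))"
    using e N by (intro part[of _ e]) auto
  \<comment> \<open>With a borrow, the last digits of j and N - j add up to \<open>p + e\<close>
    instead of e, and the remaining parts to M - 1.\<close>
  have high: "fil_R (Suc s + c) (\<Sum>i | i < ?p ^ s \<and> i < M. \<Sum>b\<in>{e<..<?p}. f (b + ?p * i))"
  proof (cases M)
    case (Suc L)
    have "fil_R (Suc s + c) (\<Sum>i | i < ?p ^ s \<and> i \<le> L. \<Sum>b\<in>{e<..<?p}. f (b + ?p * i))"
      using N Suc by (intro part[of _ "?p + e"]) auto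
    then show ?thesis using Suc by (simp add: less_Suc_eq_le)
  qed simp
  show ?case
    using fil_R_add[OF low high] sum_digits[OF e, where K = "?p ^ s" and M = M and f = f] unfolding N[symmetric] f_def
    by simp
qed

section \<open>The filtration of power series over R\<close>

text \<open>The n-th step is \<open>J^n R[[\<lambda>]]\<close>; as \<lambda> does not belong to J,
  the same bound applies to every coefficient in \<lambda>.\<close>

definition fil :: "nat \<Rightarrow> 'p::prime_card padic_int fps fps \<Rightarrow> bool" where
  "fil n x \<longleftrightarrow> (\<forall>i. fil_R n (x $ i))"

lemma fil_0 [simp]: "fil 0 x" and fil_zero [simp]: "fil n 0"
  by (simp_all add: fil_def)

lemma fil_add: "fil n x \<Longrightarrow> fil n y \<Longrightarrow> fil n (x + y)"
  by (simp add: fil_def fil_R_add)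

lemma fil_diff: "fil n x \<Longrightarrow> fil n y \<Longrightarrow> fil n (x - y)"
  by (simp add: fil_def fil_R_diff)

lemma fil_minus_iff [simp]: "fil n (- x) \<longleftrightarrow> fil n x"
  by (simp add: fil_def)

lemma fil_mono: "fil n x \<Longrightarrow> m \<le> n \<Longrightarrow> fil m x"
  unfolding fil_def using fil_R_mono by blast

lemma fil_mult: "fil m x \<Longrightarrow> fil n y \<Longrightarrow> fil (m + n) (x * y)"
  unfolding fil_def fps_mult_nth by (intro allI fil_R_sum fil_R_mult) auto

lemma fil_mult_left: "fil n y \<Longrightarrow> fil n (x * y)"
  using fil_mult[of 0 x n y] by simp

lemma fil_mult_right: "fil n x \<Longrightarrow> fil n (x * y)"
  using fil_mult[of n x 0 y] by simp

lemma fil_cong_mult: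
  assumes "fil n (x - x')" "fil n (y - y')"
  shows "fil n (x * y - x' * y')"
proof -
  have "x * y - x' * y' = (x - x') * y + x' * (y - y')" by (simp add: algebra_simps)
  then show ?thesis using assms by (simp add: fil_add fil_mult_left fil_mult_right)
qed

lemma fil_cong_trans: "fil n (x - y) \<Longrightarrow> fil n (y - z) \<Longrightarrow> fil n (x - z)"
  using fil_add[of n "x - y" "y - z"] by simp

lemma fil_cong_sym: "fil n (x - y) \<Longrightarrow> fil n (y - x)"
  using fil_minus_iff[of n "x - y"] by simp

lemma fil_cancel_unit:
  assumes "fil n (x * u - y * u)" "u dvd 1" shows "fil n (x - y)"
proof -
  obtain v where "u * v = 1" using assms(2) by (metis dvdE)
  then have "(x * u - y * u) * v = x - y" by (simp add: left_diff_distrib mult.assoc)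
  then show ?thesis using fil_mult_right[OF assms(1), of v] by simp
qed

lemma fil_const_iff [simp]: "fil n (fps_const c) \<longleftrightarrow> fil_R n c"
  unfolding fil_def by (auto elim: allE[of _ 0])

text \<open>Compatibility with the filtration is the form of continuity that lets statements about
  polynomials divided by powers of h pass to limits.\<close>

definition fil_hom :: "('p::prime_card padic_int fps fps \<Rightarrow> 'p padic_int fps fps) \<Rightarrow> bool" where
  "fil_hom \<psi> \<longleftrightarrow> \<psi> 1 = 1 \<and> (\<forall>x y. \<psi> (x + y) = \<psi> x + \<psi> y) \<and> (\<forall>x y. \<psi> (x * y) = \<psi> x * \<psi> y)
     \<and> (\<forall>n x. fil n x \<longrightarrow> fil n (\<psi> x))"

lemma fil_homD:
  assumes "fil_hom \<psi>"
  shows "\<psi> 1 = 1" "\<psi> (x + y) = \<psi> x + \<psi> y" "\<psi> (x * y) = \<psi> x * \<psi> y" "fil n x \<Longrightarrow> fil n (\<psi> x)"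
    "\<psi> 0 = 0" "\<psi> (x - y) = \<psi> x - \<psi> y"
proof -
  have add: "\<psi> (x + y) = \<psi> x + \<psi> y" for x y using assms by (simp add: fil_hom_def)
  from add[of 0 0] show "\<psi> 0 = 0" by simp
  from add[of "x - y" y] show "\<psi> (x - y) = \<psi> x - \<psi> y" by simp
qed (use assms in \<open>auto simp: fil_hom_def\<close>)

lemma fil_hom_power: "fil_hom \<psi> \<Longrightarrow> \<psi> (x ^ n) = \<psi> x ^ n"
  by (induction n) (simp_all add: fil_homD)

lemma fil_hom_sum: "fil_hom \<psi> \<Longrightarrow> \<psi> (sum f A) = (\<Sum>i\<in>A. \<psi> (f i))"
  by (induction A rule: infinite_finite_induct) (simp_all add: fil_homD)

lemma fil_hom_comp: "fil_hom \<psi> \<Longrightarrow> fil_hom \<chi> \<Longrightarrow> fil_hom (\<psi> \<circ> \<chi>)"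
  by (auto simp: fil_hom_def)

section \<open>The coefficients of \<sigma>, \<rho> and Frobenius images, and the commutation
  relations\<close>

lemma sigma_nth: "sigma l x $ n = subst_q l (x $ n)"
  by (simp add: sigma_def coeff_map_def subst_q_def)

lemma rho_nth: "rho m x $ n = q_power m ^ n * x $ n"
  by (simp add: rho_def fps_compose_linear)

lemma frob_eq: "frob x = fps_compose (sigma pp x) (fps_X ^ CARD('p))"
  for x :: "'p::prime_card padic_int fps fps"
  unfolding frob_def q_power_card subst_q_def[symmetric] sigma_def ..

lemma fps_nth_compose_power_X:
  assumes "p > 0"
  shows "fps_compose a (fps_X ^ p) $ n = (if p dvd n then a $ (n div p) else (0 :: 'a::comm_ring_1))"
proof -
  have "fps_compose a (fps_X ^ p) $ n = (\<Sum>i = 0..n. if i = n div p \<and> p dvd n then a $ i else 0)"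
    unfolding fps_compose_nth power_mult[symmetric] fps_X_power_nth
    using assms by (intro sum.cong refl) auto
  also have "\<dots> = (if p dvd n then \<Sum>i = 0..n. if i = n div p then a $ i else 0 else 0)" by simp
  also have "\<dots> = (if p dvd n then a $ (n div p) else 0)" by simp
  finally show ?thesis .
qed

lemma frob_nth: "(frob x :: 'p::prime_card padic_int fps fps) $ n
    = (if CARD('p) dvd n then subst_q pp (x $ (n div CARD('p))) else 0)"
  by (simp add: frob_eq fps_nth_compose_power_X sigma_nth)

lemma fil_hom_sigma: "fil_hom (sigma l)"
  unfolding fil_hom_def
proof (intro conjI allI impI)
  show "sigma l 1 = 1" by (rule fps_ext) (simp add: sigma_nth)
  show "sigma l (x + y) = sigma l x + sigma l y" for x y
    by (rule fps_ext) (simp add: sigma_nth subst_q_add)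
  show "sigma l (x * y) = sigma l x * sigma l y" for x y
    by (rule fps_ext) (simp add: sigma_nth fps_mult_nth subst_q_sum subst_q_mult)
  show "fil n x \<Longrightarrow> fil n (sigma l x)" for n x
    by (simp add: fil_def sigma_nth fil_R_subst_q)
qed

lemma fil_hom_rho: "fil_hom (rho m)"
  unfolding fil_hom_def
proof (intro conjI allI impI)
  show "rho m 1 = 1" by (simp add: rho_def)
  show "rho m (x + y) = rho m x + rho m y" for x y
    by (simp add: rho_def fps_compose_add_distrib)
  show "rho m (x * y) = rho m x * rho m y" for x y
    by (simp add: rho_def fps_compose_mult_distrib)
  show "fil n x \<Longrightarrow> fil n (rho m x)" for n x
    by (simp add: fil_def rho_nth fil_R_mult_left)
qed

lemma fil_hom_frob: "fil_hom (frob :: 'p::prime_card padic_int fps fps \<Rightarrow> _)"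
  unfolding fil_hom_def
proof (intro conjI allI impI)
  have X: "(fps_X ^ CARD('p) :: 'p padic_int fps fps) $ 0 = 0" by simp
  show "frob 1 = (1 :: 'p padic_int fps fps)"
    by (simp add: frob_eq fil_homD[OF fil_hom_sigma])
  show "frob (x + y) = frob x + frob y" for x y :: "'p padic_int fps fps"
    by (simp add: frob_eq fil_homD[OF fil_hom_sigma] fps_compose_add_distrib)
  show "frob (x * y) = frob x * frob y" for x y :: "'p padic_int fps fps"
    by (simp add: frob_eq fil_homD[OF fil_hom_sigma] fps_compose_mult_distrib[OF X])
  show "fil n x \<Longrightarrow> fil n (frob x)" for n and x :: "'p padic_int fps fps"
    by (simp add: fil_def frob_nth fil_R_subst_q)
qed

lemma sigma_rho: "sigma l (rho m x) = rho (l * m) (sigma l x)"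
  by (rule fps_ext) (simp add: sigma_nth rho_nth subst_q_mult subst_q_power subst_q_q_power)

lemma sigma_sigma: "sigma l (sigma k x) = sigma (l * k) x"
  by (rule fps_ext) (simp add: sigma_nth subst_q_subst_q)

lemma rho_rho: "rho m (rho n x) = rho (m + n) x"
  by (rule fps_ext) (simp add: rho_nth q_power_add power_mult_distrib)

lemma sigma_frob: "sigma l (frob x) = frob (sigma l x)"
  by (rule fps_ext) (simp add: sigma_nth frob_nth subst_q_subst_q mult.commute)

lemma rho_frob: "rho m (frob x) = frob (rho m x)"
  by (rule fps_ext)
    (auto simp: rho_nth frob_nth subst_q_mult subst_q_power subst_q_q_power q_power_of_nat_mult
      simp flip: power_mult)

lemma sigma_one [simp]: "sigma 1 x = x"
  by (rule fps_ext) (simp add: sigma_nth)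

lemma rho_zero [simp]: "rho 0 x = x"
  by (rule fps_ext) (simp add: rho_nth)

section \<open>The Dwork congruence for F\<close>

text \<open>\<open>frob B\<close> has only exponents divisible by p, so in degree
  \<open>e + p N\<close> only the indices p j contribute.\<close>

lemma mult_frob_nth:
  fixes A B :: "'p::prime_card padic_int fps fps"
  assumes "e < CARD('p)"
  shows "(A * frob B) $ (e + CARD('p) * N)
    = (\<Sum>j\<le>N. A $ (e + CARD('p) * (N - j)) * subst_q pp (B $ j))"
proof -
  let ?p = "CARD('p)"
  let ?f = "\<lambda>i. frob B $ i * A $ (e + ?p * N - i)"
  have "(frob B * A) $ (e + ?p * N) = sum ?f {0..e + ?p * N}" by (rule fps_mult_nth)
  also have "\<dots> = sum ?f ((\<lambda>j. ?p * j) ` {..N})"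
  proof (rule sum.mono_neutral_right)
    show "(\<lambda>j. ?p * j) ` {..N} \<subseteq> {0..e + ?p * N}"
      using mult_le_mono2[of _ N ?p] by (fastforce intro: trans_le_add2)
    show "\<forall>i\<in>{0..e + ?p * N} - (\<lambda>j. ?p * j) ` {..N}. ?f i = 0"
    proof
      fix i assume i: "i \<in> {0..e + ?p * N} - (\<lambda>j. ?p * j) ` {..N}"
      have "\<not> ?p dvd i"
      proof
        assume "?p dvd i"
        then obtain j where j: "i = ?p * j" by (rule dvdE)
        then have "j \<le> N" using i digit_le_iff[of 0 ?p e j N] assms by auto
        then show False using i j by auto
      qed
      then show "?f i = 0" by (simp add: frob_nth)
    qed
  qed simp
  also have "\<dots> = (\<Sum>j\<le>N. ?f (?p * j))"
    by (subst sum.reindex) (auto simp: inj_on_def)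
  also have "\<dots> = (\<Sum>j\<le>N. A $ (e + ?p * (N - j)) * subst_q pp (B $ j))"
    by (intro sum.cong refl) (simp add: frob_nth diff_mult_distrib2 mult.commute)
  finally show ?thesis by (simp add: mult.commute)
qed

lemma fil_I_digits:
  assumes "\<And>e N. e < CARD('p) \<Longrightarrow> fil_R n (x $ (e + CARD('p) * N))"
  shows "fil n (x :: 'p::prime_card padic_int fps fps)"
  unfolding fil_def
proof
  fix i
  show "fil_R n (x $ i)" using assms[of "i mod CARD('p)" "i div CARD('p)"] by simp
qed

lemma h_poly_nth: "fps_of_poly (h_poly n :: 'a::comm_ring_1 poly) $ i = of_nat ((((n - 1) div 2) choose i)\<^sup>2)"
proof -
  have "fps_of_poly (h_poly n :: 'a poly) $ i
      = (\<Sum>j\<le>(n - 1) div 2. if j = i then of_nat ((((n - 1) div 2) choose j)\<^sup>2) else 0)"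
    by (simp add: h_poly_def coeff_sum del: of_nat_power)
  also have "\<dots> = of_nat ((((n - 1) div 2) choose i)\<^sup>2)" by (simp add: sum.delta binomial_eq_0 del: of_nat_power)
  finally show ?thesis .
qed

definition F_trunc :: "nat \<Rightarrow> 'p::prime_card padic_int fps fps" where
  "F_trunc s = Abs_fps (\<lambda>n. if n < CARD('p) ^ s then a_coeff n else 0)"

context
  assumes odd_card: "odd CARD('p::prime_card)"
begin

text \<open>In degree \<open>e + p N\<close> both products are sums of
  \<open>\<phi>(a_j) \<phi>(a_{N-j})\<close> over truncated j, weighted by
  \<open>step_quotient e\<close> at N - j in one and at j in the other. Their difference is the
  antisymmetric kernel E.\<close>

lemma dwork_congruence:
  "fil (Suc s) (F_series * frob (F_trunc s) - F_trunc (Suc s) * frob (F_series :: 'p padic_int fps fps))"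
proof (rule fil_I_digits)
  fix e N assume e: "e < CARD('p)"
  let ?p = "CARD('p)" and ?\<phi> = "subst_q (pp :: 'p padic_int)"
  define a g where "a k i = (?\<phi> ^^ k) (a_coeff i)" and "g k b i = (?\<phi> ^^ k) (step_quotient b i)"
    for k b i
  define E where "E i j = step_quotient e j - (step_quotient e i :: 'p padic_int fps)" for i j
  have hom: "(?\<phi> ^^ k) (x * y) = (?\<phi> ^^ k) x * (?\<phi> ^^ k) y" "(?\<phi> ^^ k) (x - y) = (?\<phi> ^^ k) x - (?\<phi> ^^ k) y"
    "fil_R n x \<Longrightarrow> fil_R n ((?\<phi> ^^ k) x)" for k n x y
    by (induction k) (simp_all add: subst_q_mult subst_q_diff fil_R_subst_q)
  have step: "a k (b + ?p * i) = a (Suc k) i * g k b i" if "b < ?p" for k b i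
    using that by (simp add: a_def g_def a_coeff_step[OF odd_card] hom funpow_swap1)
  have lip: "fil_R (Suc r) (g k b (i + ?p ^ r * j) - g k b i)" for k b r i j
    unfolding g_def hom(2)[symmetric] by (intro hom fil_R_step_quotient[OF odd_card])
  \<comment> \<open>Level 1 because the coefficients enter already twisted by \<phi> once; c = 1
    because \<open>step_quotient\<close> itself gains one power of J.\<close>
  have "fil_R (s + 1) (\<Sum>j | j < ?p ^ s \<and> j \<le> N. a 1 j * a 1 (N - j) * E j (N - j))"
  proof (rule dwork_sum[where g = g])
    show "E x y = - E y x" for x y by (simp add: E_def)
    show "\<And>k b i. b < ?p \<Longrightarrow> a k (b + ?p * i) = a (Suc k) i * g k b i" by (rule step)
    show "\<And>k b r i j. fil_R (Suc r) (g k b (i + ?p ^ r * j) - g k b i)" by (rule lip)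
    show "fil_R (r + 1) (E (x + ?p ^ r * j) y - E x y)" for r x j y
      using fil_R_cong_sym[OF fil_R_step_quotient[OF odd_card, of r e x j]] by (simp add: E_def)
  qed
  also have "(\<Sum>j | j < ?p ^ s \<and> j \<le> N. a 1 j * a 1 (N - j) * E j (N - j))
      = (\<Sum>j\<le>N. if j < ?p ^ s then a 1 j * a 1 (N - j) * E j (N - j) else 0)"
    by (subst sum.If_cases) (auto intro: sum.cong)
  \<comment> \<open>The second product is indexed in reverse so that both truncations become the
    condition \<open>j < p^s\<close>: as e < p, it is equivalent to
    \<open>e + p j < p^(s+1)\<close>.\<close>
  also have "\<dots> = (\<Sum>j\<le>N. F_series $ (e + ?p * (N - j)) * ?\<phi> (F_trunc s $ j))
      - (\<Sum>j\<le>N. F_trunc (Suc s) $ (e + ?p * j) * ?\<phi> (F_series $ (N - j)))"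
    unfolding sum_subtractf[symmetric]
  proof (rule sum.cong[OF refl])
    fix j
    have "F_trunc (Suc s) $ (e + ?p * j) = (if j < ?p ^ s then a_coeff (e + ?p * j) else (0 :: 'p padic_int fps))"
      using digit_less_iff[OF e, of j "?p ^ s"] by (simp add: F_trunc_def)
    then have trunc: "F_trunc (Suc s) $ (e + ?p * j)
        = (if j < ?p ^ s then ?\<phi> (a_coeff j) * step_quotient e j else 0)"
      by (simp only: a_coeff_step[OF odd_card e])
    have series: "F_series $ (e + ?p * (N - j)) = ?\<phi> (a_coeff (N - j)) * step_quotient e (N - j)"
      by (simp only: F_series_def fps_nth_Abs_fps a_coeff_step[OF odd_card e])
    show "(if j < ?p ^ s then a 1 j * a 1 (N - j) * E j (N - j) else 0)
        = F_series $ (e + ?p * (N - j)) * ?\<phi> (F_trunc s $ j)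
          - F_trunc (Suc s) $ (e + ?p * j) * ?\<phi> (F_series $ (N - j))"
      unfolding trunc series by (simp add: F_series_def F_trunc_def a_def E_def algebra_simps)
  qed
  also have "(\<Sum>j\<le>N. F_trunc (Suc s) $ (e + ?p * j) * ?\<phi> (F_series $ (N - j)))
      = (\<Sum>j\<le>N. F_trunc (Suc s) $ (e + ?p * (N - j)) * ?\<phi> (F_series $ j))"
    by (rule sum.reindex_bij_witness[where i = "\<lambda>j. N - j" and j = "\<lambda>j. N - j"]) auto
  finally show "fil_R (Suc s)
      ((F_series * frob (F_trunc s) - F_trunc (Suc s) * frob (F_series :: 'p padic_int fps fps)) $ (e + ?p * N))"
    unfolding fps_sub_nth mult_frob_nth[OF e] by simp
qed

lemma F_series_0 [simp]: "(F_series :: 'p padic_int fps fps) $ 0 = 1"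
  by (simp add: F_series_def a_coeff_0[OF odd_card])

lemma F_trunc_0: "(F_trunc 0 :: 'p padic_int fps fps) = 1"
  by (rule fps_ext) (simp add: F_trunc_def a_coeff_0[OF odd_card])

text \<open>As h has degree below p, the product with \<open>frob (F_trunc s)\<close> has a single
  term in each degree. Modulo J the factor \<open>step_quotient e N\<close> is independent of N, so
  it equals its value \<open>a_coeff e\<close> at 0, which is the coefficient of h.\<close>

lemma fil_F_trunc_Suc:
  "fil (Suc 0) (F_trunc (Suc s) - fps_of_poly (h_poly CARD('p)) * frob (F_trunc s :: 'p padic_int fps fps))"
proof (rule fil_I_digits)
  fix e N assume e: "e < CARD('p)"
  let ?p = "CARD('p)" and ?\<phi> = "subst_q (pp :: 'p padic_int)"
  let ?H = "fps_of_poly (h_poly CARD('p)) :: 'p padic_int fps fps"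
  have H: "?H $ (e + ?p * (N - j)) = 0" if "j \<le> N" "j \<noteq> N" for j
  proof -
    have "?p * 1 \<le> ?p * (N - j)" using that by (intro mult_le_mono2) simp
    moreover have "(?p - 1) div 2 < ?p" using e by linarith
    ultimately have "(?p - 1) div 2 < e + ?p * (N - j)" by linarith
    then show ?thesis unfolding h_poly_nth by (simp add: binomial_eq_0)
  qed
  have "(?H * frob (F_trunc s)) $ (e + ?p * N)
      = (\<Sum>j\<le>N. if j = N then ?H $ e * ?\<phi> (F_trunc s $ N) else 0)"
    unfolding mult_frob_nth[OF e] by (intro sum.cong refl) (use H in auto)
  also have "\<dots> = ?H $ e * ?\<phi> (F_trunc s $ N)" by simp
  finally have prod: "(?H * frob (F_trunc s)) $ (e + ?p * N) = ?H $ e * ?\<phi> (F_trunc s $ N)" .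
  have eq: "(F_trunc (Suc s) - ?H * frob (F_trunc s)) $ (e + ?p * N)
      = (if N < ?p ^ s then ?\<phi> (a_coeff N) * (step_quotient e N - ?H $ e) else 0)"
  proof -
    have "F_trunc (Suc s) $ (e + ?p * N)
        = (if N < ?p ^ s then ?\<phi> (a_coeff N) * step_quotient e N else 0)"
      using digit_less_iff[OF e, of N "?p ^ s"]
      by (simp add: F_trunc_def a_coeff_step[OF odd_card e])
    then show ?thesis
      unfolding fps_sub_nth prod by (simp add: F_trunc_def algebra_simps)
  qed
  have "fil_R (Suc 0) (step_quotient e N - (step_quotient e 0 :: 'p padic_int fps))"
    using fil_R_step_quotient[OF odd_card, of 0 e 0 N] by simp
  moreover have "step_quotient e 0 = (a_coeff e :: 'p padic_int fps)"
    using a_coeff_step[OF odd_card e, of 0] by (simp add: a_coeff_0[OF odd_card])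
  moreover have "fil_R (Suc 0) (a_coeff e - ?H $ e)"
    unfolding h_poly_nth by (rule fil_R_a_coeff_binomial[OF odd_card e])
  ultimately have "fil_R (Suc 0) (step_quotient e N - ?H $ e)" using fil_R_cong_trans by metis
  then show "fil_R (Suc 0) ((F_trunc (Suc s) - ?H * frob (F_trunc s)) $ (e + ?p * N))"
    unfolding eq by (simp add: fil_R_mult_left)
qed

end

section \<open>Subrings as modules over themselves\<close>

definition closed_subring :: "'a::comm_ring_1 set \<Rightarrow> bool" where
  "closed_subring A \<longleftrightarrow> 1 \<in> A \<and> (\<forall>x\<in>A. - x \<in> A) \<and> (\<forall>x\<in>A. \<forall>y\<in>A. x + y \<in> A \<and> x * y \<in> A)"

lemma closed_subringD:
  assumes "closed_subring A"
  shows "1 \<in> A" "0 \<in> A" "x \<in> A \<Longrightarrow> - x \<in> A" "x \<in> A \<Longrightarrow> y \<in> A \<Longrightarrow> x + y \<in> A"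
    "x \<in> A \<Longrightarrow> y \<in> A \<Longrightarrow> x * y \<in> A" "x \<in> A \<Longrightarrow> y \<in> A \<Longrightarrow> x - y \<in> A"
proof -
  have A: "1 \<in> A" "\<And>x. x \<in> A \<Longrightarrow> - x \<in> A" "\<And>x y. x \<in> A \<Longrightarrow> y \<in> A \<Longrightarrow> x + y \<in> A"
    "\<And>x y. x \<in> A \<Longrightarrow> y \<in> A \<Longrightarrow> x * y \<in> A"
    using assms by (auto simp: closed_subring_def)
  from A(3)[OF A(1) A(2)[OF A(1)]] show "0 \<in> A" by simp
  show "x \<in> A \<Longrightarrow> y \<in> A \<Longrightarrow> x - y \<in> A" using A(3)[of x "- y"] A(2)[of y] by simp
qed (use assms in \<open>auto simp: closed_subring_def\<close>)

lemma closed_subring_power: "closed_subring A \<Longrightarrow> x \<in> A \<Longrightarrow> x ^ n \<in> A"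
  by (induction n) (simp_all add: closed_subringD)

lemma closed_subring_sum:
  "closed_subring A \<Longrightarrow> (\<And>i. i \<in> I \<Longrightarrow> f i \<in> A) \<Longrightarrow> sum f I \<in> A"
  by (induction I rule: infinite_finite_induct) (simp_all add: closed_subringD)

lemma closed_subring_of_nat: "closed_subring A \<Longrightarrow> of_nat n \<in> A"
  by (induction n) (simp_all add: closed_subringD)

lemma closed_subring_UNIV: "closed_subring UNIV"
  by (simp add: closed_subring_def)

lemma ring_on_simps [simp]:
  "carrier (ring_on A) = A" "mult (ring_on A) = (*)" "one (ring_on A) = 1" "zero (ring_on A) = 0"
  "add (ring_on A) = (+)"
  by (simp_all add: ring_on_def)

lemma module_on_simps [simp]:
  "carrier (module_on A) = A" "mult (module_on A) = (*)" "one (module_on A) = 1"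
  "zero (module_on A) = 0" "add (module_on A) = (+)" "smult (module_on A) = (*)"
  by (simp_all add: module_on_def)

lemma cring_ring_on: assumes "closed_subring A" shows "cring (ring_on A)"
proof (rule cringI)
  show "abelian_group (ring_on A)"
  proof (rule abelian_groupI)
    fix x assume "x \<in> carrier (ring_on A)"
    then show "\<exists>y\<in>carrier (ring_on A). y \<oplus>\<^bsub>ring_on A\<^esub> x = \<zero>\<^bsub>ring_on A\<^esub>"
      using closed_subringD(3)[OF assms] by (intro bexI[of _ "- x"]) auto
  qed (auto simp: closed_subringD[OF assms] algebra_simps)
  show "comm_monoid (ring_on A)"
    by (rule comm_monoidI) (auto simp: closed_subringD[OF assms] algebra_simps)
qed (simp add: algebra_simps)

lemma module_module_on: assumes "closed_subring A" shows "module (ring_on A) (module_on A)"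
proof (rule moduleI)
  show "cring (ring_on A)" using cring_ring_on[OF assms] .
  show "abelian_group (module_on A)"
  proof (rule abelian_groupI)
    fix x assume "x \<in> carrier (module_on A)"
    then show "\<exists>y\<in>carrier (module_on A). y \<oplus>\<^bsub>module_on A\<^esub> x = \<zero>\<^bsub>module_on A\<^esub>"
      using closed_subringD(3)[OF assms] by (intro bexI[of _ "- x"]) auto
  qed (auto simp: closed_subringD[OF assms] algebra_simps)
qed (auto simp: closed_subringD[OF assms] algebra_simps)

lemma a_inv_module_on: assumes "closed_subring A" "x \<in> A" shows "\<ominus>\<^bsub>module_on A\<^esub> x = - x"
proof -
  interpret module "ring_on A" "module_on A" by (rule module_module_on[OF assms(1)])
  have "- x \<oplus>\<^bsub>module_on A\<^esub> x = \<zero>\<^bsub>module_on A\<^esub>" by simp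
  then show ?thesis
    using M.minus_equality[of "- x" x] assms closed_subringD(3)[OF assms] by simp
qed

lemma a_minus_module_on:
  "closed_subring A \<Longrightarrow> x \<in> A \<Longrightarrow> y \<in> A \<Longrightarrow> x \<ominus>\<^bsub>module_on A\<^esub> y = x - y"
  by (simp add: a_minus_def a_inv_module_on)

lemma submodule_module_on_iff:
  assumes "closed_subring A"
  shows "submodule N (ring_on A) (module_on A) \<longleftrightarrow>
    N \<subseteq> A \<and> 0 \<in> N \<and> (\<forall>x\<in>N. \<forall>y\<in>N. x + y \<in> N) \<and> (\<forall>a\<in>A. \<forall>x\<in>N. a * x \<in> N)"
    (is "_ \<longleftrightarrow> ?R")
proof -
  interpret module "ring_on A" "module_on A" by (rule module_module_on[OF assms])
  show ?thesis
  proof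
    assume N: "submodule N (ring_on A) (module_on A)"
    have "0 \<in> N" using subgroup.one_closed[OF submodule.axioms(1)[OF N]] by simp
    then show ?R using submoduleE[OF N] by auto
  next
    assume R: ?R
    have "- x \<in> N" if "x \<in> N" for x
    proof -
      have "- 1 \<in> A" using closed_subringD[OF assms] by blast
      then have "- 1 * x \<in> N" using R that by blast
      then show ?thesis by simp
    qed
    then show "submodule N (ring_on A) (module_on A)"
      using R by (intro submoduleI) (auto simp: a_inv_module_on[OF assms] subset_iff)
  qed
qed

lemma adic_power_eqI:
  fixes A :: "'a::comm_ring_1 set"
  assumes A: "closed_subring A"
    and 0: "I 0 = A" and sub: "\<And>n. submodule (I n) (ring_on A) (module_on A)"
    and mult: "\<And>n x. x \<in> I n \<Longrightarrow> u * x \<in> I (Suc n)" "\<And>n x. x \<in> I n \<Longrightarrow> v * x \<in> I (Suc n)"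
    and decomp: "\<And>n x. x \<in> I (Suc n) \<Longrightarrow> \<exists>y\<in>I n. \<exists>z\<in>I n. x = u * y + v * z"
  shows "adic_power (ring_on A) (module_on A) {u, v} n = I n"
proof (induction n)
  case (Suc n)
  let ?X = "{a * x | a x. a \<in> {u, v} \<and> x \<in> I n}"
  have "module_span (ring_on A) (module_on A) ?X = I (Suc n)"
  proof
    show "module_span (ring_on A) (module_on A) ?X \<subseteq> I (Suc n)"
      unfolding module_span_def using sub mult by (intro Inter_lower) auto
    show "I (Suc n) \<subseteq> module_span (ring_on A) (module_on A) ?X"
      unfolding module_span_def
    proof (intro Inter_greatest subsetI)
      fix N x assume N: "N \<in> {N. submodule N (ring_on A) (module_on A) \<and> ?X \<subseteq> N}" and "x \<in> I (Suc n)"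
      then obtain y z where yz: "y \<in> I n" "z \<in> I n" "x = u * y + v * z" using decomp by blast
      then have "u * y \<in> N" "v * z \<in> N" using N by auto
      then show "x \<in> N" using N yz(3) unfolding submodule_module_on_iff[OF A] by blast
    qed
  qed
  then show ?case using Suc by simp
qed (simp add: 0)

lemma adic_power_principal:
  fixes A :: "'a::idom set"
  assumes A: "closed_subring A" and "u \<in> A" and sat: "\<And>x. u * x \<in> A \<Longrightarrow> x \<in> A"
  shows "adic_power (ring_on A) (module_on A) {u} n = {x \<in> A. u ^ n dvd x}"
proof -
  \<comment> \<open>The two-generator criterion is applied with the generator repeated.\<close>
  have "adic_power (ring_on A) (module_on A) {u, u} n = {x \<in> A. u ^ n dvd x}"
  proof (rule adic_power_eqI[OF A])
    show "submodule {x \<in> A. u ^ n dvd x} (ring_on A) (module_on A)" for n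
      by (auto simp: submodule_module_on_iff[OF A] closed_subringD[OF A] dvd_add)
    show "\<exists>y\<in>{x \<in> A. u ^ n dvd x}. \<exists>z\<in>{x \<in> A. u ^ n dvd x}. x = u * y + u * z"
      if "x \<in> {x \<in> A. u ^ Suc n dvd x}" for n x
    proof -
      have "u ^ Suc n dvd x" using that by blast
      then obtain y where "x = u ^ Suc n * y" by (rule dvdE)
      then have y: "x = u * (u ^ n * y)" by (simp only: power_Suc mult.assoc)
      then have "u ^ n * y \<in> A" using that sat by blast
      moreover have "x = u * (u ^ n * y) + u * 0" using y by simp
      ultimately show ?thesis using closed_subringD(2)[OF A]
        by (intro bexI[of _ "u ^ n * y"] bexI[of _ 0]) simp_all
    qed
    show mult: "u * x \<in> {x \<in> A. u ^ Suc n dvd x}" if "x \<in> {x \<in> A. u ^ n dvd x}" for n x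
      using that closed_subringD(5)[OF A \<open>u \<in> A\<close>] by (simp add: mult_dvd_mono)
    then show "u * x \<in> {x \<in> A. u ^ Suc n dvd x}" if "x \<in> {x \<in> A. u ^ n dvd x}" for n x
      using that .
  qed simp
  then show ?thesis by simp
qed

section \<open>Expansion in powers of q - 1\<close>

abbreviation tt :: "'p::prime_card padic_int fps fps" where
  "tt \<equiv> fps_const fps_X"

text \<open>The section of \<open>at_q1\<close> given by the constants \<open>Z_p\<close> in R.
  Together with \<open>tshift\<close>, the quotient by q - 1 of what remains, it makes reduction
  modulo q - 1 explicit.\<close>

definition emb :: "'p::prime_card padic_int fps \<Rightarrow> 'p padic_int fps fps" where
  "emb y = Abs_fps (\<lambda>i. fps_const (y $ i))"

definition tshift :: "'p::prime_card padic_int fps fps \<Rightarrow> 'p padic_int fps fps" where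
  "tshift x = Abs_fps (\<lambda>i. fps_shift 1 (x $ i))"

lemma emb_nth [simp]: "emb y $ i = fps_const (y $ i)" and tshift_nth [simp]: "tshift x $ i = fps_shift 1 (x $ i)"
  and at_q1_nth [simp]: "at_q1 x $ i = x $ i $ 0"
  by (simp_all add: emb_def tshift_def at_q1_def coeff_map_def)

lemma t_expansion: "x = emb (at_q1 x) + tt * tshift x"
proof (intro fps_ext)
  fix i k
  show "x $ i $ k = (emb (at_q1 x) + tt * tshift x) $ i $ k"
    by (cases k) simp_all
qed

lemma at_q1_mult: "at_q1 (x * y) = at_q1 x * at_q1 y"
  by (rule fps_ext) (simp add: fps_mult_nth fps_sum_nth)

lemma at_q1_simps [simp]:
  "at_q1 (x + y) = at_q1 x + at_q1 y" "at_q1 (x - y) = at_q1 x - at_q1 y" "at_q1 0 = 0" "at_q1 1 = 1"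
  "at_q1 (- x) = - at_q1 x" "at_q1 (emb w) = w" "at_q1 tt = 0"
  by (rule fps_ext, simp)+

lemma at_q1_power: "at_q1 (x ^ n) = at_q1 x ^ n"
  by (induction n) (simp_all add: at_q1_mult)

lemma emb_mult: "emb (x * y) = emb x * emb y"
proof (rule fps_ext)
  fix n
  have "fps_const (\<Sum>i = 0..n. x $ i * y $ (n - i)) = (\<Sum>i = 0..n. fps_const (x $ i * y $ (n - i)))"
    by (rule fps_ext) (simp add: fps_sum_nth)
  then show "emb (x * y) $ n = (emb x * emb y) $ n" by (simp add: fps_mult_nth)
qed

lemma emb_simps [simp]: "emb 0 = 0" "emb 1 = 1"
  by (rule fps_ext, simp)+

lemma emb_diff: "emb (x - y) = emb x - emb y"
  by (rule fps_ext) simp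

lemma emb_power: "emb (x ^ n) = emb x ^ n"
  by (induction n) (simp_all add: emb_mult)

lemma tshift_diff: "tshift (x - y) = tshift x - tshift y"
  by (rule fps_ext) (simp add: fps_shift_diff)

lemma tt_neq_0: "tt \<noteq> 0"
  by (simp add: fps_const_eq_0_iff)

text \<open>Linearity over series without q is what makes \<open>tshift\<close> compatible with the
  denominators \<open>h^k\<close>, since h has integer coefficients.\<close>

lemma tshift_mult_emb: "tshift (x * emb y) = tshift x * emb y"
proof -
  have "emb (at_q1 (x * emb y)) + tt * tshift (x * emb y) = (emb (at_q1 x) + tt * tshift x) * emb y"
    using t_expansion by metis
  then have "tt * tshift (x * emb y) = tt * (tshift x * emb y)"
    by (simp add: at_q1_mult emb_mult algebra_simps)
  then show ?thesis using tt_neq_0 by (metis mult_left_cancel)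
qed

lemma of_nat_dvd_fps_iff:
  "of_nat c dvd (x :: 'a::idom fps) \<longleftrightarrow> (\<forall>i. of_nat c dvd x $ i)"
proof
  assume "of_nat c dvd x"
  then obtain y where "x = fps_const (of_nat c) * y" by (auto simp: fps_of_nat elim: dvdE)
  then show "\<forall>i. of_nat c dvd x $ i" by simp
next
  assume "\<forall>i. of_nat c dvd x $ i"
  then obtain y where "\<And>i. x $ i = of_nat c * y i" unfolding dvd_def by metis
  then have "x = fps_const (of_nat c) * Abs_fps y" by (intro fps_ext) simp
  then show "of_nat c dvd x" by (simp add: fps_of_nat)
qed

lemma pp_pow_dvd_fps_iff:
  "(of_nat CARD('p) ^ n dvd (x :: 'p::prime_card padic_int fps)) \<longleftrightarrow> (\<forall>i. pp ^ n dvd x $ i)"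
  using of_nat_dvd_fps_iff[of "CARD('p) ^ n" x] by simp

lemma fil_emb: "of_nat CARD('p) ^ n dvd y \<Longrightarrow> fil n (emb (y :: 'p::prime_card padic_int fps))"
  unfolding fil_def fil_R_def pp_pow_dvd_fps_iff
  by (auto intro: dvd_trans[OF le_imp_power_dvd])

lemma fil_at_q1: "fil n x \<Longrightarrow> of_nat CARD('p) ^ n dvd at_q1 (x :: 'p::prime_card padic_int fps fps)"
  unfolding fil_def fil_R_def pp_pow_dvd_fps_iff by (metis at_q1_nth diff_zero)

lemma fil_tshift: "fil (Suc n) x \<Longrightarrow> fil n (tshift x)"
  unfolding fil_def fil_R_def by (metis (no_types, lifting) tshift_nth fps_shift_nth diff_Suc_Suc Suc_eq_plus1)

lemma fil_tt: "fil (Suc 0) tt"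
  by (simp add: fil_R_fps_X)

lemma fil_pp: "fil (Suc 0) (of_nat CARD('p) :: 'p::prime_card padic_int fps fps)"
  using fil_R_pp_pow[of 1, where 'a='p] by (simp add: fps_of_nat[symmetric] del: fps_const_eq_1_iff)

lemma fil_dvd_pp:
  "of_nat CARD('p) dvd x \<Longrightarrow> fil (Suc 0) (x :: 'p::prime_card padic_int fps fps)"
  using fil_mult_right[OF fil_pp] by (auto elim: dvdE)

text \<open>Each x in step n + 1 splits into p times an embedded series and q - 1 times
  \<open>tshift x\<close>. The hypotheses keep both cofactors in A, so the intrinsic powers of J in
  A are those induced from \<open>R[[\<lambda>]]\<close>.\<close>

lemma adic_power_fil:
  fixes A :: "'p::prime_card padic_int fps fps set"
  assumes A: "closed_subring A" and tt: "tt \<in> A"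
    and shift: "\<And>x. x \<in> A \<Longrightarrow> tshift x \<in> A"
    and sat: "\<And>x w. x \<in> A \<Longrightarrow> at_q1 x = of_nat CARD('p) * w \<Longrightarrow> emb w \<in> A"
  shows "adic_power (ring_on A) (module_on A) {of_nat CARD('p), tt} n = {x \<in> A. fil n x}"
proof (rule adic_power_eqI[OF A])
  show "{x \<in> A. fil 0 x} = A" by simp
  show "submodule {x \<in> A. fil n x} (ring_on A) (module_on A)" for n
    by (auto simp: submodule_module_on_iff[OF A] closed_subringD[OF A] fil_add fil_mult_left)
  show "of_nat CARD('p) * x \<in> {x \<in> A. fil (Suc n) x}" if "x \<in> {x \<in> A. fil n x}" for n x
    using fil_mult[OF fil_pp, of n x] that closed_subringD[OF A] closed_subring_of_nat[OF A] by auto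
  show "tt * x \<in> {x \<in> A. fil (Suc n) x}" if "x \<in> {x \<in> A. fil n x}" for n x
    using fil_mult[OF fil_tt, of n x] that closed_subringD[OF A] tt by auto
  show "\<exists>y\<in>{x \<in> A. fil n x}. \<exists>z\<in>{x \<in> A. fil n x}. x = of_nat CARD('p) * y + tt * z"
    if x: "x \<in> {x \<in> A. fil (Suc n) x}" for n x
  proof -
    have "of_nat CARD('p) ^ Suc n dvd at_q1 x" using x by (intro fil_at_q1) simp
    then obtain w where w: "at_q1 x = of_nat CARD('p) * (of_nat CARD('p) ^ n * w)"
      by (auto elim: dvdE simp: mult.assoc)
    have "fil n (emb (of_nat CARD('p) ^ n * w))" by (rule fil_emb) simp
    moreover have "emb (of_nat CARD('p) ^ n * w) \<in> A" using sat[OF _ w] x by simp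
    moreover have "x = of_nat CARD('p) * emb (of_nat CARD('p) ^ n * w) + tt * tshift x"
    proof -
      have "emb (of_nat CARD('p)) = (of_nat CARD('p) :: 'p padic_int fps fps)"
        by (rule fps_ext) (simp add: fps_of_nat[symmetric])
      then show ?thesis using t_expansion[of x] unfolding w emb_mult[of "of_nat CARD('p)"] by simp
    qed
    ultimately show ?thesis using x shift fil_tshift by blast
  qed
qed

section \<open>Localized polynomial rings\<close>

definition poly_like :: "'a::zero fps \<Rightarrow> bool" where
  "poly_like x \<longleftrightarrow> (\<exists>d. \<forall>i>d. x $ i = 0)"

lemma poly_like_iff: "poly_like x \<longleftrightarrow> (\<exists>P. x = fps_of_poly P)"
proof
  assume "poly_like x"
  then obtain d where d: "\<And>i. i > d \<Longrightarrow> x $ i = 0" by (auto simp: poly_like_def)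
  have "x = fps_of_poly (Poly (map (fps_nth x) [0..<Suc d]))"
    by (rule fps_ext) (auto simp: nth_default_def d less_Suc_eq_le simp del: upt_Suc)
  then show "\<exists>P. x = fps_of_poly P" ..
next
  assume "\<exists>P. x = fps_of_poly P"
  then obtain P where "x = fps_of_poly P" ..
  then show "poly_like x" by (auto simp: poly_like_def coeff_eq_0 intro!: exI[of _ "degree P"])
qed

context
  fixes h :: "'a::idom poly"
  assumes h0: "poly.coeff h 0 = 1"
begin

lemma poly_localization_iff:
  "x \<in> poly_localization h \<longleftrightarrow> (\<exists>k. poly_like (x * fps_of_poly h ^ k))"
proof
  assume "x \<in> poly_localization h"
  then obtain P k where x: "x = quot (fps_of_poly P) (fps_of_poly h ^ k)"
    by (auto simp: poly_localization_def)
  have "fps_of_poly h ^ k dvd 1"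
    by (simp add: fps_dvd_one_iff fps_power_zeroth h0)
  then have "fps_of_poly h ^ k dvd fps_of_poly P" "fps_of_poly h ^ k \<noteq> 0"
    using h0 by (auto intro: dvd_trans)
  then have "x * fps_of_poly h ^ k = fps_of_poly P" unfolding x by (rule quot_mult)
  then show "\<exists>k. poly_like (x * fps_of_poly h ^ k)" by (auto simp: poly_like_iff)
next
  assume "\<exists>k. poly_like (x * fps_of_poly h ^ k)"
  then obtain k P where "x * fps_of_poly h ^ k = fps_of_poly P" by (auto simp: poly_like_iff)
  moreover have "fps_of_poly h ^ k \<noteq> 0" using h0 by auto
  ultimately have "quot (fps_of_poly P) (fps_of_poly h ^ k) = x" by (rule quot_eqI)
  then show "x \<in> poly_localization h" by (auto simp: poly_localization_def)
qed

lemma poly_like_localization: "poly_like x \<Longrightarrow> x \<in> poly_localization h"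
  unfolding poly_localization_iff by (intro exI[of _ 0]) simp

lemma closed_subring_localization: "closed_subring (poly_localization h)"
  unfolding closed_subring_def
proof (intro conjI ballI)
  have "poly_like (1 :: 'a fps)" by (auto simp: poly_like_def)
  then show "1 \<in> poly_localization h" by (rule poly_like_localization)
  show "- x \<in> poly_localization h" if "x \<in> poly_localization h" for x
    using that by (auto simp: poly_localization_iff poly_like_def)
  fix x y assume "x \<in> poly_localization h" "y \<in> poly_localization h"
  then obtain k l P Q where kl: "x * fps_of_poly h ^ k = fps_of_poly P" "y * fps_of_poly h ^ l = fps_of_poly Q"
    by (auto simp: poly_localization_iff poly_like_iff)
  have "(x + y) * fps_of_poly h ^ (k + l)
      = (x * fps_of_poly h ^ k) * fps_of_poly h ^ l + (y * fps_of_poly h ^ l) * fps_of_poly h ^ k"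
    by (simp add: power_add algebra_simps)
  also have "\<dots> = fps_of_poly (P * h ^ l + Q * h ^ k)"
    by (simp add: kl fps_of_poly_add fps_of_poly_mult fps_of_poly_power)
  finally show "x + y \<in> poly_localization h" by (auto simp: poly_localization_iff poly_like_iff)
  have "(x * y) * fps_of_poly h ^ (k + l) = (x * fps_of_poly h ^ k) * (y * fps_of_poly h ^ l)"
    by (simp add: power_add algebra_simps)
  also have "\<dots> = fps_of_poly (P * Q)" by (simp add: kl fps_of_poly_mult)
  finally show "x * y \<in> poly_localization h" by (auto simp: poly_localization_iff poly_like_iff)
qed

lemma inverse_localization: "x * fps_of_poly h = 1 \<Longrightarrow> x \<in> poly_localization h"
  unfolding poly_localization_iff by (intro exI[of _ 1]) (auto simp: poly_like_def)

lemma of_nat_mult_localization: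
  assumes "of_nat c * x \<in> poly_localization h" "(of_nat c :: 'a) \<noteq> 0"
  shows "x \<in> poly_localization h"
proof -
  obtain k where "poly_like (fps_const (of_nat c) * (x * fps_of_poly h ^ k))"
    using assms(1) by (auto simp: poly_localization_iff fps_of_nat mult.assoc)
  then show ?thesis using assms(2) by (auto simp: poly_localization_iff poly_like_def)
qed

end

section \<open>The rings S' and B'\<close>

lemma h_poly_coeff_0: "poly.coeff (h_poly n :: 'a::comm_ring_1 poly) 0 = 1"
  using h_poly_nth[of n 0, where 'a='a] by simp

lemmas localization = poly_localization_iff[OF h_poly_coeff_0]
  and localization_subring = closed_subring_localization[OF h_poly_coeff_0]
  and localization_poly_like = poly_like_localization[OF h_poly_coeff_0]

abbreviation hh :: "'p::prime_card padic_int fps fps" where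
  "hh \<equiv> fps_of_poly (h_poly CARD('p))"

abbreviation hh1 :: "'p::prime_card padic_int fps" where
  "hh1 \<equiv> fps_of_poly (h_poly CARD('p))"

lemma emb_hh1: "emb hh1 = (hh :: 'p::prime_card padic_int fps fps)"
  by (rule fps_ext) (simp only: emb_nth h_poly_nth fps_of_nat)

lemma at_q1_hh: "at_q1 hh = (hh1 :: 'p::prime_card padic_int fps)"
  by (simp flip: emb_hh1)

abbreviation A1 :: "'p::prime_card padic_int fps set" where
  "A1 \<equiv> poly_localization (h_poly CARD('p))"

abbreviation A2 :: "'p::prime_card padic_int fps fps set" where
  "A2 \<equiv> poly_localization (h_poly CARD('p))"

lemma at_q1_A2: "x \<in> A2 \<Longrightarrow> at_q1 x \<in> A1"
proof -
  assume "x \<in> A2"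
  then obtain k d where "\<forall>i>d. (x * hh ^ k) $ i = 0" by (auto simp: localization poly_like_def)
  then have "\<forall>i>d. at_q1 (x * hh ^ k) $ i = 0" by simp
  then show ?thesis by (auto simp: localization poly_like_def at_q1_mult at_q1_power at_q1_hh)
qed

lemma emb_A1: "x \<in> A1 \<Longrightarrow> emb x \<in> A2"
proof -
  assume "x \<in> A1"
  then obtain k d where "\<forall>i>d. (x * hh1 ^ k) $ i = 0" by (auto simp: localization poly_like_def)
  then have "\<forall>i>d. emb (x * hh1 ^ k) $ i = 0" by simp
  then show ?thesis by (auto simp: localization poly_like_def emb_mult emb_power emb_hh1)
qed

lemma tshift_A2: "x \<in> A2 \<Longrightarrow> tshift x \<in> A2"
proof -
  assume "x \<in> A2"
  then obtain k d where "\<forall>i>d. (x * hh ^ k) $ i = 0" by (auto simp: localization poly_like_def)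
  then have "\<forall>i>d. tshift (x * hh ^ k) $ i = 0" by simp
  moreover have "tshift (x * hh ^ k) = tshift x * hh ^ k"
    using tshift_mult_emb[of x "hh1 ^ k"] by (simp add: emb_power emb_hh1)
  ultimately have "\<forall>i>d. (tshift x * hh ^ k) $ i = 0" by simp
  then show ?thesis by (auto simp: localization poly_like_def)
qed

lemma const_A2: "fps_const c \<in> A2"
  by (rule localization_poly_like) (auto simp: poly_like_def intro!: exI[of _ 0])

lemma A1_saturated: "of_nat CARD('p) * w \<in> (A1 :: 'p::prime_card padic_int fps set) \<Longrightarrow> w \<in> A1"
  by (rule of_nat_mult_localization[OF h_poly_coeff_0]) auto

lemma adic_power_A2:
  "adic_power (ring_on A2) (module_on A2) {of_nat CARD('p), tt} n
    = {x \<in> A2. fil n (x :: 'p::prime_card padic_int fps fps)}"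
  by (rule adic_power_fil[OF localization_subring const_A2 tshift_A2])
    (metis at_q1_A2 A1_saturated emb_A1)+

lemma adic_power_UNIV:
  "adic_power (ring_on UNIV) (module_on UNIV) {of_nat CARD('p), tt} n
    = {x :: 'p::prime_card padic_int fps fps. fil n x}"
  by (subst adic_power_fil[OF closed_subring_UNIV]) auto

lemma adic_power_A1:
  "adic_power (ring_on A1) (module_on A1) {of_nat CARD('p)} n
    = {x \<in> A1. of_nat CARD('p) ^ n dvd (x :: 'p::prime_card padic_int fps)}"
  by (rule adic_power_principal[OF localization_subring])
    (auto intro: A1_saturated closed_subring_of_nat localization_subring)

lemma adic_power_UNIV1:
  "adic_power (ring_on UNIV) (module_on UNIV) {u} n = {x :: 'a::idom. u ^ n dvd x}"
  by (subst adic_power_principal[OF closed_subring_UNIV]) auto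

text \<open>Because the adic powers of \<open>A2\<close> are induced from the ambient ring, any
  approximating sequence in \<open>A2\<close> is Cauchy for the intrinsic topology as well.\<close>

lemma S'_iff: "x \<in> S' \<longleftrightarrow> (\<forall>n. \<exists>a\<in>A2. fil n (x - a))"
  for x :: "'p::prime_card padic_int fps fps"
proof
  assume "x \<in> S'"
  then show "\<forall>n. \<exists>a\<in>A2. fil n (x - a)"
    unfolding S'_def completion_in_def adic_power_A2 adic_power_UNIV by blast
next
  assume "\<forall>n. \<exists>a\<in>A2. fil n (x - a)"
  then obtain y where y: "\<And>n. y n \<in> A2" "\<And>n. fil n (x - y n)" by metis
  have "fil n (y (Suc n) - y n)" for n
    using fil_diff[OF y(2)[of n] fil_mono[OF y(2)[of "Suc n"]]] by simp
  then show "x \<in> S'"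
    unfolding S'_def completion_in_def adic_power_A2 adic_power_UNIV
    using y closed_subringD(6)[OF localization_subring] by blast
qed

lemma B'_iff: "x \<in> B' \<longleftrightarrow> (\<forall>n. \<exists>a\<in>A1. of_nat CARD('p) ^ n dvd x - a)"
  for x :: "'p::prime_card padic_int fps"
proof
  assume "x \<in> B'"
  then show "\<forall>n. \<exists>a\<in>A1. of_nat CARD('p) ^ n dvd x - a"
    unfolding B'_def completion_in_def adic_power_A1 adic_power_UNIV1 by blast
next
  assume "\<forall>n. \<exists>a\<in>A1. of_nat CARD('p) ^ n dvd x - a"
  then obtain y where y: "\<And>n. y n \<in> A1" "\<And>n. of_nat CARD('p) ^ n dvd x - y n" by metis
  have "of_nat CARD('p) ^ n dvd y (Suc n) - y n" for n
  proof -
    have "of_nat CARD('p) ^ n dvd (x - y n) - (x - y (Suc n))"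
      by (rule dvd_diff[OF y(2) dvd_trans[OF le_imp_power_dvd y(2)]]) simp
    then show ?thesis by simp
  qed
  then show "x \<in> B'"
    unfolding B'_def completion_in_def adic_power_A1 adic_power_UNIV1
    using y closed_subringD(6)[OF localization_subring] by blast
qed

lemma A2_subset_S': "x \<in> A2 \<Longrightarrow> x \<in> S'"
  unfolding S'_iff by (auto intro!: bexI[of _ x])

lemma closed_subring_S': "closed_subring (S' :: 'p::prime_card padic_int fps fps set)"
  unfolding closed_subring_def
proof (intro conjI ballI)
  note D = closed_subringD[OF localization_subring[where 'a="'p padic_int fps"]]
  show "(1 :: 'p padic_int fps fps) \<in> S'" by (intro A2_subset_S' D)
  show "- x \<in> S'" if "x \<in> S'" for x :: "'p padic_int fps fps"
    unfolding S'_iff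
  proof
    fix n
    obtain a where "a \<in> A2" "fil n (x - a)" using \<open>x \<in> S'\<close> by (auto simp: S'_iff)
    then show "\<exists>a\<in>A2. fil n (- x - a)"
      using fil_minus_iff[of n "x - a"] by (intro bexI[of _ "- a"]) (auto intro: D)
  qed
  fix x y :: "'p padic_int fps fps" assume xy: "x \<in> S'" "y \<in> S'"
  have approx: "\<exists>a\<in>A2. \<exists>b\<in>A2. fil n (x - a) \<and> fil n (y - b)" for n
    using xy by (auto simp: S'_iff)
  show "x + y \<in> S'"
    unfolding S'_iff
  proof
    fix n
    obtain a b where "a \<in> A2" "b \<in> A2" "fil n (x - a)" "fil n (y - b)" using approx by blast
    then show "\<exists>a\<in>A2. fil n (x + y - a)"
      using fil_add[of n "x - a" "y - b"]
      by (intro bexI[of _ "a + b"]) (auto intro: D simp: algebra_simps)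
  qed
  show "x * y \<in> S'"
    unfolding S'_iff
  proof
    fix n
    obtain a b where "a \<in> A2" "b \<in> A2" "fil n (x - a)" "fil n (y - b)" using approx by blast
    then show "\<exists>a\<in>A2. fil n (x * y - a)"
      by (intro bexI[of _ "a * b"] fil_cong_mult) (auto intro: D)
  qed
qed

lemmas S'_ring = closed_subringD[OF closed_subring_S'] closed_subring_power[OF closed_subring_S']
  closed_subring_sum[OF closed_subring_S']

lemma S'_closed:
  assumes "\<And>n. \<exists>a\<in>S'. fil n (x - a)"
  shows "x \<in> S'"
  unfolding S'_iff
proof
  fix n
  obtain a where "a \<in> S'" "fil n (x - a)" using assms by blast
  moreover obtain b where "b \<in> A2" "fil n (a - b)" using \<open>a \<in> S'\<close> unfolding S'_iff by blast
  ultimately show "\<exists>a\<in>A2. fil n (x - a)" using fil_cong_trans by blast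
qed

lemma const_S': "fps_const c \<in> S'"
  by (rule A2_subset_S'[OF const_A2])

lemma X_S': "fps_X \<in> S'"
  by (intro A2_subset_S' localization_poly_like) (auto simp: poly_like_def intro!: exI[of _ 1])

lemma poly_like_S': "poly_like x \<Longrightarrow> x \<in> S'"
  by (intro A2_subset_S' localization_poly_like)

lemma at_q1_S': "x \<in> S' \<Longrightarrow> at_q1 x \<in> B'"
  unfolding S'_iff B'_iff by (metis at_q1_A2 at_q1_simps(2) fil_at_q1)

lemma emb_B': "x \<in> B' \<Longrightarrow> emb x \<in> S'"
  unfolding S'_iff B'_iff by (metis emb_A1 emb_diff fil_emb)

lemma tshift_S': "x \<in> S' \<Longrightarrow> tshift x \<in> S'"
  unfolding S'_iff by (metis tshift_A2 tshift_diff fil_tshift)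

lemma at_q1_image_S': "at_q1 ` S' = B'"
  using at_q1_S' emb_B' at_q1_simps(6) by (metis (no_types, lifting) image_subset_iff subsetI
      subset_antisym image_eqI)

lemma closed_subring_B': "closed_subring (B' :: 'p::prime_card padic_int fps set)"
  unfolding closed_subring_def at_q1_image_S'[symmetric]
proof (intro conjI ballI)
  show "1 \<in> at_q1 ` (S' :: 'p padic_int fps fps set)"
    using closed_subringD(1)[OF closed_subring_S'] by (intro image_eqI[of _ _ 1]) simp_all
  show "- x \<in> at_q1 ` S'" if "x \<in> at_q1 ` S'" for x :: "'p padic_int fps"
  proof -
    obtain a where "a \<in> S'" "x = at_q1 a" using \<open>x \<in> at_q1 ` S'\<close> by blast
    then show ?thesis
      using closed_subringD(3)[OF closed_subring_S'] by (intro image_eqI[of _ _ "- a"]) simp_all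
  qed
  fix x y :: "'p padic_int fps" assume "x \<in> at_q1 ` S'" "y \<in> at_q1 ` S'"
  then obtain a b where ab: "a \<in> S'" "b \<in> S'" "x = at_q1 a" "y = at_q1 b" by blast
  show "x + y \<in> at_q1 ` S'"
    using ab closed_subringD(4)[OF closed_subring_S', of a b] by (intro image_eqI[of _ _ "a + b"]) simp_all
  show "x * y \<in> at_q1 ` S'"
    using ab closed_subringD(5)[OF closed_subring_S', of a b] by (intro image_eqI[of _ _ "a * b"]) (simp_all add: at_q1_mult)
qed

lemma B'_saturated: "of_nat CARD('p) * w \<in> B' \<Longrightarrow> w \<in> (B' :: 'p::prime_card padic_int fps set)"
  unfolding B'_iff
proof
  fix n assume "\<forall>n. \<exists>a\<in>A1. of_nat CARD('p) ^ n dvd of_nat CARD('p) * w - a"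
  then obtain a where a: "a \<in> A1" "of_nat CARD('p) ^ Suc n dvd of_nat CARD('p) * w - a" by blast
  from a(2) have "of_nat CARD('p) dvd of_nat CARD('p) * w - a"
    unfolding power_Suc by (rule dvd_mult_left)
  then have "of_nat CARD('p) dvd of_nat CARD('p) * w - (of_nat CARD('p) * w - a)"
    by (rule dvd_diff[OF dvd_triv_left])
  then have "of_nat CARD('p) dvd a" by simp
  then obtain b where b: "a = of_nat CARD('p) * b" by (rule dvdE)
  have "b \<in> A1" using a b A1_saturated by blast
  moreover have "of_nat CARD('p) * of_nat CARD('p) ^ n dvd of_nat CARD('p) * (w - b)"
    using a b by (simp add: right_diff_distrib)
  then have "of_nat CARD('p) ^ n dvd w - b" by (subst (asm) dvd_mult_cancel_left) auto
  ultimately show "\<exists>a\<in>A1. of_nat CARD('p) ^ n dvd w - a" by blast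
qed

lemma adic_power_S':
  "adic_power (ring_on S') (module_on S') {of_nat CARD('p), tt} n
    = {x \<in> S'. fil n (x :: 'p::prime_card padic_int fps fps)}"
  by (rule adic_power_fil[OF closed_subring_S' const_S' tshift_S'])
    (metis at_q1_S' B'_saturated emb_B')+

section \<open>Units of S' and endomorphisms that preserve S'\<close>

definition S'_unit :: "'p::prime_card padic_int fps fps \<Rightarrow> bool" where
  "S'_unit x \<longleftrightarrow> x \<in> S' \<and> (\<exists>y\<in>S'. x * y = 1)"

lemma S'_unitE: assumes "S'_unit x" obtains y where "x \<in> S'" "y \<in> S'" "x * y = 1"
  using assms by (auto simp: S'_unit_def)

lemma S'_unit_1: "S'_unit 1"
  using S'_ring(1) by (auto simp: S'_unit_def)

lemma S'_unit_mult: assumes "S'_unit x" "S'_unit y" shows "S'_unit (x * y)"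
proof -
  obtain x' y' where "x \<in> S'" "x' \<in> S'" "x * x' = 1" "y \<in> S'" "y' \<in> S'" "y * y' = 1"
    using assms by (meson S'_unitE)
  moreover have "(x * y) * (x' * y') = (x * x') * (y * y')" by (simp only: mult_ac)
  ultimately have "(x * y) * (x' * y') = 1" by simp
  then show ?thesis using \<open>x \<in> S'\<close> \<open>y \<in> S'\<close> \<open>x' \<in> S'\<close> \<open>y' \<in> S'\<close> S'_ring(5) by (auto simp: S'_unit_def)
qed

lemma S'_unit_power: "S'_unit x \<Longrightarrow> S'_unit (x ^ n)"
  by (induction n) (simp_all add: S'_unit_1 S'_unit_mult)

lemma S'_unit_hh: "S'_unit (hh :: 'p::prime_card padic_int fps fps)"
proof -
  have "(hh :: 'p padic_int fps fps) dvd 1" by (simp add: fps_dvd_one_iff h_poly_coeff_0)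
  then obtain y where y: "(1 :: 'p padic_int fps fps) = hh * y" by (rule dvdE)
  have "y \<in> A2" by (rule inverse_localization[OF h_poly_coeff_0]) (simp add: y mult.commute)
  moreover have "poly_like (hh :: 'p padic_int fps fps)" by (auto simp: poly_like_iff)
  ultimately show ?thesis using y poly_like_S' A2_subset_S' by (auto simp: S'_unit_def)
qed

text \<open>The inverse is \<open>e\<inverse> \<Sum> z\<^sup>i\<close>, where \<open>z = 1 - x e\<inverse>\<close>.\<close>

lemma S'_unit_cong:
  fixes x :: "'p::prime_card padic_int fps fps"
  assumes e: "S'_unit e" and x: "x \<in> S'" and fil: "fil (Suc 0) (x - e)"
  shows "S'_unit x"
proof -
  obtain e' where e': "e \<in> S'" "e' \<in> S'" "e * e' = 1" using e by (rule S'_unitE)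
  \<comment> \<open>A unit of \<open>R[[\<lambda>]]\<close> is recognised by its constant
    coefficient modulo p. This yields an inverse y, which remains to be located in S'.\<close>
  have "e $ 0 $ 0 * e' $ 0 $ 0 = 1"
    using arg_cong[OF e'(3), of "\<lambda>x. x $ 0 $ 0"] by simp
  then have "\<not> pp dvd e $ 0 $ 0" by (metis dvdI padic_unit_iff)
  moreover have "pp dvd x $ 0 $ 0 - e $ 0 $ 0"
    using fil by (simp add: fil_def fil_R_1_iff)
  ultimately have "\<not> pp dvd x $ 0 $ 0"
    using dvd_diff[of pp "x $ 0 $ 0" "x $ 0 $ 0 - e $ 0 $ 0"] by auto
  then have "x dvd 1" by (simp add: fps_dvd_one_iff padic_unit_iff)
  then obtain y where y: "1 = x * y" by (rule dvdE)
  define z where "z = 1 - x * e'"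
  have z: "z \<in> S'" unfolding z_def by (intro S'_ring x e')
  have "z = - ((x - e) * e')" using e'(3) by (simp add: z_def algebra_simps)
  then have "fil (Suc 0) z" using fil by (simp add: fil_mult_right)
  then have filz: "fil n (z ^ n)" for n
    by (induction n) (use fil_mult[of "Suc 0" z] in auto)
  have "y \<in> S'"
  proof (rule S'_closed)
    fix n
    have "(1 - z) * (\<Sum>i<n. z ^ i) = 1 - z ^ n" by (rule one_diff_power_eq[symmetric])
    then have "x * y - x * (e' * (\<Sum>i<n. z ^ i)) = x * y * z ^ n"
      using y by (simp add: z_def mult.assoc)
    then have "x * (y - e' * (\<Sum>i<n. z ^ i)) = x * (y * z ^ n)" by (simp add: right_diff_distrib mult.assoc)
    then have "y - e' * (\<Sum>i<n. z ^ i) = y * z ^ n" using y by (metis mult_cancel_left mult_zero_left zero_neq_one)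
    then have "fil n (y - e' * (\<Sum>i<n. z ^ i))" by (simp add: filz fil_mult_left)
    moreover have "e' * (\<Sum>i<n. z ^ i) \<in> S'" by (intro S'_ring e' z)
    ultimately show "\<exists>a\<in>S'. fil n (y - a)" by blast
  qed
  then show ?thesis using x y by (auto simp: S'_unit_def)
qed

text \<open>Elements of \<open>A2\<close> are polynomials divided by powers of h, so the images of
  constants, \<lambda> and h decide on \<open>A2\<close>; the filtration takes care of the
  limit.\<close>

lemma fil_hom_S':
  assumes hom: "fil_hom \<psi>" and const: "\<And>c. \<psi> (fps_const c) \<in> S'" and X: "\<psi> fps_X \<in> S'"
    and h: "S'_unit (\<psi> hh)" and x: "x \<in> S'"
  shows "\<psi> x \<in> S'"
proof (rule S'_closed)
  fix n
  obtain a where a: "a \<in> A2" "fil n (x - a)" using x by (auto simp: S'_iff)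
  then obtain k d where d: "\<And>i. i > d \<Longrightarrow> (a * hh ^ k) $ i = 0"
    by (auto simp: localization poly_like_def)
  have "a * hh ^ k = (\<Sum>i\<le>d. fps_const ((a * hh ^ k) $ i) * fps_X ^ i)"
  proof (rule fps_ext)
    fix n
    have "(\<Sum>i\<le>d. fps_const ((a * hh ^ k) $ i) * fps_X ^ i) $ n
        = (\<Sum>i\<le>d. if n = i then (a * hh ^ k) $ i else 0)"
      unfolding fps_sum_nth by (intro sum.cong) auto
    then show "(a * hh ^ k) $ n = (\<Sum>i\<le>d. fps_const ((a * hh ^ k) $ i) * fps_X ^ i) $ n"
      by (simp add: d)
  qed
  then have "\<psi> (a * hh ^ k) = (\<Sum>i\<le>d. \<psi> (fps_const ((a * hh ^ k) $ i)) * \<psi> fps_X ^ i)"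
    by (metis (mono_tags, lifting) fil_hom_sum[OF hom] fil_homD(3)[OF hom] fil_hom_power[OF hom] sum.cong)
  also have "\<dots> \<in> S'" by (intro S'_ring const X)
  finally have P: "\<psi> a * \<psi> hh ^ k \<in> S'" by (simp add: fil_homD[OF hom] fil_hom_power[OF hom])
  obtain g where g: "g \<in> S'" "\<psi> hh ^ k * g = 1" using S'_unit_power[OF h] by (rule S'_unitE)
  have "\<psi> a = (\<psi> a * \<psi> hh ^ k) * g" using g by (simp add: mult.assoc)
  then have "\<psi> a \<in> S'" using P g S'_ring(5) by metis
  moreover have "fil n (\<psi> x - \<psi> a)" using a by (simp add: fil_homD(4)[OF hom] flip: fil_homD(6)[OF hom])
  ultimately show "\<exists>a\<in>S'. fil n (\<psi> x - a)" by blast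
qed

lemma S'_unit_hom:
  assumes "fil_hom \<psi>" "\<And>x. x \<in> S' \<Longrightarrow> \<psi> x \<in> S'" "S'_unit x"
  shows "S'_unit (\<psi> x)"
  using assms unfolding S'_unit_def by (metis fil_homD(1,3))

section \<open>The endomorphisms of S'\<close>

lemma sigma_S': "x \<in> S' \<Longrightarrow> sigma l x \<in> S'"
proof (rule fil_hom_S'[OF fil_hom_sigma])
  have "sigma l (fps_const c) = fps_const (subst_q l c)" for c
    by (rule fps_ext) (simp add: sigma_nth)
  then show "sigma l (fps_const c) \<in> S'" for c by (simp add: const_S')
  have "sigma l fps_X = fps_X" by (rule fps_ext) (simp add: sigma_nth fps_X_def)
  then show "sigma l fps_X \<in> S'" by (simp add: X_S')
  have "sigma l hh = hh" unfolding emb_hh1[symmetric] by (rule fps_ext) (simp add: sigma_nth)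
  then show "S'_unit (sigma l hh)" by (simp add: S'_unit_hh)
qed

lemma fil_rho_id: "fil (Suc 0) (rho m x - x)"
  by (simp add: fil_def fil_R_1_iff rho_nth fps_power_zeroth)

text \<open>The image \<open>h(q^m \<lambda>)\<close> is again a polynomial and is congruent to h
  modulo q - 1, hence a unit of S'.\<close>

lemma rho_S': "x \<in> S' \<Longrightarrow> rho m x \<in> (S' :: 'p::prime_card padic_int fps fps set)"
proof (rule fil_hom_S'[OF fil_hom_rho])
  show "rho m (fps_const c) \<in> S'" for c by (simp add: rho_def const_S')
  have "rho m fps_X = fps_const (q_power m) * fps_X" by (simp add: rho_def)
  then show "rho m fps_X \<in> S'" by (simp add: S'_ring(5) const_S' X_S')
  have "poly_like (rho m hh)"
    unfolding poly_like_def
    by (intro exI[of _ "degree (h_poly CARD('p) :: 'p padic_int fps poly)"])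
      (simp add: rho_nth coeff_eq_0)
  then show "S'_unit (rho m hh)"
    by (rule S'_unit_cong[OF S'_unit_hh poly_like_S' fil_rho_id])
qed

section \<open>Frobenius as p-th power modulo p\<close>

lemma prime_dvd_power_add:
  fixes x y :: "'a::comm_ring_1"
  assumes "prime p"
  shows "of_nat p dvd (x + y) ^ p - (x ^ p + y ^ p)"
proof -
  have p: "p > 0" using assms by (rule prime_gt_0_nat)
  have "(x + y) ^ p = (\<Sum>k\<in>{0, p} \<union> {0<..<p}. of_nat (p choose k) * x ^ k * y ^ (p - k))"
    unfolding binomial_ring using p by (intro sum.cong) auto
  also have "\<dots> = (\<Sum>k\<in>{0, p}. of_nat (p choose k) * x ^ k * y ^ (p - k))
      + (\<Sum>k\<in>{0<..<p}. of_nat (p choose k) * x ^ k * y ^ (p - k))"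
    by (rule sum.union_disjoint) auto
  also have "(\<Sum>k\<in>{0, p}. of_nat (p choose k) * x ^ k * y ^ (p - k)) = x ^ p + y ^ p"
    using p by simp
  finally have "(x + y) ^ p - (x ^ p + y ^ p)
      = (\<Sum>k\<in>{0<..<p}. of_nat (p choose k) * x ^ k * y ^ (p - k))" by simp
  also have "of_nat p dvd \<dots>"
  proof (rule dvd_sum)
    fix k assume "k \<in> {0<..<p}"
    then have "p dvd (p choose k)" using assms by (intro dvd_choose_prime) auto
    then have "(of_nat p :: 'a) dvd of_nat (p choose k)" by (auto elim: dvdE)
    then show "of_nat p dvd of_nat (p choose k) * x ^ k * y ^ (p - k)" by (simp add: mult.assoc)
  qed
  finally show ?thesis .
qed

lemma prime_dvd_power_sum:
  fixes f :: "'b \<Rightarrow> 'a::comm_ring_1"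
  assumes "prime p" "finite I"
  shows "of_nat p dvd (\<Sum>i\<in>I. f i) ^ p - (\<Sum>i\<in>I. f i ^ p)"
  using assms(2)
proof induction
  case empty
  then show ?case using prime_gt_0_nat[OF assms(1)] by (simp add: power_0_left)
next
  case (insert i I)
  have eq: "(\<Sum>i\<in>insert i I. f i) ^ p - (\<Sum>i\<in>insert i I. f i ^ p)
      = ((f i + sum f I) ^ p - (f i ^ p + sum f I ^ p)) + (sum f I ^ p - (\<Sum>i\<in>I. f i ^ p))"
    using insert by simp
  show ?case unfolding eq by (intro dvd_add prime_dvd_power_add assms(1) insert.IH)
qed

lemma prime_dvd_power_of_nat:
  assumes "prime p" shows "(of_nat p :: 'a::comm_ring_1) dvd of_nat n ^ p - of_nat n"
  using prime_dvd_power_sum[OF assms, of "{..<n}" "\<lambda>_. 1 :: 'a"] by simp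

text \<open>As h has integer coefficients, \<phi> turns it into \<open>h(\<lambda>^p)\<close>, which
  modulo p is \<open>h^p\<close> by additivity of p-th powers and Fermat. This makes the image of h
  a unit.\<close>

lemma fil_frob_hh: "fil (Suc 0) (frob hh - (hh :: 'p::prime_card padic_int fps fps) ^ CARD('p))"
proof -
  let ?p = "CARD('p)" and ?m = "(CARD('p) - 1) div 2"
  define c where "c i = (?m choose i)\<^sup>2" for i
  have hh: "hh = (\<Sum>i\<le>?m. of_nat (c i) * fps_X ^ i :: 'p padic_int fps fps)"
  proof (rule fps_ext)
    fix n
    have "(of_nat (c i) * fps_X ^ i :: 'p padic_int fps fps) $ n = (if n = i then of_nat (c i) else 0)" for i
      by (simp add: fps_of_nat[symmetric])
    then show "hh $ n = (\<Sum>i\<le>?m. of_nat (c i) * fps_X ^ i :: 'p padic_int fps fps) $ n"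
      unfolding h_poly_nth c_def[symmetric] fps_sum_nth by (simp add: c_def binomial_eq_0)
  qed
  have of_nat: "frob (of_nat k) = of_nat k" for k
    by (induction k) (simp_all add: fil_homD[OF fil_hom_frob])
  have X: "frob fps_X = (fps_X ^ ?p :: 'p padic_int fps fps)"
  proof -
    have "sigma pp fps_X = (fps_X :: 'p padic_int fps fps)"
      by (rule fps_ext) (simp add: sigma_nth fps_X_def)
    then show ?thesis by (simp add: frob_eq)
  qed
  have "frob hh = (\<Sum>i\<le>?m. of_nat (c i) * (fps_X ^ i) ^ ?p :: 'p padic_int fps fps)"
    unfolding hh by (simp add: fil_hom_sum[OF fil_hom_frob] fil_homD[OF fil_hom_frob]
        fil_hom_power[OF fil_hom_frob] of_nat X mult.commute flip: power_mult)
  moreover have A: "of_nat ?p dvd hh ^ ?p - (\<Sum>i\<le>?m. (of_nat (c i) * fps_X ^ i) ^ ?p :: 'p padic_int fps fps)"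
    unfolding hh by (rule prime_dvd_power_sum[OF prime_card]) simp
  moreover have B: "of_nat ?p dvd (\<Sum>i\<le>?m. (of_nat (c i) * fps_X ^ i) ^ ?p :: 'p padic_int fps fps)
      - (\<Sum>i\<le>?m. of_nat (c i) * (fps_X ^ i) ^ ?p)"
    unfolding sum_subtractf[symmetric] power_mult_distrib left_diff_distrib[symmetric]
    by (intro dvd_sum dvd_mult2 prime_dvd_power_of_nat prime_card)
  ultimately have "of_nat ?p dvd hh ^ ?p - (frob hh :: 'p padic_int fps fps)"
    using dvd_add[OF A B] by simp
  then show ?thesis by (rule fil_cong_sym[OF fil_dvd_pp])
qed

lemma frob_S': "x \<in> S' \<Longrightarrow> frob x \<in> (S' :: 'p::prime_card padic_int fps fps set)"
proof (rule fil_hom_S'[OF fil_hom_frob])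
  have "sigma pp (fps_const c) = fps_const (subst_q pp c)" for c :: "'p padic_int fps"
    by (rule fps_ext) (simp add: sigma_nth)
  then show "frob (fps_const c) \<in> S'" for c :: "'p padic_int fps"
    by (simp add: frob_eq const_S')
  have "sigma pp fps_X = (fps_X :: 'p padic_int fps fps)"
    by (rule fps_ext) (simp add: sigma_nth fps_X_def)
  then show "frob fps_X \<in> (S' :: 'p padic_int fps fps set)"
    using closed_subring_power[OF closed_subring_S' X_S'] by (simp add: frob_eq)
  have "poly_like (frob hh :: 'p padic_int fps fps)"
    unfolding poly_like_def
  proof (intro exI[of _ "CARD('p) * degree (h_poly CARD('p) :: 'p padic_int fps poly)"] allI impI)
    fix i assume i: "i > CARD('p) * degree (h_poly CARD('p) :: 'p padic_int fps poly)"
    have "degree (h_poly CARD('p) :: 'p padic_int fps poly) < i div CARD('p)" if "CARD('p) dvd i"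
      using i that by (auto elim!: dvdE)
    then show "frob hh $ i = (0 :: 'p padic_int fps)" by (simp add: frob_nth coeff_eq_0)
  qed
  then show "S'_unit (frob hh :: 'p padic_int fps fps)"
    using S'_unit_cong[OF S'_unit_power[OF S'_unit_hh] poly_like_S' fil_frob_hh] by blast
qed

section \<open>The group and its action\<close>

lemma padic_units_iff: "l \<in> padic_units \<longleftrightarrow> l dvd 1"
  by (simp add: padic_units_def)

lemma group_Gamma: "group (Gamma_semidirect :: ('p::prime_card padic_int \<times> 'p padic_int) monoid)"
proof (rule groupI)
  let ?G = "Gamma_semidirect :: ('p padic_int \<times> 'p padic_int) monoid"
  show "x \<otimes>\<^bsub>?G\<^esub> y \<in> carrier ?G" if "x \<in> carrier ?G" "y \<in> carrier ?G" for x y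
    using that mult_dvd_mono[of "fst x" 1 "fst y" 1]
    by (auto simp: Gamma_semidirect_def padic_units_iff)
  show "\<exists>y\<in>carrier ?G. y \<otimes>\<^bsub>?G\<^esub> x = \<one>\<^bsub>?G\<^esub>" if "x \<in> carrier ?G" for x
  proof -
    obtain l m where x: "x = (l, m)" by (cases x)
    then have "l dvd 1" using that by (simp add: Gamma_semidirect_def padic_units_iff)
    then obtain k where k: "1 = l * k" by (rule dvdE)
    then have "k dvd 1" by (metis dvd_triv_right)
    then show ?thesis
      using k by (intro bexI[of _ "(k, - (k * m))"])
        (auto simp: x Gamma_semidirect_def padic_units_iff mult.commute)
  qed
qed (auto simp: Gamma_semidirect_def padic_units_iff algebra_simps)

lemma Gamma_act_eq: "Gamma_act g x = rho (snd g) (sigma (fst g) x)"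
  by (simp add: Gamma_act_def case_prod_beta)

lemma fil_hom_Gamma_act: "fil_hom (Gamma_act g)"
  using fil_hom_comp[OF fil_hom_rho fil_hom_sigma, of "snd g" "fst g"]
  by (simp add: Gamma_act_def case_prod_beta)

lemma Gamma_act_S': "x \<in> S' \<Longrightarrow> Gamma_act g x \<in> S'"
  by (simp add: Gamma_act_eq rho_S' sigma_S')

lemma Gamma_act_frob: "Gamma_act g (frob x) = frob (Gamma_act g x)"
  by (simp add: Gamma_act_eq sigma_frob rho_frob)

lemma at_q1_Gamma_act: "at_q1 (Gamma_act g x) = at_q1 x"
  by (rule fps_ext) (simp add: Gamma_act_eq rho_nth sigma_nth fps_power_zeroth)

lemma Gamma_act_one: "Gamma_act \<one>\<^bsub>Gamma_semidirect\<^esub> x = x"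
  by (simp add: Gamma_act_eq Gamma_semidirect_def)

lemma Gamma_act_mult: "Gamma_act (g \<otimes>\<^bsub>Gamma_semidirect\<^esub> h) x = Gamma_act g (Gamma_act h x)"
  by (simp add: Gamma_act_eq Gamma_semidirect_def case_prod_beta sigma_rho sigma_sigma rho_rho)

lemma fil_R_q_power_dvd: "pp ^ n dvd l - l' \<Longrightarrow> fil_R n (q_power l - q_power l')"
proof -
  assume "pp ^ n dvd l - l'"
  then obtain y where "l - l' = pp ^ n * y" by (rule dvdE)
  then have "l = l' + pp ^ n * y" by (simp add: algebra_simps)
  then show ?thesis using fil_R_mono[OF fil_R_q_power_cong[of n l' y]] by simp
qed

text \<open>The bound is uniform in x, which is what joint continuity in the group element and the
  module element requires.\<close>

lemma fil_Gamma_act_cong: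
  assumes "pp ^ n dvd fst g - fst g'" "pp ^ n dvd snd g - snd g'"
  shows "fil n (Gamma_act g x - Gamma_act g' x)"
proof -
  have "fil n (sigma (fst g) x - sigma (fst g') x)"
    using fil_R_subst_q_cong[OF fil_R_q_power_dvd[OF assms(1)]] by (simp add: fil_def sigma_nth)
  then have "fil n (rho (snd g) (sigma (fst g) x) - rho (snd g) (sigma (fst g') x))"
    by (simp add: fil_homD(4)[OF fil_hom_rho] flip: fil_homD(6)[OF fil_hom_rho])
  moreover have "fil n (rho (snd g) y - rho (snd g') y)" for y
    unfolding fil_def fps_sub_nth rho_nth
    by (intro allI fil_R_cong_mult fil_R_cong_power fil_R_q_power_dvd assms(2)) simp
  ultimately show ?thesis unfolding Gamma_act_eq by (rule fil_cong_trans)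
qed

section \<open>Adic topologies\<close>

text \<open>Monotonicity of the powers gives stability under intersections, by passing to the larger
  of two exponents.\<close>

lemma openin_adic_topology:
  assumes mono: "\<And>m n. m \<le> n \<Longrightarrow> adic_power S M J n \<subseteq> adic_power S M J m"
  shows "openin (adic_topology S M J) U \<longleftrightarrow>
    U \<subseteq> carrier M \<and> (\<forall>x\<in>U. \<exists>n. \<forall>y\<in>adic_power S M J n. x \<oplus>\<^bsub>M\<^esub> y \<in> U)"
proof -
  let ?P = "\<lambda>U. U \<subseteq> carrier M \<and> (\<forall>x\<in>U. \<exists>n. \<forall>y\<in>adic_power S M J n. x \<oplus>\<^bsub>M\<^esub> y \<in> U)"
  have "istopology ?P"
    unfolding istopology_def
  proof (intro conjI allI impI)
    fix U V assume UV: "?P U" "?P V"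
    show "U \<inter> V \<subseteq> carrier M" using UV by blast
    show "\<forall>x\<in>U \<inter> V. \<exists>n. \<forall>y\<in>adic_power S M J n. x \<oplus>\<^bsub>M\<^esub> y \<in> U \<inter> V"
    proof
      fix x assume "x \<in> U \<inter> V"
      then obtain m n where "\<forall>y\<in>adic_power S M J m. x \<oplus>\<^bsub>M\<^esub> y \<in> U"
        "\<forall>y\<in>adic_power S M J n. x \<oplus>\<^bsub>M\<^esub> y \<in> V"
        using UV by blast
      then show "\<exists>n. \<forall>y\<in>adic_power S M J n. x \<oplus>\<^bsub>M\<^esub> y \<in> U \<inter> V"
        using mono[of m "max m n"] mono[of n "max m n"] by (intro exI[of _ "max m n"]) auto
    qed
  next
    fix \<K> assume K: "\<forall>U\<in>\<K>. ?P U"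
    show "\<Union>\<K> \<subseteq> carrier M" using K by blast
    show "\<forall>x\<in>\<Union>\<K>. \<exists>n. \<forall>y\<in>adic_power S M J n. x \<oplus>\<^bsub>M\<^esub> y \<in> \<Union>\<K>"
      using K by (meson UnionE UnionI)
  qed
  then show ?thesis unfolding adic_topology_def by (simp add: topology_inverse')
qed

abbreviation S'_topology :: "'p::prime_card padic_int fps fps topology" where
  "S'_topology \<equiv> adic_topology (ring_on S') U' {of_nat CARD('p), tt}"

lemma openin_S'_topology:
  "openin S'_topology U \<longleftrightarrow> U \<subseteq> S' \<and> (\<forall>x\<in>U. \<exists>n. \<forall>y\<in>S'. fil n y \<longrightarrow> x + y \<in> U)"
  unfolding U'_def
  by (subst openin_adic_topology) (auto simp: adic_power_S' Ball_def imp_conjL dest: fil_mono)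

lemma topspace_S'_topology: "topspace S'_topology = S'"
proof
  show "topspace S'_topology \<subseteq> S'"
    using openin_topspace[of S'_topology] unfolding openin_S'_topology by blast
  have "openin S'_topology S'" unfolding openin_S'_topology by (auto intro: S'_ring)
  then show "S' \<subseteq> topspace S'_topology" by (rule openin_subset)
qed

lemma openin_S'_ball:
  "openin S'_topology {y \<in> S'. fil n (y - x)}"
  unfolding openin_S'_topology
proof (intro conjI ballI exI allI impI)
  fix y z :: "'a padic_int fps fps" assume "y \<in> {y \<in> S'. fil n (y - x)}" "z \<in> S'" "fil n z"
  then show "y + z \<in> {y \<in> S'. fil n (y - x)}"
    using fil_add[of n "y - x" z] by (auto intro: S'_ring simp: algebra_simps)
qed auto

lemma openin_padic_topology:
  "openin padic_topology U \<longleftrightarrow> (\<forall>x\<in>U. \<exists>n. \<forall>y. pp ^ n dvd y \<longrightarrow> x + y \<in> U)"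
  unfolding padic_topology_def
  by (subst openin_adic_topology)
    (auto simp: adic_power_UNIV1 Ball_def intro: dvd_trans[OF le_imp_power_dvd])

lemma openin_padic_ball: "openin padic_topology {y. pp ^ n dvd y - x}"
  unfolding openin_padic_topology
proof (intro ballI exI allI impI)
  fix y z :: "'a padic_int" assume "y \<in> {y. pp ^ n dvd y - x}" "pp ^ n dvd z"
  then show "y + z \<in> {y. pp ^ n dvd y - x}"
    using dvd_add[of "pp ^ n" "y - x" z] by (simp add: algebra_simps)
qed

lemma topspace_padic_topology: "topspace padic_topology = UNIV"
proof -
  have "openin padic_topology UNIV" unfolding openin_padic_topology by auto
  then show ?thesis using openin_subset by blast
qed

lemma topspace_Gamma_topology: "topspace Gamma_topology = carrier Gamma_semidirect"
  by (simp add: Gamma_topology_def topspace_padic_topology Gamma_semidirect_def)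

section \<open>The ratios of F and its conjugates\<close>

lemma F_trunc_S': "F_trunc s \<in> S'"
  by (rule poly_like_S') (auto simp: poly_like_def F_trunc_def intro!: exI[of _ "CARD('a) ^ s"])

text \<open>The cofactor constructed is \<open>[p^N]_q\<close>: each application of \<phi>
  contributes a further factor \<open>[p]_q\<close>, which lies in J.\<close>

lemma fil_tt_frob_power:
  "\<exists>e. (frob ^^ N) tt = tt * e \<and> fil N (e :: 'p::prime_card padic_int fps fps)"
proof (induction N)
  case (Suc N)
  then obtain e where e: "(frob ^^ N) tt = tt * e" "fil N (e :: 'p padic_int fps fps)" by blast
  have "sigma pp tt = (fps_const (q_number pp * fps_X) :: 'p padic_int fps fps)"
    by (rule fps_ext) (simp add: sigma_nth subst_q_X)
  then have "frob tt = (tt * fps_const (q_number pp) :: 'p padic_int fps fps)"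
    by (simp add: frob_eq mult.commute)
  then have "(frob ^^ Suc N) tt = tt * (fps_const (q_number pp) * frob e :: 'p padic_int fps fps)"
    using e by (simp add: fil_homD[OF fil_hom_frob] mult.assoc)
  moreover have "fil (Suc 0 + N) (fps_const (q_number pp) * frob e :: 'p padic_int fps fps)"
    using e by (intro fil_mult fil_homD(4)[OF fil_hom_frob]) (simp_all add: fil_R_1_iff)
  ultimately show ?case by auto
qed (auto intro: exI[of _ 1])

lemma fil_tt_frob_power': "fil N ((frob ^^ N) tt * z)"
  using fil_tt_frob_power[of N] by (metis fil_mult_left fil_mult_right)

text \<open>\<open>v\<close> is the limit of the products \<open>w \<phi>(w) \<dots> \<phi>\<^sup>N(w)\<close>.\<close>

lemma frob_fixed_ratio_S':
  assumes w: "w \<in> S'" and v: "v = w * frob v" "at_q1 v = 1"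
  shows "v \<in> S'"
proof -
  \<comment> \<open>The error is kept as a multiple of \<open>\<phi>^N(q - 1)\<close>, since a bound
    in terms of \<open>fil\<close> would not improve under \<phi>. The smallness of this multiple is
    used only at the end.\<close>
  have approx: "\<exists>a\<in>S'. \<exists>z. v - a = (frob ^^ N) tt * z" for N
  proof (induction N)
    case 0
    have "v = 1 + tt * tshift v" using t_expansion[of v] v(2) by simp
    then have "v - 1 = tt * tshift v" by (metis add_diff_cancel_left')
    then show ?case using S'_ring(1) by auto
  next
    case (Suc N)
    then obtain a z where az: "a \<in> S'" "v - a = (frob ^^ N) tt * z" by blast
    have "v - w * frob a = w * frob (v - a)"
      using v(1) by (simp add: fil_homD[OF fil_hom_frob] right_diff_distrib)
    also have "\<dots> = (frob ^^ Suc N) tt * (w * frob z)"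
      by (simp add: az fil_homD[OF fil_hom_frob])
    finally show ?case using S'_ring(5)[OF w frob_S'[OF az(1)]] by blast
  qed
  show ?thesis
  proof (rule S'_closed)
    fix n
    show "\<exists>a\<in>S'. fil n (v - a)" using approx[of n] fil_tt_frob_power' by metis
  qed
qed

context
  assumes odd_card: "odd CARD('p::prime_card)"
begin

abbreviation FF :: "'p padic_int fps fps" where
  "FF \<equiv> F_series"

lemma FF_dvd_one: "FF dvd 1"
  by (simp add: fps_dvd_one_iff F_series_0[OF odd_card])

lemma FF_neq_0: "FF \<noteq> 0"
  using FF_dvd_one by auto

lemma hom_FF_dvd_one: "fil_hom \<psi> \<Longrightarrow> \<psi> FF dvd 1"
  using FF_dvd_one by (metis dvdE dvdI fil_homD(1,3))

lemma quot_FF: assumes "fil_hom \<psi>" shows "quot FF (\<psi> FF) * \<psi> FF = FF"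
proof (rule quot_mult)
  show "\<psi> FF dvd FF" using hom_FF_dvd_one[OF assms] by (rule dvd_trans) simp
  show "\<psi> FF \<noteq> 0" using hom_FF_dvd_one[OF assms] by auto
qed

lemma S'_unit_F_trunc: "S'_unit (F_trunc s :: 'p padic_int fps fps)"
proof (induction s)
  case 0
  then show ?case by (simp add: F_trunc_0[OF odd_card] S'_unit_1)
next
  case (Suc s)
  have "S'_unit (hh * frob (F_trunc s) :: 'p padic_int fps fps)"
    by (intro S'_unit_mult S'_unit_hh S'_unit_hom[OF fil_hom_frob frob_S'] Suc)
  then show ?case by (rule S'_unit_cong[OF _ F_trunc_S' fil_F_trunc_Suc[OF odd_card]])
qed

lemma S'_unit_frob_ratio: "S'_unit (quot FF (frob FF))"
proof -
  let ?u = "quot FF (frob FF)"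
  have u: "?u * frob FF = FF" by (rule quot_FF[OF fil_hom_frob])
  have approx: "\<exists>g. g \<in> S' \<and> frob (F_trunc s) * g = 1 \<and> fil (Suc s) (?u - F_trunc (Suc s) * g)" for s
  proof -
    obtain g where g: "g \<in> S'" "frob (F_trunc s) * g = (1 :: 'p padic_int fps fps)"
      using S'_unit_hom[OF fil_hom_frob frob_S' S'_unit_F_trunc[of s]] by (auto simp: S'_unit_def)
    \<comment> \<open>Clearing both denominators leaves the Dwork congruence; they are units of
      \<open>R[[\<lambda>]]\<close> and can be cancelled from the filtration afterwards.\<close>
    have "?u * (frob FF * frob (F_trunc s)) - F_trunc (Suc s) * g * (frob FF * frob (F_trunc s))
        = (?u * frob FF) * frob (F_trunc s) - F_trunc (Suc s) * frob FF * (frob (F_trunc s) * g)"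
      by (simp only: mult_ac)
    also have "\<dots> = FF * frob (F_trunc s) - F_trunc (Suc s) * frob FF" using g u by simp
    finally have "fil (Suc s)
        (?u * (frob FF * frob (F_trunc s)) - F_trunc (Suc s) * g * (frob FF * frob (F_trunc s)))"
      using dwork_congruence[OF odd_card, of s] by simp
    moreover have "frob FF * frob (F_trunc s) dvd 1"
      using hom_FF_dvd_one[OF fil_hom_frob] g(2) by (metis dvdI mult_dvd_mono mult_1)
    ultimately show ?thesis using g fil_cancel_unit by blast
  qed
  have "?u \<in> S'"
  proof (rule S'_closed)
    fix n
    obtain g where "g \<in> S'" "fil (Suc n) (?u - F_trunc (Suc n) * g)" using approx by blast
    then show "\<exists>a\<in>S'. fil n (?u - a)"
      using S'_ring(5)[OF F_trunc_S'] fil_mono[of "Suc n" _ n] by (metis le_add2 plus_1_eq_Suc)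
  qed
  \<comment> \<open>The case s = 0, where \<open>F_trunc 0 = 1\<close>, compares u modulo J with a
    truncation already known to be a unit.\<close>
  moreover have "fil (Suc 0) (?u - F_trunc (Suc 0))"
    using approx[of 0] F_trunc_0[OF odd_card] by (auto simp: fil_homD[OF fil_hom_frob])
  ultimately show ?thesis using S'_unit_cong[OF S'_unit_F_trunc] by blast
qed

text \<open>The functional equation of v has the coefficient \<open>u / \<psi>(u)\<close>; it lies
  in S' because u is a unit there, so that \<open>\<psi>(u)\<close> can be inverted inside
  S'.\<close>

lemma ratio_S':
  assumes hom: "fil_hom \<psi>" and S': "\<And>x. x \<in> S' \<Longrightarrow> \<psi> x \<in> S'"
    and comm: "\<And>x. \<psi> (frob x) = frob (\<psi> x)" and q1: "\<And>x. at_q1 (\<psi> x) = at_q1 x"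
  shows "quot FF (\<psi> FF) \<in> S'" and "at_q1 (quot FF (\<psi> FF)) = 1"
proof -
  let ?u = "quot FF (frob FF)" and ?v = "quot FF (\<psi> FF)"
  have u: "?u * frob FF = FF" by (rule quot_FF[OF fil_hom_frob])
  have v: "?v * \<psi> FF = FF" by (rule quot_FF[OF hom])
  have "at_q1 ?v * at_q1 FF = 1 * at_q1 FF"
    using arg_cong[OF v, of at_q1] by (simp add: at_q1_mult q1)
  moreover have "at_q1 FF $ 0 = 1" by (simp add: F_series_0[OF odd_card])
  then have "at_q1 FF \<noteq> 0" by (metis fps_zero_nth zero_neq_one)
  ultimately show v1: "at_q1 ?v = 1" by (metis mult_right_cancel)
  obtain u' where u': "u' \<in> S'" "\<psi> ?u * u' = 1"
    using S'_unit_hom[OF hom S' S'_unit_frob_ratio] by (rule S'_unitE)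
  have "?u \<in> S'" using S'_unit_frob_ratio by (simp add: S'_unit_def)
  have "frob ?v * frob (\<psi> FF) = frob FF"
    using arg_cong[OF v, of frob] by (simp add: fil_homD[OF fil_hom_frob])
  have \<psi>u: "\<psi> ?u * frob (\<psi> FF) = \<psi> FF"
    using arg_cong[OF u, of \<psi>] by (simp add: fil_homD[OF hom] comm)
  have "(?u * u' * frob ?v) * \<psi> FF = ?u * u' * frob ?v * (\<psi> ?u * frob (\<psi> FF))"
    by (simp only: \<psi>u)
  also have "\<dots> = ?u * (\<psi> ?u * u') * (frob ?v * frob (\<psi> FF))" by (simp only: mult_ac)
  also have "\<dots> = ?v * \<psi> FF"
    using u u' v \<open>frob ?v * frob (\<psi> FF) = frob FF\<close> by simp
  finally have "(?u * u' * frob ?v) * \<psi> FF = ?v * \<psi> FF" .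
  moreover have "\<psi> FF \<noteq> 0" using hom_FF_dvd_one[OF hom] by auto
  ultimately have fixed: "?v = ?u * u' * frob ?v" by (metis mult_right_cancel)
  show "?v \<in> S'"
    by (rule frob_fixed_ratio_S'[OF S'_ring(5)[OF \<open>?u \<in> S'\<close> u'(1)] fixed v1])
qed

section \<open>The action on U'\<close>

abbreviation kappa :: "'p padic_int \<times> 'p padic_int \<Rightarrow> 'p padic_int fps fps" where
  "kappa g \<equiv> quot FF (Gamma_act g FF)"

lemma kappa: "kappa g * Gamma_act g FF = FF"
  by (rule quot_FF[OF fil_hom_Gamma_act])

lemma kappa_eqI: "c * Gamma_act g FF = FF \<Longrightarrow> kappa g = c"
  using hom_FF_dvd_one[OF fil_hom_Gamma_act[of g]] by (intro quot_eqI) auto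

lemma kappa_S': "kappa g \<in> S'"
  by (rule ratio_S'(1)[OF fil_hom_Gamma_act Gamma_act_S' Gamma_act_frob at_q1_Gamma_act])

lemma at_q1_kappa: "at_q1 (kappa g) = 1"
  by (rule ratio_S'(2)[OF fil_hom_Gamma_act Gamma_act_S' Gamma_act_frob at_q1_Gamma_act])

text \<open>The two successive ratios telescope into one. The action thereby becomes the ring action
  twisted by \<open>kappa\<close>, and the group law reduces to the cocycle identity.\<close>

lemma U'_act_eq: "U'_act g x = Gamma_act g x * kappa g"
proof -
  let ?v = "quot FF (sigma (fst g) FF)" and ?w = "quot FF (rho (snd g) FF)"
  have v: "?v * sigma (fst g) FF = FF" by (rule quot_FF[OF fil_hom_sigma])
  have w: "?w * rho (snd g) FF = FF" by (rule quot_FF[OF fil_hom_rho])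
  have "kappa g = rho (snd g) ?v * ?w"
  proof (rule kappa_eqI)
    have "rho (snd g) ?v * ?w * Gamma_act g FF = ?w * rho (snd g) (?v * sigma (fst g) FF)"
      by (simp add: Gamma_act_eq fil_homD[OF fil_hom_rho] mult_ac)
    then show "rho (snd g) ?v * ?w * Gamma_act g FF = FF" by (simp only: v w)
  qed
  then show ?thesis
    by (simp add: U'_act_def U'_rho_def U'_sigma_def e2'_def case_prod_beta Gamma_act_eq
        fil_homD[OF fil_hom_rho] mult.assoc)
qed

lemma U'_act_S': "x \<in> S' \<Longrightarrow> U'_act g x \<in> (S' :: 'p padic_int fps fps set)"
  unfolding U'_act_eq by (intro S'_ring Gamma_act_S' kappa_S')

text \<open>The cocycle identity holds because \<open>kappa g\<close> is the coboundary
  \<open>F / g(F)\<close>.\<close>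

lemma kappa_mult: "kappa (g \<otimes>\<^bsub>Gamma_semidirect\<^esub> h) = Gamma_act g (kappa h) * kappa g"
proof (rule kappa_eqI)
  have "Gamma_act g (kappa h) * kappa g * Gamma_act (g \<otimes>\<^bsub>Gamma_semidirect\<^esub> h) FF
      = kappa g * Gamma_act g (kappa h * Gamma_act h FF)"
    by (simp add: Gamma_act_mult fil_homD[OF fil_hom_Gamma_act] mult_ac)
  then show "Gamma_act g (kappa h) * kappa g * Gamma_act (g \<otimes>\<^bsub>Gamma_semidirect\<^esub> h) FF = FF"
    by (simp only: kappa)
qed

lemma carrier_U' [simp]: "carrier U' = S'" and U'_simps [simp]: "smult U' = (*)" "add U' = (+)" "zero U' = 0"
  by (simp_all add: U'_def)

lemma module_U': "module (ring_on S') (U' :: (_, 'p padic_int fps fps) module)"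
  unfolding U'_def by (rule module_module_on[OF closed_subring_S'])

lemma semilinear_action_U':
  "semilinear_action (ring_on S') (Gamma_semidirect :: ('p padic_int \<times> 'p padic_int) monoid)
     Gamma_act U' U'_act"
  unfolding semilinear_action_def acts_by_ring_automorphisms_def acts_on_def semilinear_map_def
proof (intro conjI ballI)
  let ?G = "Gamma_semidirect :: ('p padic_int \<times> 'p padic_int) monoid"
  show "group ?G" by (rule group_Gamma)
  show "Gamma_act g \<in> Ring.ring_hom (ring_on S') (ring_on S')" for g :: "'p padic_int \<times> 'p padic_int"
    by (rule ring_hom_memI) (simp_all add: Gamma_act_S' fil_homD[OF fil_hom_Gamma_act])
  have "kappa \<one>\<^bsub>?G\<^esub> = 1" by (rule kappa_eqI) (simp add: Gamma_act_one)
  then show "U'_act \<one>\<^bsub>?G\<^esub> x = x" for x by (simp add: U'_act_eq Gamma_act_one)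
  show "U'_act (g \<otimes>\<^bsub>?G\<^esub> h) x = U'_act g (U'_act h x)" for g h x
    unfolding U'_act_eq kappa_mult
    by (simp add: Gamma_act_mult fil_homD[OF fil_hom_Gamma_act] mult.assoc)
  show "U'_act g (x \<oplus>\<^bsub>U'\<^esub> y) = U'_act g x \<oplus>\<^bsub>U'\<^esub> U'_act g y" for g and x y :: "'p padic_int fps fps"
    by (simp add: U'_act_eq fil_homD[OF fil_hom_Gamma_act] algebra_simps)
  show "U'_act g (a \<odot>\<^bsub>U'\<^esub> x) = Gamma_act g a \<odot>\<^bsub>U'\<^esub> U'_act g x" for g and a x :: "'p padic_int fps fps"
    by (simp add: U'_act_eq fil_homD[OF fil_hom_Gamma_act] mult.assoc)
qed (simp_all add: Gamma_act_S' Gamma_act_one Gamma_act_mult U'_act_S')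

text \<open>\<open>kappa g\<close> times \<open>g(F)\<close> is F for every g, so continuity of
  \<open>kappa\<close> follows from that of \<open>g(F)\<close> after cancelling a unit.\<close>

lemma fil_kappa_cong:
  assumes "pp ^ n dvd fst g - fst g'" "pp ^ n dvd snd g - snd g'"
  shows "fil n (kappa g - kappa g')"
proof (rule fil_cancel_unit)
  have "kappa g * Gamma_act g FF - kappa g' * Gamma_act g FF
      = kappa g' * (Gamma_act g' FF - Gamma_act g FF)"
    by (simp add: kappa right_diff_distrib)
  then show "fil n (kappa g * Gamma_act g FF - kappa g' * Gamma_act g FF)"
    using fil_cong_sym[OF fil_Gamma_act_cong[OF assms]] by (simp add: fil_mult_left)
qed (rule hom_FF_dvd_one[OF fil_hom_Gamma_act])

lemma continuous_U'_act:
  "continuous_map (prod_topology Gamma_topology S'_topology) S'_topology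
     (\<lambda>(g, x). U'_act g (x :: 'p padic_int fps fps))"
  unfolding continuous_map_def
proof (intro conjI allI impI)
  show "(\<lambda>(g, x). U'_act g x) \<in> topspace (prod_topology Gamma_topology S'_topology)
      \<rightarrow> topspace (S'_topology :: 'p padic_int fps fps topology)"
    by (auto simp: topspace_S'_topology U'_act_S')
  fix U :: "'p padic_int fps fps set" assume "openin S'_topology U"
  then have U: "U \<subseteq> S'" "\<And>x. x \<in> U \<Longrightarrow> \<exists>n. \<forall>y\<in>S'. fil n y \<longrightarrow> x + y \<in> U"
    unfolding openin_S'_topology by blast+
  let ?W = "{z \<in> topspace (prod_topology Gamma_topology S'_topology). (case z of (g, x) \<Rightarrow> U'_act g x) \<in> U}"
  show "openin (prod_topology Gamma_topology S'_topology) ?W"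
    unfolding openin_prod_topology_alt
  proof (intro allI impI)
    fix g0 :: "'p padic_int \<times> 'p padic_int" and x0 :: "'p padic_int fps fps"
    assume "(g0, x0) \<in> ?W"
    then have g0: "fst g0 \<in> padic_units" and x0: "x0 \<in> S'" and "U'_act g0 x0 \<in> U"
      by (auto simp: topspace_S'_topology topspace_Gamma_topology Gamma_semidirect_def)
    then obtain n where n: "\<And>y. y \<in> S' \<Longrightarrow> fil n y \<Longrightarrow> U'_act g0 x0 + y \<in> U" using U by blast
    let ?L = "{l. pp ^ n dvd l - fst g0} \<inter> padic_units" and ?M = "{m. pp ^ n dvd m - snd g0}"
    let ?V = "{x \<in> S'. fil n (x - x0)}"
    have "openin Gamma_topology (?L \<times> ?M)"
      unfolding Gamma_topology_def openin_prod_Times_iff openin_subtopology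
      using openin_padic_ball by blast
    moreover have "openin S'_topology ?V" by (rule openin_S'_ball)
    moreover have "g0 \<in> ?L \<times> ?M" "x0 \<in> ?V" using g0 x0 by (auto simp: mem_Times_iff)
    moreover have "(?L \<times> ?M) \<times> ?V \<subseteq> ?W"
    proof
      fix z assume "z \<in> (?L \<times> ?M) \<times> ?V"
      then obtain g x where z: "z = (g, x)" and g: "g \<in> ?L \<times> ?M" and x: "x \<in> ?V" by blast
      have "fil n (Gamma_act g x - Gamma_act g0 x0)"
      proof (rule fil_cong_trans)
        show "fil n (Gamma_act g x - Gamma_act g x0)"
          using x by (simp add: fil_homD(4)[OF fil_hom_Gamma_act] flip: fil_homD(6)[OF fil_hom_Gamma_act])
        show "fil n (Gamma_act g x0 - Gamma_act g0 x0)"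
          using g by (intro fil_Gamma_act_cong) auto
      qed
      then have "fil n (U'_act g x - U'_act g0 x0)"
        unfolding U'_act_eq using g by (intro fil_cong_mult fil_kappa_cong) auto
      moreover have "U'_act g x - U'_act g0 x0 \<in> S'"
        using x x0 by (intro S'_ring U'_act_S') auto
      ultimately have "U'_act g0 x0 + (U'_act g x - U'_act g0 x0) \<in> U" using n by blast
      then show "z \<in> ?W"
        using g x by (auto simp: z topspace_S'_topology topspace_Gamma_topology Gamma_semidirect_def)
    qed
    ultimately show "\<exists>A B. openin Gamma_topology A \<and> openin S'_topology B \<and> g0 \<in> A \<and> x0 \<in> B \<and> A \<times> B \<subseteq> ?W"
      by blast
  qed
qed

section \<open>The Frobenius of U'\<close>

lemma free_U': "free_of_finite_type (ring_on S') (U' :: (_, 'p padic_int fps fps) module)"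
  unfolding free_of_finite_type_def
proof (intro exI[of _ "{1}"] conjI ballI)
  interpret module "ring_on S'" "U' :: (_, 'p padic_int fps fps) module" by (rule module_U')
  show "{1} \<subseteq> carrier (U' :: (_, 'p padic_int fps fps) module)" using S'_ring(1) by simp
  have sum: "(\<Oplus>\<^bsub>U'\<^esub>e\<in>{1}. c e \<odot>\<^bsub>U'\<^esub> e) = (c 1 :: 'p padic_int fps fps)" if "c 1 \<in> S'" for c
  proof -
    have "(\<Oplus>\<^bsub>U'\<^esub>e\<in>{1}. c e \<odot>\<^bsub>U'\<^esub> e) = c 1 \<odot>\<^bsub>U'\<^esub> 1 \<oplus>\<^bsub>U'\<^esub> (\<Oplus>\<^bsub>U'\<^esub>e\<in>{}. c e \<odot>\<^bsub>U'\<^esub> e)"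
      using that by (intro M.finsum_insert) auto
    then show ?thesis by simp
  qed
  fix x :: "'p padic_int fps fps" assume "x \<in> carrier U'"
  then have x: "x \<in> S'" by simp
  show "\<exists>!c. c \<in> {1} \<rightarrow>\<^sub>E carrier (ring_on S') \<and> x = (\<Oplus>\<^bsub>U'\<^esub>e\<in>{1}. c e \<odot>\<^bsub>U'\<^esub> e)"
  proof (rule ex1I[of _ "restrict (\<lambda>_. x) {1}"])
    show "restrict (\<lambda>_. x) {1} \<in> {1} \<rightarrow>\<^sub>E carrier (ring_on S')
        \<and> x = (\<Oplus>\<^bsub>U'\<^esub>e\<in>{1}. restrict (\<lambda>_. x) {1} e \<odot>\<^bsub>U'\<^esub> e)"
      using x by (subst sum) auto
    fix c assume c: "c \<in> {1} \<rightarrow>\<^sub>E carrier (ring_on S') \<and> x = (\<Oplus>\<^bsub>U'\<^esub>e\<in>{1}. c e \<odot>\<^bsub>U'\<^esub> e)"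
    then have "c 1 \<in> S'" by auto
    then have "c 1 = x" using sum[of c] c by simp
    then show "c = restrict (\<lambda>_. x) {1}" using c PiE_arb[of c "{1}"] by (intro ext) (auto simp: restrict_def)
  qed
qed simp

abbreviation eps_u :: "'p padic_int fps fps" where
  "eps_u \<equiv> (-1) ^ ((CARD('p) - 1) div 2) * quot FF (frob FF)"

lemma U'_frob_eq: "U'_frob x = frob x * eps_u"
  by (simp add: U'_frob_def e2'_def)

lemma S'_unit_eps_u: "S'_unit eps_u"
proof (intro S'_unit_mult S'_unit_power S'_unit_frob_ratio)
  show "S'_unit (-1 :: 'p padic_int fps fps)"
    unfolding S'_unit_def using S'_ring(3)[OF S'_ring(1)] by (intro conjI bexI[of _ "-1"]) auto
qed

lemma U'_frob_S': "x \<in> S' \<Longrightarrow> U'_frob x \<in> (S' :: 'p padic_int fps fps set)"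
  unfolding U'_frob_eq using S'_unit_eps_u by (auto simp: S'_unit_def intro: S'_ring frob_S')

lemma span_U'_frob:
  "module_span (ring_on S') U' (U'_frob ` carrier U') = carrier (U' :: (_, 'p padic_int fps fps) module)"
proof
  interpret module "ring_on S'" "U' :: (_, 'p padic_int fps fps) module" by (rule module_U')
  have "U'_frob ` carrier U' \<subseteq> carrier (U' :: (_, 'p padic_int fps fps) module)"
    by (auto intro: U'_frob_S')
  then show "module_span (ring_on S') U' (U'_frob ` carrier U') \<subseteq> carrier (U' :: (_, 'p padic_int fps fps) module)"
    unfolding module_span_def using carrier_is_submodule by (intro Inter_lower) blast
  show "carrier (U' :: (_, 'p padic_int fps fps) module) \<subseteq> module_span (ring_on S') U' (U'_frob ` carrier U')"
    unfolding module_span_def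
  proof (intro subsetI InterI)
    fix x :: "'p padic_int fps fps" and N :: "'p padic_int fps fps set"
    assume "x \<in> carrier U'" and N: "N \<in> {N. submodule N (ring_on S') U' \<and> U'_frob ` carrier U' \<subseteq> N}"
    obtain y where y: "y \<in> S'" "eps_u * y = 1" using S'_unit_eps_u by (rule S'_unitE)
    have "U'_frob 1 \<in> N" using N S'_ring(1) by auto
    then have "eps_u \<in> N" by (simp add: U'_frob_eq fil_homD[OF fil_hom_frob])
    moreover have "x * y \<in> S'" using \<open>x \<in> carrier U'\<close> y by (auto intro: S'_ring)
    moreover have "submodule N (ring_on S') (module_on S')" using N by (simp add: U'_def)
    ultimately have "(x * y) * eps_u \<in> N"
      unfolding submodule_module_on_iff[OF closed_subring_S'] by blast
    moreover have "(x * y) * eps_u = x" using y(2) by (simp add: mult_ac)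
    ultimately show "x \<in> N" by (simp only:)
  qed
qed

lemma MF00_object_U':
  "MF00_object (ring_on S') (of_nat CARD('p)) tt frob
     (Gamma_semidirect :: ('p padic_int \<times> 'p padic_int) monoid) Gamma_topology Gamma_act
     U' U'_frob U'_act"
  unfolding MF00_object_def
proof (intro conjI ballI)
  let ?G = "Gamma_semidirect :: ('p padic_int \<times> 'p padic_int) monoid"
  show "frob \<in> Ring.ring_hom (ring_on S') (ring_on (S' :: 'p padic_int fps fps set))"
    by (rule ring_hom_memI) (simp_all add: frob_S' fil_homD[OF fil_hom_frob])
  show "semilinear_map (ring_on S') frob (U' :: (_, 'p padic_int fps fps) module) U' U'_frob"
    unfolding semilinear_map_def
    by (auto simp: U'_frob_S') (simp_all add: U'_frob_eq fil_homD[OF fil_hom_frob] algebra_simps)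
  show "U'_act g (U'_frob x) = U'_frob (U'_act g x)" for g and x :: "'p padic_int fps fps"
  proof -
    let ?u = "quot FF (frob FF)" and ?g = "Gamma_act g"
    have u: "?u * frob FF = FF" by (rule quot_FF[OF fil_hom_frob])
    \<comment> \<open>This is what commutation with the Frobenius amounts to; both sides equal F
      divided by \<open>frob (?g FF)\<close>.\<close>
    have "?g ?u * kappa g = frob (kappa g) * ?u"
    proof -
      have "?g ?u * frob (?g FF) = ?g FF" "frob (kappa g) * frob (?g FF) = frob FF"
        using arg_cong[OF u, of ?g] arg_cong[OF kappa[of g], of frob]
        by (simp_all add: fil_homD[OF fil_hom_Gamma_act] fil_homD[OF fil_hom_frob] Gamma_act_frob)
      then have "(?g ?u * kappa g) * frob (?g FF) = FF" "(frob (kappa g) * ?u) * frob (?g FF) = FF"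
        using u kappa[of g] by (metis mult.assoc mult.commute)+
      moreover have "frob (?g FF) dvd 1"
        using hom_FF_dvd_one[OF fil_hom_comp[OF fil_hom_frob fil_hom_Gamma_act, of g]] by simp
      then have "frob (?g FF) \<noteq> 0" by auto
      ultimately show ?thesis by (metis mult_right_cancel)
    qed
    moreover have "?g ((-1) ^ n) = (-1) ^ n" for n
      using fil_homD(6)[OF fil_hom_Gamma_act, of g 0 1]
      by (simp add: fil_hom_power[OF fil_hom_Gamma_act] fil_homD[OF fil_hom_Gamma_act])
    ultimately show ?thesis
      unfolding U'_act_eq U'_frob_eq
      by (simp add: fil_homD[OF fil_hom_Gamma_act] fil_homD[OF fil_hom_frob] Gamma_act_frob mult_ac)
  qed
  show "\<exists>y\<in>carrier U'. U'_act g x \<ominus>\<^bsub>U'\<^esub> x = tt \<odot>\<^bsub>U'\<^esub> y"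
    if "x \<in> carrier U'" for g and x :: "'p padic_int fps fps"
  proof -
    have x: "x \<in> S'" using that by simp
    let ?d = "U'_act g x - x"
    have "at_q1 ?d = 0" by (simp add: U'_act_eq at_q1_mult at_q1_kappa at_q1_Gamma_act)
    \<comment> \<open>Triviality modulo q - 1 holds since both the ring action and
      \<open>kappa\<close> are trivial at q = 1; \<open>tshift\<close> supplies the
      quotient.\<close>
    then have "?d = tt * tshift ?d" using t_expansion[of ?d] by simp
    moreover have "tshift ?d \<in> S'" using x by (intro tshift_S' S'_ring U'_act_S')
    moreover have "U'_act g x \<ominus>\<^bsub>U'\<^esub> x = ?d"
      unfolding U'_def using x by (intro a_minus_module_on closed_subring_S' U'_act_S')
    ultimately show ?thesis by auto
  qed
qed (rule module_U' free_U' span_U'_frob semilinear_action_U' continuous_U'_act)+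

section \<open>The reduction modulo q - 1\<close>

lemma at_q1_frob: "at_q1 (frob x) = frob1 (at_q1 (x :: 'p padic_int fps fps))"
  by (rule fps_ext) (simp add: frob1_def frob_nth fps_nth_compose_power_X)

lemma at_q1_frob_ratio: "at_q1 (quot FF (frob FF)) = quot f_series (frob1 f_series)"
proof (rule quot_eqI[symmetric])
  have "quot FF (frob FF) * frob FF = FF" by (rule quot_FF[OF fil_hom_frob])
  then show "at_q1 (quot FF (frob FF)) * frob1 f_series = f_series"
    unfolding f_series_def by (metis at_q1_frob at_q1_mult)
  have "frob1 f_series $ 0 = (1 :: 'p padic_int)"
    by (simp add: frob1_def f_series_def F_series_0[OF odd_card])
  then show "frob1 f_series \<noteq> (0 :: 'p padic_int fps)" by auto
qed

end

section \<open>The free rank one module over B' and the comparison with U'\<close>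

context
  fixes H :: "('p::prime_card padic_int fps, 'h) module" and D :: "'h \<Rightarrow> 'h" and \<omega> :: 'h
  assumes legendre: "legendre_de_rham H D \<omega>"
begin

interpretation H: module "ring_on (UNIV :: 'p padic_int fps set)" H
  using legendre by (simp add: legendre_de_rham_def)

abbreviation e2b :: 'h where "e2b \<equiv> e2_bar H D \<omega>"

lemma smult_minus: assumes "x \<in> carrier H" shows "(- a) \<odot>\<^bsub>H\<^esub> x = \<ominus>\<^bsub>H\<^esub> (a \<odot>\<^bsub>H\<^esub> x)"
proof -
  have "(- a) \<odot>\<^bsub>H\<^esub> x \<oplus>\<^bsub>H\<^esub> a \<odot>\<^bsub>H\<^esub> x = (- a + a) \<odot>\<^bsub>H\<^esub> x"
    using H.smult_l_distr[of "- a" a x] assms by simp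
  also have "\<dots> = \<zero>\<^bsub>H\<^esub>" using H.smult_l_null[OF assms] by simp
  finally show ?thesis using H.M.minus_equality[of "(- a) \<odot>\<^bsub>H\<^esub> x"] assms by simp
qed

lemma omega_carrier: "\<omega> \<in> carrier H" "D \<omega> \<in> carrier H"
  using legendre by (auto simp: legendre_de_rham_def)

lemma e2b_eq:
  "e2b = (fps_X * (1 - fps_X) * quot (fps_deriv f_series) f_series) \<odot>\<^bsub>H\<^esub> \<omega>
    \<oplus>\<^bsub>H\<^esub> (- (fps_X * (1 - fps_X))) \<odot>\<^bsub>H\<^esub> D \<omega>"
  using omega_carrier H.smult_assoc1[of "fps_X * (1 - fps_X)" "quot (fps_deriv f_series) f_series" \<omega>]
    H.smult_assoc1[of "fps_X * (1 - fps_X)" "- 1" "D \<omega>"] smult_minus[of "D \<omega>" 1]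
    H.smult_one[OF omega_carrier(2)]
  by (simp add: e2_bar_def a_minus_def H.smult_r_distr)

lemma e2b_carrier: "e2b \<in> carrier H"
  using omega_carrier by (simp add: e2b_eq)

text \<open>The coefficient of D \<omega> in the generator is
  \<open>- \<lambda> (1 - \<lambda>)\<close>, which is nonzero in a domain, so independence of
  \<omega> and D \<omega> suffices. This makes coordinates unique, as the definite description in
  \<open>U_B'_frob\<close> requires.\<close>

lemma smult_e2b_eq_0: assumes "b \<odot>\<^bsub>H\<^esub> e2b = \<zero>\<^bsub>H\<^esub>" shows "b = 0"
proof -
  let ?c = "fps_X * (1 - fps_X) :: 'p padic_int fps"
  have "(b * (?c * quot (fps_deriv f_series) f_series)) \<odot>\<^bsub>H\<^esub> \<omega> \<oplus>\<^bsub>H\<^esub> (b * (- ?c)) \<odot>\<^bsub>H\<^esub> D \<omega> = \<zero>\<^bsub>H\<^esub>"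
    using assms omega_carrier unfolding e2b_eq
    by (simp add: H.smult_r_distr flip: H.smult_assoc1[simplified])
  then have "b * (- ?c) = 0" using legendre unfolding legendre_de_rham_def by blast
  moreover have "(1 - fps_X :: 'p padic_int fps) \<noteq> 0"
    by (metis fps_X_nth fps_one_nth fps_sub_nth fps_zero_nth diff_zero zero_neq_one)
  ultimately show ?thesis by simp
qed

lemma smult_e2b_inj: assumes "b \<odot>\<^bsub>H\<^esub> e2b = c \<odot>\<^bsub>H\<^esub> e2b" shows "b = c"
proof -
  have "(b + - c) \<odot>\<^bsub>H\<^esub> e2b = \<zero>\<^bsub>H\<^esub>"
    using H.smult_l_distr[of b "- c" e2b] e2b_carrier assms
    by (simp add: smult_minus H.M.r_neg)
  then show ?thesis using smult_e2b_eq_0 by fastforce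
qed

lemma carrier_U_B': "carrier (U_B' H D \<omega>) = {b \<odot>\<^bsub>H\<^esub> e2b | b. b \<in> B'}"
  by (simp add: U_B'_def)

lemma module_U_B': "module (ring_on B') (U_B' H D \<omega>)"
proof -
  \<comment> \<open>Restriction of scalars from \<open>Z_p[[\<lambda>]]\<close> to B', so that the
    multiples of the generator by B' form a submodule.\<close>
  have H: "module (ring_on (B' :: 'p padic_int fps set)) H"
  proof (rule moduleI)
    show "cring (ring_on (B' :: 'p padic_int fps set))" by (rule cring_ring_on[OF closed_subring_B'])
    show "abelian_group H" by (rule H.M.abelian_group_axioms)
  qed (use H.smult_l_distr H.smult_r_distr H.smult_assoc1 H.smult_one in auto)
  interpret B: module "ring_on (B' :: 'p padic_int fps set)" H by (rule H)
  note D = closed_subringD[OF closed_subring_B']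
  have "submodule {b \<odot>\<^bsub>H\<^esub> e2b | b. b \<in> B'} (ring_on B') H"
  proof (rule B.submoduleI)
    show "\<zero>\<^bsub>H\<^esub> \<in> {b \<odot>\<^bsub>H\<^esub> e2b | b. b \<in> B'}"
      using D(2) H.smult_l_null[OF e2b_carrier] by (auto intro!: exI[of _ 0])
    show "\<ominus>\<^bsub>H\<^esub> x \<in> {b \<odot>\<^bsub>H\<^esub> e2b | b. b \<in> B'}" if x: "x \<in> {b \<odot>\<^bsub>H\<^esub> e2b | b. b \<in> B'}" for x
    proof -
      obtain b where "b \<in> B'" "x = b \<odot>\<^bsub>H\<^esub> e2b" using x by blast
      then show ?thesis using D(3)[of b] smult_minus[OF e2b_carrier, of b] by (metis (mono_tags, lifting) mem_Collect_eq)
    qed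
    show "x \<oplus>\<^bsub>H\<^esub> y \<in> {b \<odot>\<^bsub>H\<^esub> e2b | b. b \<in> B'}"
      if "x \<in> {b \<odot>\<^bsub>H\<^esub> e2b | b. b \<in> B'}" "y \<in> {b \<odot>\<^bsub>H\<^esub> e2b | b. b \<in> B'}" for x y
    proof -
      obtain a b where "a \<in> B'" "b \<in> B'" "x = a \<odot>\<^bsub>H\<^esub> e2b" "y = b \<odot>\<^bsub>H\<^esub> e2b" using \<open>x \<in> _\<close> \<open>y \<in> _\<close> by blast
      then show ?thesis
        using D(4)[of a b] H.smult_l_distr[of a b e2b] e2b_carrier by (auto intro!: exI[of _ "a + b"])
    qed
    show "a \<odot>\<^bsub>H\<^esub> x \<in> {b \<odot>\<^bsub>H\<^esub> e2b | b. b \<in> B'}"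
      if "a \<in> carrier (ring_on B')" "x \<in> {b \<odot>\<^bsub>H\<^esub> e2b | b. b \<in> B'}" for a x
    proof -
      obtain b where "b \<in> B'" "x = b \<odot>\<^bsub>H\<^esub> e2b" using \<open>x \<in> _\<close> by blast
      then show ?thesis
        using \<open>a \<in> _\<close> D(5)[of a b] H.smult_assoc1[of a b e2b] e2b_carrier
        by (auto intro!: exI[of _ "a * b"])
    qed
  qed (use e2b_carrier in auto)
  then show ?thesis unfolding U_B'_def by (rule submodule.submodule_is_module[OF _ H])
qed

lemma U_B'_frob_smult:
  assumes "b \<in> B'"
  shows "U_B'_frob H D \<omega> (b \<odot>\<^bsub>H\<^esub> e2b)
    = (frob1 b * ((-1) ^ ((CARD('p) - 1) div 2) * quot f_series (frob1 f_series))) \<odot>\<^bsub>H\<^esub> e2b"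
proof -
  have "(THE c. c \<in> B' \<and> b \<odot>\<^bsub>H\<^esub> e2b = c \<odot>\<^bsub>H\<^esub> e2b) = b"
    using assms smult_e2b_inj by (intro the_equality) auto
  then show ?thesis by (simp add: U_B'_frob_def Let_def)
qed

text \<open>In the coordinates of the two generators the reduction map is \<open>at_q1\<close>. As
  the target generator has no annihilator, its kernel is that of \<open>at_q1\<close>, which
  \<open>t_expansion\<close> identifies with (q - 1) S'.\<close>

lemma is_reduction_U':
  assumes odd_card: "odd CARD('p)"
  shows "is_reduction (ring_on S') tt U' U'_frob (ring_on B') at_q1 (U_B' H D \<omega>)
    (U_B'_frob H D \<omega>) (\<lambda>x. at_q1 x \<odot>\<^bsub>H\<^esub> e2b)"
  unfolding is_reduction_def
proof (intro conjI ballI)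
  have kernel: "{x \<in> S'. at_q1 x = 0} = {tt * x | x. x \<in> (S' :: 'p padic_int fps fps set)}"
  proof
    show "{x \<in> S'. at_q1 x = 0} \<subseteq> {tt * x | x. x \<in> (S' :: 'p padic_int fps fps set)}"
    proof
      fix x :: "'p padic_int fps fps" assume "x \<in> {x \<in> S'. at_q1 x = 0}"
      then show "x \<in> {tt * x | x. x \<in> S'}"
        using t_expansion[of x] tshift_S'[of x] by auto
    qed
    show "{tt * x | x. x \<in> (S' :: 'p padic_int fps fps set)} \<subseteq> {x \<in> S'. at_q1 x = 0}"
      by (auto simp: at_q1_mult intro: S'_ring const_S')
  qed
  show "at_q1 \<in> Ring.ring_hom (ring_on S') (ring_on (B' :: 'p padic_int fps set))"
    by (rule ring_hom_memI) (simp_all add: at_q1_S' at_q1_mult)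
  show "at_q1 ` carrier (ring_on S') = carrier (ring_on (B' :: 'p padic_int fps set))"
    by (simp add: at_q1_image_S')
  show "{a \<in> carrier (ring_on S'). at_q1 a = \<zero>\<^bsub>ring_on (B' :: 'p padic_int fps set)\<^esub>}
      = {tt \<otimes>\<^bsub>ring_on S'\<^esub> a | a. a \<in> carrier (ring_on (S' :: 'p padic_int fps fps set))}"
    using kernel by simp
  show "module (ring_on S') (U' :: (_, 'p padic_int fps fps) module)"
    unfolding U'_def by (rule module_module_on[OF closed_subring_S'])
  show "module (ring_on B') (U_B' H D \<omega>)" by (rule module_U_B')
  show "semilinear_map (ring_on S') at_q1 U' (U_B' H D \<omega>) (\<lambda>x. at_q1 x \<odot>\<^bsub>H\<^esub> e2b)"
    unfolding semilinear_map_def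
  proof (intro conjI ballI)
    show "at_q1 x \<odot>\<^bsub>H\<^esub> e2b \<in> carrier (U_B' H D \<omega>)" if "x \<in> carrier U'" for x :: "'p padic_int fps fps"
      using that at_q1_S'[of x] unfolding carrier_U_B' U'_def by auto
  qed (use e2b_carrier H.smult_l_distr H.smult_assoc1 in \<open>simp_all add: U'_def U_B'_def at_q1_mult\<close>)
  show "(\<lambda>x. at_q1 x \<odot>\<^bsub>H\<^esub> e2b) ` carrier U' = carrier (U_B' H D \<omega>)"
    unfolding carrier_U_B' by (auto simp: U'_def at_q1_image_S'[symmetric])
  have "at_q1 x \<odot>\<^bsub>H\<^esub> e2b = \<zero>\<^bsub>H\<^esub> \<longleftrightarrow> at_q1 x = 0" for x :: "'p padic_int fps fps"
    using smult_e2b_eq_0 H.smult_l_null[OF e2b_carrier] by auto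
  then show "{x \<in> carrier U'. at_q1 x \<odot>\<^bsub>H\<^esub> e2b = \<zero>\<^bsub>U_B' H D \<omega>\<^esub>}
      = {tt \<odot>\<^bsub>U'\<^esub> x | x. x \<in> carrier U'}"
    using kernel by (simp add: U'_def U_B'_def)
  show "at_q1 (U'_frob x) \<odot>\<^bsub>H\<^esub> e2b = U_B'_frob H D \<omega> (at_q1 x \<odot>\<^bsub>H\<^esub> e2b)"
    if "x \<in> carrier U'" for x :: "'p padic_int fps fps"
  proof -
    have "at_q1 x \<in> B'" using that by (simp add: U'_def at_q1_S')
    then show ?thesis
      by (simp add: U_B'_frob_smult U'_frob_eq[OF odd_card] at_q1_mult at_q1_power at_q1_frob[OF odd_card]
          at_q1_frob_ratio[OF odd_card])
  qed
qed

end

theorem mainTheorem3: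
  fixes H :: "('p::prime_card padic_int fps, 'h) module" and D :: "'h \<Rightarrow> 'h" and \<omega> :: 'h
  assumes "odd CARD('p)"
    and "legendre_de_rham H D \<omega>"
  shows
    "semilinear_action (ring_on S') (Gamma_semidirect :: ('p padic_int \<times> 'p padic_int) monoid)
       Gamma_act U' U'_act \<and>
     (\<forall>l\<in>padic_units. \<forall>x\<in>carrier U'. U'_act (l :: 'p padic_int, 0) x = U'_sigma l x) \<and>
     (\<forall>m. \<forall>x\<in>carrier U'. U'_act (1 :: 'p padic_int, m) x = U'_rho m x) \<and>
     MF00_object (ring_on S') (of_nat CARD('p)) (fps_const fps_X) frob
       (Gamma_semidirect :: ('p padic_int \<times> 'p padic_int) monoid) Gamma_topology Gamma_act
       U' U'_frob U'_act \<and>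
     (\<exists>\<pi>. \<pi> e2' = e2_bar H D \<omega> \<and>
       is_reduction (ring_on S') (fps_const fps_X) U' U'_frob
         (ring_on B') at_q1 (U_B' H D \<omega>) (U_B'_frob H D \<omega>) \<pi>)"
proof (intro conjI ballI allI exI)
  \<comment> \<open>For an element of one of the two subgroups, the other factor of
    \<open>U'_act\<close> is the ratio of F to itself.\<close>
  have quot_self: "quot F_series F_series = (1 :: 'p padic_int fps fps)"
    by (rule quot_eqI) (simp_all add: FF_neq_0[OF assms(1)])
  show "U'_act (l, 0) x = U'_sigma l x" for l and x :: "'p padic_int fps fps"
    by (simp add: U'_act_def U'_rho_def e2'_def quot_self)
  show "U'_act (1, m) x = U'_rho m x" for m and x :: "'p padic_int fps fps"
    by (simp add: U'_act_def U'_sigma_def e2'_def quot_self)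
  show "at_q1 e2' \<odot>\<^bsub>H\<^esub> e2_bar H D \<omega> = e2_bar H D \<omega>"
  proof -
    interpret module "ring_on (UNIV :: 'p padic_int fps set)" H
      using assms(2) by (simp add: legendre_de_rham_def)
    show ?thesis using smult_one[OF e2b_carrier[OF assms(2)]] by (simp add: e2'_def)
  qed
qed (rule semilinear_action_U'[OF assms(1)] MF00_object_U'[OF assms(1)] is_reduction_U'[OF assms(2,1)])+

end
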